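(* Let $\Omega\subset\mathbb{R}^n$ be a Lebesgue measurable set and $f:\Omega\to\mathbb{R}$ a function such that for almost every $x\in\Omega$ there exists $\xi_x\in\mathbb{R}^n$ with $$\liminf_{y\to x,\ y\in\Omega}\frac{f(y)-f(x)-\langle\xi_x,y-x\rangle}{|y-x|^2}>-\infty.$$ Then for every $\varepsilon>0$ there exists $g\in C^2(\mathbb{R}^n)$ such that $\mathcal{L}^n(\{x\in\Omega: f(x)\neq g(x)\})\le\varepsilon$.
   Context: $\mathcal{L}^n$ denotes Lebesgue measure on $\mathbb{R}^n$, $\langle\cdot,\cdot\rangle$ the Euclidean inner product. *)

theory Defs
  imports "HOL-Analysis.Analysis"
begin

definition C2_on_UNIV :: "('a::euclidean_space \<Rightarrow> real) \<Rightarrow> bool" where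
  "C2_on_UNIV g \<longleftrightarrow>
     (\<exists>G :: 'a \<Rightarrow> 'a. \<exists>H :: 'a \<Rightarrow> ('a \<Rightarrow>\<^sub>L 'a).
        (\<forall>x. (g has_derivative (\<lambda>h. G x \<bullet> h)) (at x)) \<and>
        (\<forall>x. (G has_derivative blinfun_apply (H x)) (at x)) \<and>
        continuous_on UNIV H)"

end

theory Submission
  imports Defs
begin

text \<open>
  At almost every point \<open>f\<close> has a supporting paraboloid from below. On a small piece where
  the opening of these paraboloids is uniformly bounded, \<open>f\<close> plus a quadratic behaves like a convex
  function: the map sending a point to its (shifted) subgradient has a Lipschitz left inverse.
  By the theorems of Rademacher and Sard this inverse has an injective derivative at the relevant
  points outside an exceptional set with null image, which turns the lower bound into a
  two-sided quadratic bound with Lipschitz gradients. Thus \<open>f\<close> agrees, on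
  countably many pieces covering almost all of \<open>\<Omega>\<close>, with \<open>C\<^sup>1\<^sup>,\<^sup>1\<close> functions, obtained from the
  convex envelope of an infimum of paraboloids.

  A \<open>C\<^sup>1\<^sup>,\<^sup>1\<close> function has a \<open>C\<^sup>2\<close> Lusin approximation by iteration: where its gradient is uniformly
  differentiable, the difference from a mollification at a fine enough scale satisfies a quadratic
  jet bound with a tiny constant at all scales. Extending this jet gives a new \<open>C\<^sup>1\<^sup>,\<^sup>1\<close> function
  with tiny bound, so the mollifications sum to a \<open>C\<^sup>2\<close> function.
\<close>

text \<open>The hypothesis is one-sided and says nothing about measurability of \<open>f\<close>.
  The same lower paraboloids supply the latter, since they make \<open>f\<close> lower
  semicontinuous relative to \<Omega> at almost every point. Two obstacles shape the rest. A null
  set of shifted subgradients says nothing by itself about the points that carry them, so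
  exceptional points are always exhibited as images under the Lipschitz inverse. And extending a
  first-order jet multiplies its constant by 72 and yields only a Lipschitz gradient, so a single
  extension cannot reach C^2. The factor does no harm because the constant demanded of the next
  remainder is fixed before the scale of mollification: the remainders get the constants 2^-n, each
  step giving up a set of geometrically decreasing measure. The Hessian of a mollification is
  bounded by the constant of the function it smooths, so the series of Hessians converges
  uniformly.\<close>

section \<open>Extension of quadratically bounded jets\<close>

text \<open>Whitney's compatibility condition for a first-order jet of class C^{1,1}, with one
  constant for both clauses. On \<open>UNIV\<close> it says that \<open>G\<close> is the gradient of
  \<open>f\<close> and is Lipschitz.\<close>

definition jet_bound :: "'a::euclidean_space set \<Rightarrow> ('a \<Rightarrow> real) \<Rightarrow> ('a \<Rightarrow> 'a) \<Rightarrow> real \<Rightarrow> bool" where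
  "jet_bound E f G M \<longleftrightarrow>
     (\<forall>x\<in>E. \<forall>y\<in>E. \<bar>f y - f x - G x \<bullet> (y - x)\<bar> \<le> M * (norm (y - x))\<^sup>2 \<and>
                    norm (G y - G x) \<le> M * norm (y - x))"

lemma jet_boundD:
  assumes "jet_bound E f G M" "x \<in> E" "y \<in> E"
  shows "\<bar>f y - f x - G x \<bullet> (y - x)\<bar> \<le> M * (norm (y - x))\<^sup>2"
    and "norm (G y - G x) \<le> M * norm (y - x)"
  using assms by (auto simp: jet_bound_def)

lemma jet_bound_mono:
  assumes "jet_bound E f G M" "M \<le> M'"
  shows "jet_bound E f G M'"
  unfolding jet_bound_def
proof (intro ballI conjI)
  fix x y assume xy: "x \<in> E" "y \<in> E"
  have "M * (norm (y - x))\<^sup>2 \<le> M' * (norm (y - x))\<^sup>2" "M * norm (y - x) \<le> M' * norm (y - x)"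
    using assms(2) by (auto intro: mult_right_mono)
  then show "\<bar>f y - f x - G x \<bullet> (y - x)\<bar> \<le> M' * (norm (y - x))\<^sup>2" "norm (G y - G x) \<le> M' * norm (y - x)"
    using jet_boundD[OF assms(1) xy] by linarith+
qed

lemma quadratic_bound_imp_has_derivative:
  fixes g :: "'a::euclidean_space \<Rightarrow> real"
  assumes q: "\<And>y. \<bar>g y - g x - p \<bullet> (y - x)\<bar> \<le> C * (norm (y - x))\<^sup>2"
  shows "(g has_derivative (\<lambda>h. p \<bullet> h)) (at x)"
  unfolding has_derivative_at_alt
proof (intro conjI allI impI)
  show "bounded_linear ((\<bullet>) p)" by (rule bounded_linear_inner_right)
  fix e :: real assume "e > 0"
  show "\<exists>d>0. \<forall>y. norm (y - x) < d \<longrightarrow> norm (g y - g x - p \<bullet> (y - x)) \<le> e * norm (y - x)"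
  proof (intro exI conjI allI impI)
    show "e / (\<bar>C\<bar> + 1) > 0" using \<open>e > 0\<close> by simp
    fix y assume y: "norm (y - x) < e / (\<bar>C\<bar> + 1)"
    have "norm (y - x) * (\<bar>C\<bar> + 1) \<le> e" using y by (simp add: field_simps)
    then have "(\<bar>C\<bar> * norm (y - x)) * norm (y - x) \<le> e * norm (y - x)"
      by (intro mult_right_mono) (auto simp: algebra_simps intro: order_trans[rotated])
    moreover have "C * (norm (y - x))\<^sup>2 \<le> \<bar>C\<bar> * (norm (y - x))\<^sup>2"
      by (intro mult_right_mono) auto
    ultimately show "norm (g y - g x - p \<bullet> (y - x)) \<le> e * norm (y - x)"
      using q[of y] by (simp add: power2_eq_square mult.assoc)
  qed
qed

lemma jet_bound_has_derivative:
  assumes "jet_bound UNIV g G M"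
  shows "(g has_derivative (\<lambda>h. G x \<bullet> h)) (at x)"
  using jet_boundD(1)[OF assms] by (intro quadratic_bound_imp_has_derivative) auto

lemma jet_bound_continuous:
  assumes "jet_bound UNIV g G M"
  shows "continuous_on S g"
  by (meson assms jet_bound_has_derivative continuous_at_imp_continuous_on has_derivative_continuous)

lemma jet_bound_nonneg:
  fixes g :: "'a::euclidean_space \<Rightarrow> real"
  assumes "jet_bound UNIV g G M"
  shows "M \<ge> 0"
proof -
  obtain b :: 'a where "b \<in> Basis" by fastforce
  then show ?thesis
    using jet_boundD(2)[OF assms, of 0 b] by (simp add: order_trans[OF norm_ge_zero])
qed

lemma jet_bound_lipschitz:
  assumes "jet_bound UNIV g G M"
  shows "M-lipschitz_on S G"
  using jet_boundD(2)[OF assms] jet_bound_nonneg[OF assms]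
  by (intro lipschitz_onI) (auto simp: dist_norm)

text \<open>Expand at \<open>x\<close> and at \<open>y\<close> and compare at the common point
  \<open>y + v\<close>, where \<open>v\<close> has length r = |y - x| and points along
  \<open>G y - G x\<close>. What remains is r |G y - G x|, and the errors C (2r)^2, C r^2, C r^2 add
  up to the factor 6.\<close>

lemma quadratic_bound_imp_jet_bound:
  fixes g :: "'a::euclidean_space \<Rightarrow> real"
  assumes q: "\<And>x y. \<bar>g y - g x - G x \<bullet> (y - x)\<bar> \<le> C * (norm (y - x))\<^sup>2"
  shows "jet_bound UNIV g G (6 * C)"
proof -
  obtain b :: 'a where "b \<in> Basis" by fastforce
  then have C: "C \<ge> 0" using order_trans[OF abs_ge_zero q[of b 0]] by simp
  have "norm (G y - G x) \<le> 6 * C * norm (y - x)" for x y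
  proof (cases "G y = G x \<or> y = x")
    case True then show ?thesis using C by auto
  next
    case False
    define r where "r = norm (y - x)"
    define w where "w = G y - G x"
    define v where "v = (r / norm w) *\<^sub>R w"
    have r: "r > 0" and w: "norm w > 0" using False by (auto simp: r_def w_def)
    have v: "norm v = r" "w \<bullet> v = r * norm w"
      using r w by (auto simp: v_def dot_square_norm power2_eq_square)
    have "norm (y + v - x) \<le> 2 * r"
      using norm_triangle_ineq[of "y - x" v] v by (simp add: r_def algebra_simps)
    then have "(norm (y + v - x))\<^sup>2 \<le> (2 * r)\<^sup>2" by (intro power_mono) auto
    then have b: "\<bar>g (y + v) - g x - G x \<bullet> (y + v - x)\<bar> \<le> C * (2 * r)\<^sup>2"
      using q[of "y + v" x] C by (meson mult_left_mono order_trans)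
    have "w \<bullet> v = (g (y + v) - g x - G x \<bullet> (y + v - x)) - (g y - g x - G x \<bullet> (y - x))
                  - (g (y + v) - g y - G y \<bullet> (y + v - y))"
      by (simp add: w_def algebra_simps inner_simps)
    then have "w \<bullet> v \<le> C * (2 * r)\<^sup>2 + C * r\<^sup>2 + C * r\<^sup>2"
      using b q[of y x] q[of "y + v" y] v by (simp add: r_def)
    then have "r * norm w \<le> r * (6 * C * r)"
      using v by (simp add: power2_eq_square algebra_simps)
    then show ?thesis using r by (simp add: w_def r_def)
  qed
  moreover have "C * (norm (y - x))\<^sup>2 \<le> 6 * C * (norm (y - x))\<^sup>2" for x y :: 'a
    using C by (intro mult_right_mono) auto
  ultimately show ?thesis
    unfolding jet_bound_def using q order_trans by blast
qed

lemma inner_le_quadratic_imp_0: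
  fixes d :: "'a::real_inner"
  assumes "\<And>v. d \<bullet> v \<le> K * (norm v)\<^sup>2"
  shows "d = 0"
proof (rule ccontr)
  assume "d \<noteq> 0"
  define t where "t = 1 / (2 * \<bar>K\<bar> + 1)"
  have t: "t > 0" "\<bar>K\<bar> * t < 1" by (auto simp: t_def field_simps)
  have "K * t \<le> \<bar>K\<bar> * t" using t by (intro mult_right_mono) auto
  then have "K * t < 1" using t by linarith
  have "t * (norm d)\<^sup>2 \<le> (K * t) * (t * (norm d)\<^sup>2)"
    using assms[of "t *\<^sub>R d"] t by (simp add: dot_square_norm power2_eq_square mult_ac)
  moreover have "t * (norm d)\<^sup>2 > 0" using t \<open>d \<noteq> 0\<close> by simp
  ultimately show False using \<open>K * t < 1\<close> by (smt (verit) mult_less_cancel_right2)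
qed

text \<open>Minorants whose value at \<open>x\<close> is at least that of the given one have
  coefficients in a compact set: the point x + p/|p| bounds |p| by \<open>B - v0\<close>, and the
  value \<open>b x\<close> then bounds the constant term. The supremum at \<open>x\<close> is
  therefore attained, and the slope of a maximiser serves as a subgradient of the convex
  envelope.\<close>

lemma greatest_affine_minorant:
  fixes b :: "'a::euclidean_space \<Rightarrow> real"
  assumes mino: "\<And>w. \<alpha>0 + p0 \<bullet> w \<le> b w" and bd: "\<And>w. norm (w - x) \<le> 1 \<Longrightarrow> b w \<le> B"
  obtains \<alpha> p where "\<And>w. \<alpha> + p \<bullet> w \<le> b w"
    "\<And>\<alpha>' p'. (\<And>w. \<alpha>' + p' \<bullet> w \<le> b w) \<Longrightarrow> \<alpha>' + p' \<bullet> x \<le> \<alpha> + p \<bullet> x"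
proof -
  define v0 where "v0 = \<alpha>0 + p0 \<bullet> x"
  define S where "S = {c. fst c + snd c \<bullet> x \<ge> v0} \<inter> (\<Inter>w. {c. fst c + snd c \<bullet> w \<le> b w})"
  have "closed S"
    unfolding S_def by (intro closed_Int closed_INT ballI closed_Collect_le continuous_intros)
  moreover have "bounded S"
  proof (rule bounded_subset)
    let ?P = "B - v0" and ?A = "\<bar>v0\<bar> + \<bar>b x\<bar> + \<bar>B - v0\<bar> * norm x"
    show "bounded (cball 0 ?A \<times> cball (0::'a) \<bar>?P\<bar>)" by (intro bounded_Times) auto
    show "S \<subseteq> cball 0 ?A \<times> cball 0 \<bar>?P\<bar>"
    proof
      fix c assume c: "c \<in> S"
      obtain \<alpha> p where cc: "c = (\<alpha>, p)" by (cases c)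
      have 1: "v0 \<le> \<alpha> + p \<bullet> x" and 2: "\<And>w. \<alpha> + p \<bullet> w \<le> b w" using c by (auto simp: S_def cc)
      have np: "norm p \<le> \<bar>?P\<bar>"
      proof (cases "p = 0")
        case False
        have "p \<bullet> (x + p /\<^sub>R norm p) = p \<bullet> x + norm p"
          using False by (simp add: inner_simps dot_square_norm power2_eq_square)
        then show ?thesis using 1 2[of "x + p /\<^sub>R norm p"] bd[of "x + p /\<^sub>R norm p"] False by simp
      qed auto
      have "\<bar>p \<bullet> x\<bar> \<le> \<bar>?P\<bar> * norm x"
        using Cauchy_Schwarz_ineq2[of p x] np by (meson mult_right_mono norm_ge_zero order_trans)
      then have "\<bar>\<alpha>\<bar> \<le> ?A" using 1 2[of x] by linarith
      then show "c \<in> cball 0 ?A \<times> cball 0 \<bar>?P\<bar>" using np by (simp add: cc)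
    qed
  qed
  ultimately have "compact S" using compact_eq_bounded_closed by blast
  moreover have "(\<alpha>0, p0) \<in> S" using mino by (auto simp: S_def v0_def)
  moreover have "continuous_on S (\<lambda>c. fst c + snd c \<bullet> x)" by (intro continuous_intros)
  ultimately obtain c where c: "c \<in> S" and cmax: "\<And>c'. c' \<in> S \<Longrightarrow> fst c' + snd c' \<bullet> x \<le> fst c + snd c \<bullet> x"
    using continuous_attains_sup[of S "\<lambda>c. fst c + snd c \<bullet> x"] by blast
  show thesis
  proof (rule that[of "fst c" "snd c"])
    show "\<And>w. fst c + snd c \<bullet> w \<le> b w" using c by (auto simp: S_def)
    fix \<alpha>' p' assume m: "\<And>w. \<alpha>' + p' \<bullet> w \<le> b w"
    show "\<alpha>' + p' \<bullet> x \<le> fst c + snd c \<bullet> x"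
    proof (cases "v0 \<le> \<alpha>' + p' \<bullet> x")
      case True
      then show ?thesis using cmax[of "(\<alpha>', p')"] m by (auto simp: S_def)
    next
      case False then show ?thesis using c by (auto simp: S_def)
    qed
  qed
qed

text \<open>\<open>F\<close> is the convex envelope of \<open>b\<close>, the supremum of its affine
  minorants, and \<open>P\<close> a choice of subgradient. The envelope inherits semiconcavity from
  \<open>b\<close>; combined with the subgradient inequality at the reflected point x - (y - x),
  this bounds the increment towards \<open>y\<close> from above.\<close>

lemma convex_envelope_semiconcave:
  fixes b :: "'a::euclidean_space \<Rightarrow> real"
  assumes mino: "\<And>w. \<alpha>0 + p0 \<bullet> w \<le> b w"
    and bd: "\<And>x. \<exists>B. \<forall>w. norm (w - x) \<le> 1 \<longrightarrow> b w \<le> B"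
    and semi: "\<And>w h. b (w + h) + b (w - h) \<le> 2 * b w + C * (norm h)\<^sup>2"
  obtains F P where "\<And>x y. 0 \<le> F y - F x - P x \<bullet> (y - x)"
    "\<And>x y. F y - F x - P x \<bullet> (y - x) \<le> C * (norm (y - x))\<^sup>2"
    "\<And>x. F x \<le> b x"
    "\<And>\<alpha> p x. (\<And>w. \<alpha> + p \<bullet> w \<le> b w) \<Longrightarrow> \<alpha> + p \<bullet> x \<le> F x"
proof -
  have "\<exists>\<alpha> p. (\<forall>w. \<alpha> + p \<bullet> w \<le> b w) \<and> (\<forall>\<alpha>' p'. (\<forall>w. \<alpha>' + p' \<bullet> w \<le> b w) \<longrightarrow> \<alpha>' + p' \<bullet> x \<le> \<alpha> + p \<bullet> x)" for x
  proof -
    obtain B where B: "\<And>w. norm (w - x) \<le> 1 \<Longrightarrow> b w \<le> B" using bd by blast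
    show ?thesis by (rule greatest_affine_minorant[of \<alpha>0 p0 b x B, OF mino B]) blast+
  qed
  then obtain A P where AP: "\<And>x w. A x + P x \<bullet> w \<le> b w"
    and mx: "\<And>x \<alpha>' p'. (\<And>w. \<alpha>' + p' \<bullet> w \<le> b w) \<Longrightarrow> \<alpha>' + p' \<bullet> x \<le> A x + P x \<bullet> x"
    by metis
  define F where "F x = A x + P x \<bullet> x" for x
  have sub: "0 \<le> F y - F x - P x \<bullet> (y - x)" for x y
    using mx[of "A x" "P x" y] AP by (simp add: F_def inner_simps)
  \<comment> \<open>Averaging affine minorants at the two shifted points gives an affine minorant at the midpoint.\<close>
  have mid: "F (x + h) + F (x - h) \<le> 2 * F x + C * (norm h)\<^sup>2" for x h
  proof -
    let ?\<alpha> = "((A (x + h) + P (x + h) \<bullet> h) + (A (x - h) - P (x - h) \<bullet> h) - C * (norm h)\<^sup>2) / 2"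
    let ?p = "(1 / 2) *\<^sub>R (P (x + h) + P (x - h))"
    have "?\<alpha> + ?p \<bullet> w \<le> b w" for w
      using AP[of "x + h" "w + h"] AP[of "x - h" "w - h"] semi[of w h]
      by (simp add: inner_simps field_simps)
    from mx[of ?\<alpha> ?p x, OF this] show ?thesis
      by (simp add: F_def inner_simps field_simps)
  qed
  have "F y - F x - P x \<bullet> (y - x) \<le> C * (norm (y - x))\<^sup>2" for x y
    using mid[of x "y - x"] sub[of "x - (y - x)" x] by (simp add: inner_simps)
  then show thesis
    using that[of F P] sub AP mx unfolding F_def by blast
qed

text \<open>The paraboloids \<open>q x\<close> from above and \<open>l y\<close> from below, of
  opening 4 M, touch the data at their centres and are ordered by \<open>lq\<close>, so a C^{1,1}
  function between them has the prescribed jet on \<open>E\<close>. Adding 4 M |w|^2 makes every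
  \<open>l y\<close> affine and the infimum of the \<open>q x\<close> semiconcave; the convex
  envelope of that infimum then lies between the two families. Its expansion has error at most 12 M
  |y - x|^2, and \<open>quadratic_bound_imp_jet_bound\<close> turns 12 into 72.\<close>

lemma jet_extension:
  fixes f :: "'a::euclidean_space \<Rightarrow> real"
  assumes jet: "jet_bound E f \<xi> M" and M: "M \<ge> 0"
  obtains g G where "jet_bound UNIV g G (72 * M)" "\<And>x. x \<in> E \<Longrightarrow> g x = f x" "\<And>x. x \<in> E \<Longrightarrow> G x = \<xi> x"
proof (cases "E = {}")
  case True
  have "jet_bound (UNIV::'a set) (\<lambda>_. 0) (\<lambda>_. 0) (72 * M)" using M by (auto simp: jet_bound_def)
  then show thesis using that True by blast
next
  case False
  define q where "q x w = f x + \<xi> x \<bullet> (w - x) + 4 * M * (norm (w - x))\<^sup>2" for x w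
  define l where "l x w = f x + \<xi> x \<bullet> (w - x) - 4 * M * (norm (w - x))\<^sup>2" for x w
  \<comment> \<open>The opening 4 M suffices because d^2 + d c <= 4 (a^2 + c^2) whenever d <= a +
    c.\<close>
  have lq: "l y w \<le> q x w" if "x \<in> E" "y \<in> E" for x y w
  proof -
    define a where "a = norm (w - x)"
    define c where "c = norm (w - y)"
    define d where "d = norm (y - x)"
    have nn: "a \<ge> 0" "c \<ge> 0" "d \<ge> 0" by (auto simp: a_def c_def d_def)
    have d: "d \<le> a + c" using norm_triangle_ineq4[of "w - x" "w - y"] by (simp add: a_def c_def d_def)
    have "(\<xi> y - \<xi> x) \<bullet> (w - y) \<le> norm (\<xi> y - \<xi> x) * c" unfolding c_def by (rule norm_cauchy_schwarz)
    also have "\<dots> \<le> M * d * c"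
      using jet_boundD(2)[OF jet that] nn by (intro mult_right_mono) (auto simp: d_def)
    finally have 1: "(\<xi> y - \<xi> x) \<bullet> (w - y) \<le> M * d * c" .
    have 2: "f y - f x - \<xi> x \<bullet> (y - x) \<le> M * d\<^sup>2"
      using jet_boundD(1)[OF jet that] by (simp add: d_def)
    have "d\<^sup>2 + d * c \<le> (a + c)\<^sup>2 + (a + c) * c"
      using d nn by (intro add_mono power_mono mult_right_mono) auto
    also have "\<dots> \<le> 4 * a\<^sup>2 + 4 * c\<^sup>2"
    proof -
      have "4 * a\<^sup>2 + 4 * c\<^sup>2 - ((a + c)\<^sup>2 + (a + c) * c) = (3 * (a - c)\<^sup>2 + 3 * a\<^sup>2 + c\<^sup>2) / 2"
        by (simp add: power2_eq_square field_simps)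
      moreover have "\<dots> \<ge> 0" by simp
      ultimately show ?thesis by linarith
    qed
    finally have "M * (d\<^sup>2 + d * c) \<le> M * (4 * a\<^sup>2 + 4 * c\<^sup>2)" using M by (rule mult_left_mono)
    moreover have "l y w - q x w = (f y - f x - \<xi> x \<bullet> (y - x)) + (\<xi> y - \<xi> x) \<bullet> (w - y) - 4 * M * (a\<^sup>2 + c\<^sup>2)"
      by (simp add: l_def q_def a_def c_def inner_simps algebra_simps)
    ultimately show ?thesis using 1 2 by (simp add: algebra_simps)
  qed
  obtain x0 where x0: "x0 \<in> E" using False by blast
  define u where "u w = (INF x\<in>E. q x w)" for w
  have bb: "bdd_below ((\<lambda>x. q x w) ` E)" for w
    using lq[OF _ x0] by (intro bdd_belowI[of _ "l x0 w"]) auto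
  have uq: "u w \<le> q x w" if "x \<in> E" for x w
    unfolding u_def by (rule cINF_lower[OF bb that])
  have lu: "l y w \<le> u w" if "y \<in> E" for y w
    unfolding u_def using lq that False by (intro cINF_greatest) auto
  define b where "b w = u w + 4 * M * (norm w)\<^sup>2" for w
  have laff: "l y w + 4 * M * (norm w)\<^sup>2 = (f y - \<xi> y \<bullet> y - 4 * M * (norm y)\<^sup>2) + (\<xi> y + (8 * M) *\<^sub>R y) \<bullet> w" for y w
    by (simp add: l_def power2_norm_eq_inner inner_simps inner_commute[of w y] algebra_simps)
  have mino: "(f y - \<xi> y \<bullet> y - 4 * M * (norm y)\<^sup>2) + (\<xi> y + (8 * M) *\<^sub>R y) \<bullet> w \<le> b w" if "y \<in> E" for y w
    unfolding laff[symmetric] b_def using lu[OF that] by simp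
  have bd: "\<exists>B. \<forall>w. norm (w - x) \<le> 1 \<longrightarrow> b w \<le> B" for x
  proof -
    have "continuous_on (cball x 1) (\<lambda>w. q x0 w + 4 * M * (norm w)\<^sup>2)"
      unfolding q_def by (intro continuous_intros)
    then obtain B where "\<And>w. w \<in> cball x 1 \<Longrightarrow> q x0 w + 4 * M * (norm w)\<^sup>2 \<le> B"
      using continuous_attains_sup[of "cball x 1" "\<lambda>w. q x0 w + 4 * M * (norm w)\<^sup>2"] by force
    then have "\<forall>w. norm (w - x) \<le> 1 \<longrightarrow> b w \<le> B"
      using uq[OF x0] unfolding b_def
      by (metis add_le_cancel_right dist_commute dist_norm mem_cball order_trans)
    then show ?thesis by blast
  qed
  have semi: "b (w + h) + b (w - h) \<le> 2 * b w + 16 * M * (norm h)\<^sup>2" for w h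
  proof -
    have "(u (w + h) + u (w - h) - 8 * M * (norm h)\<^sup>2) / 2 \<le> u w"
      unfolding u_def[of w]
    proof (rule cINF_greatest[OF False])
      fix x assume "x \<in> E"
      have "q x (w + h) + q x (w - h) = 2 * q x w + 8 * M * (norm h)\<^sup>2"
        by (simp add: q_def power2_norm_eq_inner inner_simps inner_commute algebra_simps)
      then show "(u (w + h) + u (w - h) - 8 * M * (norm h)\<^sup>2) / 2 \<le> q x w"
        using uq[OF \<open>x \<in> E\<close>, of "w + h"] uq[OF \<open>x \<in> E\<close>, of "w - h"] by simp
    qed
    moreover have "4 * M * (norm (w + h))\<^sup>2 + 4 * M * (norm (w - h))\<^sup>2 = 8 * M * (norm w)\<^sup>2 + 8 * M * (norm h)\<^sup>2"
      by (simp add: power2_norm_eq_inner inner_simps inner_commute algebra_simps)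
    ultimately show ?thesis by (simp add: b_def)
  qed
  obtain F P where F: "\<And>x y. 0 \<le> F y - F x - P x \<bullet> (y - x)"
    "\<And>x y. F y - F x - P x \<bullet> (y - x) \<le> 16 * M * (norm (y - x))\<^sup>2"
    "\<And>x. F x \<le> b x" "\<And>\<alpha> p x. (\<And>w. \<alpha> + p \<bullet> w \<le> b w) \<Longrightarrow> \<alpha> + p \<bullet> x \<le> F x"
    using convex_envelope_semiconcave[OF mino[OF x0] bd semi] by metis
  define g where "g w = F w - 4 * M * (norm w)\<^sup>2" for w
  define G where "G w = P w - (8 * M) *\<^sub>R w" for w
  have quad: "\<bar>g y - g x - G x \<bullet> (y - x)\<bar> \<le> 12 * M * (norm (y - x))\<^sup>2" for x y
  proof -
    have "g y - g x - G x \<bullet> (y - x) = (F y - F x - P x \<bullet> (y - x)) - 4 * M * (norm (y - x))\<^sup>2"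
      by (simp add: g_def G_def power2_norm_eq_inner inner_simps inner_commute algebra_simps)
    moreover have "M * (norm (y - x))\<^sup>2 \<ge> 0" using M by simp
    ultimately show ?thesis using F(1)[where x=x and y=y] F(2)[where x=x and y=y] by linarith
  qed
  have gu: "g w \<le> u w" for w using F(3)[of w] by (simp add: g_def b_def)
  have gl: "l y w \<le> g w" if "y \<in> E" for y w
  proof -
    have "l y w + 4 * M * (norm w)\<^sup>2 \<le> F w"
      unfolding laff by (rule F(4)) (rule mino[OF that])
    then show ?thesis by (simp add: g_def)
  qed
  have gf: "g x = f x" if "x \<in> E" for x
    using gl[OF that, of x] gu[of x] uq[OF that, of x] by (simp add: l_def q_def)
  \<comment> \<open>\<open>g\<close> lies above \<open>l x\<close> and meets it at \<open>x\<close>,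
    which forces the two gradients to agree there.\<close>
  have G\<xi>: "G x = \<xi> x" if x: "x \<in> E" for x
  proof -
    have "(\<xi> x - G x) \<bullet> v \<le> (16 * M) * (norm v)\<^sup>2" for v
      using gl[OF x, of "x + v"] quad[of "x + v" x] gf[OF x]
      by (simp add: l_def inner_simps)
    then have "\<xi> x - G x = 0" by (rule inner_le_quadratic_imp_0)
    then show ?thesis by simp
  qed
  show thesis
    using that[of g G] quadratic_bound_imp_jet_bound[of g G "12 * M", OF quad] gf G\<xi> by simp
qed

section \<open>Twice continuously differentiable functions\<close>

text \<open>Exposes the gradient and the Hessian hidden in \<open>C2_on_UNIV\<close>, because the
  series arguments need bounds on them.\<close>

definition C2_jet :: "('a::euclidean_space \<Rightarrow> real) \<Rightarrow> ('a \<Rightarrow> 'a) \<Rightarrow> ('a \<Rightarrow> ('a \<Rightarrow>\<^sub>L 'a)) \<Rightarrow> bool" where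
  "C2_jet g G H \<longleftrightarrow>
     (\<forall>x. (g has_derivative (\<lambda>h. G x \<bullet> h)) (at x)) \<and>
     (\<forall>x. (G has_derivative blinfun_apply (H x)) (at x)) \<and>
     continuous_on UNIV H"

lemma C2_on_UNIV_iff_C2_jet: "C2_on_UNIV g \<longleftrightarrow> (\<exists>G H. C2_jet g G H)"
  by (simp add: C2_on_UNIV_def C2_jet_def)

lemma C2_jetD:
  assumes "C2_jet g G H"
  shows "(g has_derivative (\<lambda>h. G x \<bullet> h)) (at x)" "(G has_derivative blinfun_apply (H x)) (at x)"
    "continuous_on S H" "continuous_on S G" "continuous_on S g"
proof -
  show 1: "(g has_derivative (\<lambda>h. G x \<bullet> h)) (at x)" "(G has_derivative blinfun_apply (H x)) (at x)" for x
    using assms by (auto simp: C2_jet_def)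
  show "continuous_on S H" using assms continuous_on_subset by (fastforce simp: C2_jet_def)
  show "continuous_on S G" "continuous_on S g"
    using 1 by (meson continuous_at_imp_continuous_on has_derivative_continuous)+
qed

lemma C2_on_UNIV_continuous: "C2_on_UNIV g \<Longrightarrow> continuous_on S g"
  using C2_jetD(5) by (auto simp: C2_on_UNIV_iff_C2_jet)

text \<open>The tensor product of two vectors as a bounded operator; it enters the Hessians of
  products and of compositions with real functions.\<close>

definition rank_one :: "'a::euclidean_space \<Rightarrow> 'a \<Rightarrow> 'a \<Rightarrow>\<^sub>L 'a" where
  "rank_one u v = blinfun_scaleR_left u o\<^sub>L blinfun_inner_right v"

lemma rank_one_apply [simp]: "blinfun_apply (rank_one u v) h = (v \<bullet> h) *\<^sub>R u"
  by (simp add: rank_one_def)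

lemma continuous_on_rank_one [continuous_intros]:
  assumes "continuous_on S f" "continuous_on S g"
  shows "continuous_on S (\<lambda>x. rank_one (f x) (g x))"
  unfolding rank_one_def
  by (intro bounded_bilinear.continuous_on[OF bounded_bilinear_blinfun_compose]
      bounded_linear.continuous_on[OF bounded_linear_blinfun_scaleR_left]
      bounded_linear.continuous_on[OF bounded_linear_blinfun_inner_right] assms)

lemma C2_jet_const: "C2_jet (\<lambda>_. c) (\<lambda>_. 0) (\<lambda>_. 0)"
  by (auto simp: C2_jet_def intro!: derivative_eq_intros)

lemma C2_jet_norm_square: "C2_jet (\<lambda>x. (norm x)\<^sup>2) (\<lambda>x. 2 *\<^sub>R x) (\<lambda>_. 2 *\<^sub>R id_blinfun)"
  unfolding C2_jet_def power2_norm_eq_inner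
  by (auto intro!: derivative_eq_intros simp: inner_commute scaleR_blinfun.rep_eq)

lemma C2_jet_add:
  assumes f: "C2_jet f F F'" and g: "C2_jet g G G'"
  shows "C2_jet (\<lambda>x. f x + g x) (\<lambda>x. F x + G x) (\<lambda>x. F' x + G' x)"
  unfolding C2_jet_def
  by (auto intro!: derivative_eq_intros continuous_intros C2_jetD[OF f] C2_jetD[OF g]
      simp: inner_simps plus_blinfun.rep_eq)

lemma C2_jet_mult:
  assumes f: "C2_jet f F F'" and g: "C2_jet g G G'"
  shows "C2_jet (\<lambda>x. f x * g x) (\<lambda>x. f x *\<^sub>R G x + g x *\<^sub>R F x)
    (\<lambda>x. f x *\<^sub>R G' x + rank_one (G x) (F x) + (g x *\<^sub>R F' x + rank_one (F x) (G x)))"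
  unfolding C2_jet_def
proof (intro conjI allI)
  show "((\<lambda>x. f x * g x) has_derivative (\<lambda>h. (f x *\<^sub>R G x + g x *\<^sub>R F x) \<bullet> h)) (at x)" for x
    by (auto intro!: derivative_eq_intros C2_jetD[OF f] C2_jetD[OF g] simp: inner_simps algebra_simps)
  show "((\<lambda>x. f x *\<^sub>R G x + g x *\<^sub>R F x) has_derivative
      blinfun_apply (f x *\<^sub>R G' x + rank_one (G x) (F x) + (g x *\<^sub>R F' x + rank_one (F x) (G x)))) (at x)" for x
    by (auto intro!: derivative_eq_intros C2_jetD[OF f] C2_jetD[OF g]
        simp: plus_blinfun.rep_eq scaleR_blinfun.rep_eq)
  show "continuous_on UNIV (\<lambda>x. f x *\<^sub>R G' x + rank_one (G x) (F x) + (g x *\<^sub>R F' x + rank_one (F x) (G x)))"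
    by (intro continuous_intros C2_jetD[OF f] C2_jetD[OF g])
qed

section \<open>Truncated powers and cutoff functions\<close>

lemma has_derivative_max_0_square:
  "((\<lambda>t. (max 0 t)\<^sup>2) has_real_derivative 2 * max 0 t) (at (t::real))"
proof -
  have "((\<lambda>t. (max 0 t)\<^sup>2) has_derivative (\<lambda>h. (2 * max 0 t) \<bullet> h)) (at t)"
  proof (rule quadratic_bound_imp_has_derivative[where C = 1])
    fix y :: real
    consider "0 \<le> t" "0 \<le> y" | "0 \<le> t" "y \<le> 0" | "t \<le> 0" "0 \<le> y" | "t \<le> 0" "y \<le> 0" by linarith
    then show "\<bar>(max 0 y)\<^sup>2 - (max 0 t)\<^sup>2 - (2 * max 0 t) \<bullet> (y - t)\<bar> \<le> 1 * (norm (y - t))\<^sup>2"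
    proof cases
      case 1
      have "y\<^sup>2 - t\<^sup>2 - 2 * t * (y - t) = (y - t)\<^sup>2" by (simp add: power2_eq_square algebra_simps)
      then show ?thesis using 1 by simp
    next
      case 2
      have ty: "2 * t * y \<le> 0" using 2 by (simp add: mult_nonneg_nonpos)
      have "0 \<le> t\<^sup>2 - 2 * t * y" using ty zero_le_power2[of t] by linarith
      moreover have "t\<^sup>2 - 2 * t * y \<le> (y - t)\<^sup>2"
        using zero_le_power2[of y] by (simp add: power2_diff mult_ac)
      moreover have "0 - t\<^sup>2 - (2 * t) * (y - t) = t\<^sup>2 - 2 * t * y" by (simp add: power2_eq_square algebra_simps)
      ultimately have "\<bar>0 - t\<^sup>2 - (2 * t) * (y - t)\<bar> \<le> (y - t)\<^sup>2" by linarith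
      then show ?thesis using 2 by (simp add: power2_commute[of t y])
    next
      case 3
      have "y\<^sup>2 \<le> (y - t)\<^sup>2" using 3 by (intro power_mono) auto
      then show ?thesis using 3 by simp
    next
      case 4 then show ?thesis by simp
    qed
  qed
  then show ?thesis by (simp add: has_field_derivative_def)
qed

text \<open>The third is the lowest integer power of the positive part that is twice continuously
  differentiable, so it can stand in for a smooth transition function.\<close>

lemma has_derivative_max_0_cube:
  "((\<lambda>t. (max 0 t) ^ 3) has_real_derivative 3 * (max 0 t)\<^sup>2) (at (t::real))"
proof -
  have eq: "(\<lambda>t::real. (max 0 t) ^ 3) = (\<lambda>t. t * (max 0 t)\<^sup>2)"
    by (auto simp: fun_eq_iff max_def power3_eq_cube power2_eq_square)
  have d: "((\<lambda>t. t * (max 0 t)\<^sup>2) has_real_derivative 1 * (max 0 t)\<^sup>2 + 2 * max 0 t * t) (at t)"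
    by (rule DERIV_mult[OF DERIV_ident has_derivative_max_0_square])
  have eq': "1 * (max 0 t)\<^sup>2 + 2 * max 0 t * t = 3 * (max 0 t)\<^sup>2"
    by (auto simp: max_def power2_eq_square)
  show ?thesis using d unfolding eq eq' .
qed

lemma C2_jet_max_0_cube:
  assumes w: "C2_jet w G H"
  shows "C2_jet (\<lambda>x. (max 0 (w x)) ^ 3) (\<lambda>x. (3 * (max 0 (w x))\<^sup>2) *\<^sub>R G x)
    (\<lambda>x. (3 * (max 0 (w x))\<^sup>2) *\<^sub>R H x + (6 * max 0 (w x)) *\<^sub>R rank_one (G x) (G x))"
  unfolding C2_jet_def
proof (intro conjI allI)
  note cube = has_derivative_max_0_cube[unfolded has_field_derivative_def]
  note square = has_derivative_max_0_square[unfolded has_field_derivative_def]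
  show "((\<lambda>x. (max 0 (w x)) ^ 3) has_derivative (\<lambda>h. ((3 * (max 0 (w x))\<^sup>2) *\<^sub>R G x) \<bullet> h)) (at x)" for x
    using has_derivative_compose[OF C2_jetD(1)[OF w] cube] by simp
  have "((\<lambda>x. (max 0 (w x))\<^sup>2) has_derivative (\<lambda>h. 2 * max 0 (w x) * (G x \<bullet> h))) (at x)" for x
    using has_derivative_compose[OF C2_jetD(1)[OF w] square] .
  from has_derivative_scaleR[OF has_derivative_mult_right[OF this, of 3] C2_jetD(2)[OF w]]
  show "((\<lambda>x. (3 * (max 0 (w x))\<^sup>2) *\<^sub>R G x) has_derivative
      blinfun_apply ((3 * (max 0 (w x))\<^sup>2) *\<^sub>R H x + (6 * max 0 (w x)) *\<^sub>R rank_one (G x) (G x))) (at x)" for x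
    by (simp add: plus_blinfun.rep_eq scaleR_blinfun.rep_eq mult.assoc)
  show "continuous_on UNIV (\<lambda>x. (3 * (max 0 (w x))\<^sup>2) *\<^sub>R H x + (6 * max 0 (w x)) *\<^sub>R rank_one (G x) (G x))"
    by (intro continuous_intros C2_jetD[OF w])
qed

lemma C2_on_UNIV_const: "C2_on_UNIV (\<lambda>_. c)"
  using C2_jet_const C2_on_UNIV_iff_C2_jet by blast

lemma C2_on_UNIV_norm_square: "C2_on_UNIV (\<lambda>x. (norm x)\<^sup>2)"
  using C2_jet_norm_square C2_on_UNIV_iff_C2_jet by blast

lemma C2_on_UNIV_mult: "C2_on_UNIV f \<Longrightarrow> C2_on_UNIV g \<Longrightarrow> C2_on_UNIV (\<lambda>x. f x * g x)"
  unfolding C2_on_UNIV_iff_C2_jet by (blast intro: C2_jet_mult)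

lemma C2_on_UNIV_diff:
  assumes "C2_on_UNIV f" "C2_on_UNIV g"
  shows "C2_on_UNIV (\<lambda>x. f x - g x)"
proof -
  obtain F F' G G' where "C2_jet f F F'" "C2_jet g G G'" using assms by (auto simp: C2_on_UNIV_iff_C2_jet)
  from C2_jet_add[OF this(1) C2_jet_mult[OF C2_jet_const[of "-1"] this(2)]] show ?thesis
    by (auto simp: C2_on_UNIV_iff_C2_jet)
qed

lemma C2_on_UNIV_max_0_cube: "C2_on_UNIV w \<Longrightarrow> C2_on_UNIV (\<lambda>x. (max 0 (w x)) ^ 3)"
  unfolding C2_on_UNIV_iff_C2_jet by (blast intro: C2_jet_max_0_cube)

text \<open>Two truncated cubes flatten both ends: the inner one vanishes for w <= 0, and the outer
  one saturates as soon as the inner one reaches 1.\<close>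

lemma C2_cutoff:
  fixes w :: "'a::euclidean_space \<Rightarrow> real"
  assumes w: "C2_on_UNIV w"
  obtains \<zeta> where "C2_on_UNIV \<zeta>" "\<And>x. w x \<le> 0 \<Longrightarrow> \<zeta> x = 0" "\<And>x. w x \<ge> 1 \<Longrightarrow> \<zeta> x = 1"
proof (rule that[of "\<lambda>x. 1 - (max 0 (1 - (max 0 (w x)) ^ 3)) ^ 3"])
  show "C2_on_UNIV (\<lambda>x. 1 - (max 0 (1 - (max 0 (w x)) ^ 3)) ^ 3)"
    by (intro C2_on_UNIV_diff C2_on_UNIV_const C2_on_UNIV_max_0_cube w)
  show "1 - (max 0 (1 - (max 0 (w x)) ^ 3)) ^ 3 = 1" if "w x \<ge> 1" for x
  proof -
    have "1 \<le> max 0 (w x) ^ 3" using that by (intro one_le_power) auto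
    then show ?thesis by simp
  qed
qed simp

text \<open>With it, the functions living on distant shells drop out of a series together with both
  derivatives.\<close>

lemma C2_jet_eq_0_on_open:
  assumes g: "C2_jet g G H" and U: "open U" "x \<in> U" and 0: "\<And>y. y \<in> U \<Longrightarrow> g y = 0"
  shows "G x = 0" "H x = 0"
proof -
  have *: "G y = 0" if "y \<in> U" for y
  proof -
    have "((\<lambda>_. 0) has_derivative (\<lambda>h. G y \<bullet> h)) (at y)"
      by (rule has_derivative_transform_within_open[OF C2_jetD(1)[OF g] U(1) that]) (simp add: 0)
    then have "(\<lambda>h. G y \<bullet> h) = (\<lambda>h. 0)" by (rule has_derivative_unique) simp
    then have "G y \<bullet> G y = 0" by metis
    then show ?thesis by simp
  qed
  then show "G x = 0" using U by blast
  have "((\<lambda>_. 0) has_derivative blinfun_apply (H x)) (at x)"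
    by (rule has_derivative_transform_within_open[OF C2_jetD(2)[OF g] U]) (simp add: *)
  then have "blinfun_apply (H x) = (\<lambda>h. 0)" by (rule has_derivative_unique) simp
  then show "H x = 0" by (auto intro!: blinfun_eqI)
qed

section \<open>Series of functions, differentiated term by term\<close>

lemma suminf_has_derivative:
  fixes f :: "nat \<Rightarrow> 'a::euclidean_space \<Rightarrow> 'b::banach" and f' :: "nat \<Rightarrow> 'a \<Rightarrow> 'a \<Rightarrow>\<^sub>L 'b"
  assumes der: "\<And>n x. (f n has_derivative blinfun_apply (f' n x)) (at x)"
    and sa: "summable a"
    and bd: "\<And>n x. norm x < r \<Longrightarrow> norm (f n x) \<le> a n \<and> norm (f' n x) \<le> a n"
    and x: "norm x < r"
  shows "((\<lambda>x. \<Sum>n. f n x) has_derivative blinfun_apply (\<Sum>n. f' n x)) (at x)"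
proof -
  let ?S = "ball (0::'a) r"
  have unif: "uniform_limit ?S (\<lambda>n x. \<Sum>i<n. f' i x) (\<lambda>x. \<Sum>i. f' i x) sequentially"
    using bd by (intro Weierstrass_m_test[OF _ sa]) auto
  have sm: "summable (\<lambda>n. f n y)" if "y \<in> ?S" for y
    using bd that by (intro summable_comparison_test[OF _ sa]) auto
  have "\<exists>g. \<forall>x\<in>?S. (\<lambda>n. f n x) sums (g x) \<and> (g has_derivative blinfun_apply (\<Sum>n. f' n x)) (at x within ?S)"
  proof (rule has_derivative_series)
    show "(f n has_derivative blinfun_apply (f' n x)) (at x within ?S)" for n x
      using der by (rule has_derivative_at_withinI)
    show "(\<lambda>n. f n x) sums (\<Sum>n. f n x)" using sm x by (simp add: summable_sums)
    fix e :: real assume "e > 0"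
    then have "\<forall>\<^sub>F n in sequentially. \<forall>x\<in>?S. dist (\<Sum>i<n. f' i x) (\<Sum>i. f' i x) < e"
      using unif by (simp add: uniform_limit_iff)
    then show "\<forall>\<^sub>F n in sequentially. \<forall>x\<in>?S. \<forall>h. norm ((\<Sum>i<n. blinfun_apply (f' i x) h) - blinfun_apply (\<Sum>i. f' i x) h) \<le> e * norm h"
    proof eventually_elim
      case (elim n)
      show ?case
      proof (intro ballI allI)
        fix y h assume "y \<in> ?S"
        have "norm (blinfun_apply ((\<Sum>i<n. f' i y) - (\<Sum>i. f' i y)) h) \<le> norm ((\<Sum>i<n. f' i y) - (\<Sum>i. f' i y)) * norm h"
          by (rule norm_blinfun)
        also have "\<dots> \<le> e * norm h"
          using elim \<open>y \<in> ?S\<close> by (intro mult_right_mono) (auto simp: dist_norm intro: less_imp_le)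
        finally show "norm ((\<Sum>i<n. blinfun_apply (f' i y) h) - blinfun_apply (\<Sum>i. f' i y) h) \<le> e * norm h"
          by (simp add: minus_blinfun.rep_eq blinfun.sum_left)
      qed
    qed
  qed (use x in auto)
  then obtain g where g: "\<And>x. x \<in> ?S \<Longrightarrow> (\<lambda>n. f n x) sums (g x)"
    "\<And>x. x \<in> ?S \<Longrightarrow> (g has_derivative blinfun_apply (\<Sum>n. f' n x)) (at x within ?S)" by blast
  have xS: "x \<in> ?S" using x by simp
  have "(g has_derivative blinfun_apply (\<Sum>n. f' n x)) (at x)"
    using g(2)[OF xS] xS at_within_open[of x ?S] by simp
  then show ?thesis
    by (rule has_derivative_transform_within_open[OF _ open_ball xS]) (use g(1) sums_unique in blast)
qed

text \<open>The majorant may depend on the radius. This covers both a geometric series of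
  mollifications, whose terms may grow quadratically at infinity, and a locally finite sum over
  shells.\<close>

lemma C2_on_UNIV_suminf:
  fixes \<phi> :: "nat \<Rightarrow> 'a::euclidean_space \<Rightarrow> real"
  assumes C2: "\<And>n. C2_jet (\<phi> n) (\<Phi> n) (H n)"
    and bd: "\<And>r. \<exists>a. summable a \<and> (\<forall>n x. norm x < r \<longrightarrow> norm (\<phi> n x) \<le> a n \<and> norm (\<Phi> n x) \<le> a n \<and> norm (H n x) \<le> a n)"
  shows "C2_on_UNIV (\<lambda>x. \<Sum>n. \<phi> n x)"
proof -
  have "C2_jet (\<lambda>x. \<Sum>n. \<phi> n x) (\<lambda>x. \<Sum>n. \<Phi> n x) (\<lambda>x. \<Sum>n. H n x)"
    unfolding C2_jet_def
  proof (intro conjI allI)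
    fix x :: 'a
    obtain a where a: "summable a" "\<And>n y. norm y < norm x + 1 \<Longrightarrow>
        norm (\<phi> n y) \<le> a n \<and> norm (\<Phi> n y) \<le> a n \<and> norm (H n y) \<le> a n"
      using bd[of "norm x + 1"] by blast
    have nb: "norm (blinfun_inner_right v) \<le> norm v" for v :: 'a
      by (rule norm_blinfun_bound) (auto intro: Cauchy_Schwarz_ineq2)
    have d: "((\<lambda>x. \<Sum>n. \<phi> n x) has_derivative blinfun_apply (\<Sum>n. blinfun_inner_right (\<Phi> n x))) (at x)"
    proof (rule suminf_has_derivative[OF _ a(1)])
      show "(\<phi> n has_derivative blinfun_apply (blinfun_inner_right (\<Phi> n x))) (at x)" for n x
        using C2_jetD(1)[OF C2] by simp
      show "norm (\<phi> n y) \<le> a n \<and> norm (blinfun_inner_right (\<Phi> n y)) \<le> a n" if "norm y < norm x + 1" for n y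
        using a(2)[OF that] nb order_trans by blast
    qed simp
    have "summable (\<lambda>n. \<Phi> n x)" using a by (intro summable_comparison_test[OF _ a(1)]) auto
    then have "(\<Sum>n. blinfun_inner_right (\<Phi> n x)) = blinfun_inner_right (\<Sum>n. \<Phi> n x)"
      by (rule bounded_linear.suminf[OF bounded_linear_blinfun_inner_right, symmetric])
    then show "((\<lambda>x. \<Sum>n. \<phi> n x) has_derivative (\<lambda>h. (\<Sum>n. \<Phi> n x) \<bullet> h)) (at x)"
      using d by simp
    show "((\<lambda>x. \<Sum>n. \<Phi> n x) has_derivative blinfun_apply (\<Sum>n. H n x)) (at x)"
      using a(2) by (intro suminf_has_derivative[OF C2_jetD(2)[OF C2] a(1), of "norm x + 1"]) auto
  next
    have "continuous_on (ball 0 r) (\<lambda>x. \<Sum>n. H n x)" for r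
    proof -
      obtain a where a: "summable a" "\<And>n y. norm y < r \<Longrightarrow> norm (H n y) \<le> a n"
        using bd[of r] by blast
      have "uniform_limit (ball 0 r) (\<lambda>n x. \<Sum>i<n. H i x) (\<lambda>x. \<Sum>i. H i x) sequentially"
        using a by (intro Weierstrass_m_test[OF _ a(1)]) auto
      then show ?thesis
        by (rule uniform_limit_theorem[rotated]) (auto intro!: always_eventually continuous_intros C2_jetD(3)[OF C2])
    qed
    then have "isCont (\<lambda>x. \<Sum>n. H n x) x" for x
      by (rule continuous_on_interior[of "ball 0 (norm x + 1)"]) auto
    then show "continuous_on UNIV (\<lambda>x. \<Sum>n. H n x)" by (simp add: continuous_at_imp_continuous_on)
  qed
  then show ?thesis using C2_on_UNIV_iff_C2_jet by blast
qed

section \<open>Mollification\<close>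

text \<open>The domain is a fixed cube, which contains the support of every bump of radius at most
  1. Writing \<open>w + t\<close> puts the translation on \<open>F\<close>, so a derivative falling
  on \<open>F\<close> is found under the integral without a change of variables.\<close>

definition conv :: "('a::euclidean_space \<Rightarrow> real) \<Rightarrow> ('a \<Rightarrow> 'b::euclidean_space) \<Rightarrow> 'a \<Rightarrow> 'b" where
  "conv \<kappa> F w = integral (cbox (- One) One) (\<lambda>t. \<kappa> t *\<^sub>R F (w + t))"

text \<open>A C^1 kernel with a quantified Lipschitz constant: of the two derivatives of a mollified
  C^{1,1} function, one falls on the function (\<open>conv_has_gradient\<close>) and the other on
  the kernel (\<open>conv_C1\<close>).\<close>

definition bump :: "real \<Rightarrow> ('a::euclidean_space \<Rightarrow> real) \<Rightarrow> ('a \<Rightarrow> 'a) \<Rightarrow> real \<Rightarrow> bool" where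
  "bump \<delta> \<kappa> D K \<longleftrightarrow> (\<forall>t. (\<kappa> has_derivative (\<lambda>h. D t \<bullet> h)) (at t)) \<and> continuous_on UNIV D \<and>
     (\<forall>t. \<kappa> t \<ge> 0) \<and> (\<forall>t. norm t \<ge> \<delta> \<longrightarrow> \<kappa> t = 0) \<and>
     integral (cbox (- One) One) \<kappa> = 1 \<and> (\<forall>s t. \<bar>\<kappa> s - \<kappa> t\<bar> \<le> K * norm (s - t))"

lemma norm_le_One:
  fixes t :: "'a::euclidean_space"
  assumes "t \<in> cbox (- (h *\<^sub>R One)) (h *\<^sub>R One)"
  shows "norm t \<le> real DIM('a) * h"
proof -
  have "norm t \<le> (\<Sum>i\<in>Basis. \<bar>t \<bullet> i\<bar>)" by (rule norm_le_l1)
  also have "\<dots> \<le> (\<Sum>i\<in>(Basis::'a set). h)"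
    using assms by (intro sum_mono) (auto simp: mem_box abs_le_iff)
  finally show ?thesis by simp
qed

lemma cball_subset_One: "cball (x::'a::euclidean_space) h \<subseteq> cbox (x - h *\<^sub>R One) (x + h *\<^sub>R One)"
proof
  fix y assume "y \<in> cball x h"
  then have *: "\<bar>y \<bullet> i - x \<bullet> i\<bar> \<le> h" if "i \<in> Basis" for i
    using Basis_le_norm[OF that, of "y - x"] by (simp add: dist_norm norm_minus_commute inner_simps)
  show "y \<in> cbox (x - h *\<^sub>R One) (x + h *\<^sub>R One)"
    unfolding mem_box
  proof
    fix i :: 'a assume "i \<in> Basis"
    then show "(x - h *\<^sub>R One) \<bullet> i \<le> y \<bullet> i \<and> y \<bullet> i \<le> (x + h *\<^sub>R One) \<bullet> i"
      using *[of i] by (simp add: inner_simps abs_le_iff; linarith)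
  qed
qed

text \<open>The kernel is the square of the positive part of \<delta>^2 - |t|^2, divided by its
  integral. Before division its gradient is at most 4 \<delta>^3; the integral is at least (3/4
  \<delta>^2)^2 times the volume of a cube of side \<delta>/n inside the ball of radius \<delta>/2.
  The quotient of these gives \<open>C\<close> and the power of \<delta>.\<close>

lemma bump_exists:
  obtains C where "C > 0"
    "\<And>\<delta>. 0 < \<delta> \<Longrightarrow> \<delta> \<le> 1 \<Longrightarrow> \<exists>\<kappa> D. bump \<delta> (\<kappa> :: 'a::euclidean_space \<Rightarrow> real) D (C / \<delta> ^ Suc DIM('a))"
proof -
  define n where "n = DIM('a)"
  have n: "n > 0" by (simp add: n_def)
  define C where "C = 4 * (16 / 9) * real n ^ n"
  have "C > 0" using n by (simp add: C_def)
  moreover have "\<exists>\<kappa> D. bump \<delta> (\<kappa> :: 'a \<Rightarrow> real) D (C / \<delta> ^ Suc n)" if \<delta>: "0 < \<delta>" "\<delta> \<le> 1" for \<delta>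
  proof -
    define \<kappa>0 where "\<kappa>0 t = (max 0 (\<delta>\<^sup>2 - (norm t)\<^sup>2))\<^sup>2" for t :: 'a
    define D0 where "D0 t = - (4 * max 0 (\<delta>\<^sup>2 - (norm t)\<^sup>2)) *\<^sub>R t" for t :: 'a
    have d0: "(\<kappa>0 has_derivative (\<lambda>h. D0 t \<bullet> h)) (at t)" for t
    proof -
      have "((\<lambda>t. \<delta>\<^sup>2 - (norm t)\<^sup>2) has_derivative (\<lambda>h. - (2 * (t \<bullet> h)))) (at t)"
        unfolding power2_norm_eq_inner by (auto intro!: derivative_eq_intros simp: inner_commute)
      from has_derivative_compose[OF this has_derivative_max_0_square[unfolded has_field_derivative_def]]
      show ?thesis by (simp add: \<kappa>0_def[abs_def] D0_def mult_ac)
    qed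
    have c0: "continuous_on S \<kappa>0" for S unfolding \<kappa>0_def by (intro continuous_intros)
    have cD0: "continuous_on S D0" for S unfolding D0_def by (intro continuous_intros)
    have zero: "\<delta>\<^sup>2 - (norm t)\<^sup>2 \<le> 0" if "norm t \<ge> \<delta>" for t :: 'a
      using that \<delta> by (simp add: power_mono)
    define Z where "Z = integral (cbox (- One) One) \<kappa>0"
    define h where "h = \<delta> / (2 * real n)"
    have h: "h > 0" using \<delta> n by (simp add: h_def)
    have h1: "h \<le> 1"
    proof -
      have "2 * real n \<ge> 1" using n by simp
      then show ?thesis using \<delta> by (simp add: h_def divide_le_eq)
    qed
    have Zlo: "9 / 16 * \<delta> ^ 4 * (\<delta> / real n) ^ n \<le> Z"
    proof -
      let ?B = "cbox (- (h *\<^sub>R One)) (h *\<^sub>R (One::'a))"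
      have "measure lborel ?B = (2 * h) ^ n"
        using h by (subst content_cbox) (auto simp: n_def inner_simps)
      also have "2 * h = \<delta> / real n" using n by (simp add: h_def)
      finally have cB: "measure lborel ?B = (\<delta> / real n) ^ n" .
      have "9 / 16 * \<delta> ^ 4 * (\<delta> / real n) ^ n = integral ?B (\<lambda>_. 9 / 16 * \<delta> ^ 4)"
        by (simp add: cB)
      also have "\<dots> \<le> integral ?B \<kappa>0"
      proof (rule integral_le)
        show "\<kappa>0 integrable_on ?B" by (rule integrable_continuous[OF c0])
        fix t assume t: "t \<in> ?B"
        have "norm t \<le> real n * h" using norm_le_One[OF t] by (simp add: n_def)
        also have "\<dots> = \<delta> / 2" using n by (simp add: h_def)
        finally have "(norm t)\<^sup>2 \<le> (\<delta> / 2)\<^sup>2" by (intro power_mono) auto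
        then have "3 / 4 * \<delta>\<^sup>2 \<le> \<delta>\<^sup>2 - (norm t)\<^sup>2" by (simp add: power_divide)
        then have "3 / 4 * \<delta>\<^sup>2 \<le> max 0 (\<delta>\<^sup>2 - (norm t)\<^sup>2)" by linarith
        then have "(3 / 4 * \<delta>\<^sup>2)\<^sup>2 \<le> (max 0 (\<delta>\<^sup>2 - (norm t)\<^sup>2))\<^sup>2" by (intro power_mono) auto
        then show "9 / 16 * \<delta> ^ 4 \<le> \<kappa>0 t" by (simp add: \<kappa>0_def power_mult_distrib power_divide)
      qed auto
      also have "\<dots> \<le> Z" unfolding Z_def
      proof (rule integral_subset_le)
        show "?B \<subseteq> cbox (- One) One" using h1 by (intro subset_box_imp) auto
      qed (auto intro!: integrable_continuous c0 simp: \<kappa>0_def)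
      finally show ?thesis .
    qed
    moreover have "9 / 16 * \<delta> ^ 4 * (\<delta> / real n) ^ n > 0" using \<delta> n by simp
    ultimately have Z: "Z > 0" by linarith
    have L0: "\<bar>\<kappa>0 s - \<kappa>0 t\<bar> \<le> 4 * \<delta> ^ 3 * norm (s - t)" for s t
    proof -
      have "norm (\<kappa>0 s - \<kappa>0 t) \<le> 4 * \<delta> ^ 3 * norm (s - t)"
      proof (rule differentiable_bound[of UNIV \<kappa>0 "\<lambda>x h. D0 x \<bullet> h"])
        show "(\<kappa>0 has_derivative (\<lambda>h. D0 x \<bullet> h)) (at x within UNIV)" for x using d0 by simp
        fix x
        have "norm (D0 x) \<le> 4 * \<delta> ^ 3"
        proof (cases "norm x \<ge> \<delta>")
          case True then show ?thesis using zero[OF True] \<delta> by (simp add: D0_def)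
        next
          case False
          have "max 0 (\<delta>\<^sup>2 - (norm x)\<^sup>2) * norm x \<le> \<delta>\<^sup>2 * \<delta>" using False by (intro mult_mono) auto
          then show ?thesis by (simp add: D0_def power2_eq_square power3_eq_cube)
        qed
        then show "onorm (\<lambda>h. D0 x \<bullet> h) \<le> 4 * \<delta> ^ 3"
          by (intro onorm_le) (metis Cauchy_Schwarz_ineq2 mult_right_mono norm_ge_zero order_trans real_norm_def)
      qed auto
      then show ?thesis by simp
    qed
    have "bump \<delta> (\<lambda>t. \<kappa>0 t / Z) (\<lambda>t. D0 t /\<^sub>R Z) (C / \<delta> ^ Suc n)"
      unfolding bump_def
    proof (intro conjI allI impI)
      show "((\<lambda>t. \<kappa>0 t / Z) has_derivative (\<lambda>h. (D0 t /\<^sub>R Z) \<bullet> h)) (at t)" for t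
        using Z by (auto intro!: derivative_eq_intros d0 simp: divide_inverse)
      show "continuous_on UNIV (\<lambda>t. D0 t /\<^sub>R Z)" by (intro continuous_intros cD0)
      show "0 \<le> \<kappa>0 t / Z" for t using Z by (simp add: \<kappa>0_def)
      show "\<kappa>0 t / Z = 0" if "\<delta> \<le> norm t" for t using zero[OF that] by (simp add: \<kappa>0_def)
      show "integral (cbox (- One) One) (\<lambda>t. \<kappa>0 t / Z) = 1"
        using Z by (simp add: Z_def[symmetric])
      fix s t
      have "\<bar>\<kappa>0 s / Z - \<kappa>0 t / Z\<bar> = \<bar>\<kappa>0 s - \<kappa>0 t\<bar> / Z" using Z by (simp add: diff_divide_distrib[symmetric])
      also have "\<dots> \<le> 4 * \<delta> ^ 3 * norm (s - t) / Z" using L0 Z by (intro divide_right_mono) auto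
      also have "\<dots> \<le> 4 * \<delta> ^ 3 * norm (s - t) / (9 / 16 * \<delta> ^ 4 * (\<delta> / real n) ^ n)"
        using Zlo \<delta> n by (intro divide_left_mono mult_pos_pos Z) auto
      also have "\<dots> = C / \<delta> ^ Suc n * norm (s - t)"
        using \<delta> n by (simp add: C_def field_simps power_divide power_numeral_reduce)
      finally show "\<bar>\<kappa>0 s / Z - \<kappa>0 t / Z\<bar> \<le> C / \<delta> ^ Suc n * norm (s - t)" .
    qed
    then show ?thesis by blast
  qed
  ultimately show thesis using that[of C] unfolding n_def by blast
qed

lemma bumpD:
  assumes "bump \<delta> \<kappa> D K"
  shows "(\<kappa> has_derivative (\<lambda>h. D t \<bullet> h)) (at t)" "continuous_on S D" "\<kappa> t \<ge> 0"
    "norm t \<ge> \<delta> \<Longrightarrow> \<kappa> t = 0" "integral (cbox (- One) One) \<kappa> = 1" "\<bar>\<kappa> s - \<kappa> t\<bar> \<le> K * norm (s - t)"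
    "continuous_on S \<kappa>"
proof -
  show 1: "(\<kappa> has_derivative (\<lambda>h. D t \<bullet> h)) (at t)" for t using assms by (auto simp: bump_def)
  show "continuous_on S D" using assms continuous_on_subset by (fastforce simp: bump_def)
  show "continuous_on S \<kappa>" using 1 by (meson continuous_at_imp_continuous_on has_derivative_continuous)
qed (use assms in \<open>auto simp: bump_def\<close>)

lemma conv_integrable:
  fixes F :: "'a::euclidean_space \<Rightarrow> 'b::euclidean_space"
  assumes "bump \<delta> \<kappa> D K" "continuous_on UNIV F"
  shows "(\<lambda>t. \<kappa> t *\<^sub>R F (w + t)) integrable_on cbox a b"
  by (intro integrable_continuous continuous_intros bumpD(7)[OF assms(1)] continuous_on_compose2[OF assms(2)]) auto

text \<open>A probability average stays as close to a constant as the averaged function does on the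
  support. The size bounds on mollifications below are instances of this.\<close>

lemma conv_near_const:
  fixes F :: "'a::euclidean_space \<Rightarrow> 'b::euclidean_space"
  assumes b: "bump \<delta> \<kappa> D K" and F: "continuous_on UNIV F"
    and bd: "\<And>t. norm t \<le> \<delta> \<Longrightarrow> norm (F (w + t) - c) \<le> B"
  shows "norm (conv \<kappa> F w - c) \<le> B"
proof -
  let ?Q = "cbox (- One) (One::'a)"
  have ik: "\<kappa> integrable_on ?Q" by (intro integrable_continuous bumpD(7)[OF b])
  have "c = integral ?Q (\<lambda>t. \<kappa> t *\<^sub>R c)"
    using integral_unique[OF has_integral_scaleR_left[OF integrable_integral[OF ik], of c]] bumpD(5)[OF b] by simp
  then have "conv \<kappa> F w - c = integral ?Q (\<lambda>t. \<kappa> t *\<^sub>R F (w + t)) - integral ?Q (\<lambda>t. \<kappa> t *\<^sub>R c)"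
    by (simp add: conv_def)
  also have "\<dots> = integral ?Q (\<lambda>t. \<kappa> t *\<^sub>R F (w + t) - \<kappa> t *\<^sub>R c)"
    by (intro integral_diff[symmetric] conv_integrable[OF b F] integrable_continuous continuous_intros bumpD(7)[OF b])
  also have "norm \<dots> \<le> integral ?Q (\<lambda>t. \<kappa> t * B)"
  proof (rule integral_norm_bound_integral)
    show "(\<lambda>t. \<kappa> t *\<^sub>R F (w + t) - \<kappa> t *\<^sub>R c) integrable_on ?Q"
      by (intro integrable_diff conv_integrable[OF b F] integrable_continuous continuous_intros bumpD(7)[OF b])
    show "(\<lambda>t. \<kappa> t * B) integrable_on ?Q" by (intro integrable_continuous continuous_intros bumpD(7)[OF b])
    fix t
    show "norm (\<kappa> t *\<^sub>R F (w + t) - \<kappa> t *\<^sub>R c) \<le> \<kappa> t * B"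
    proof (cases "norm t \<le> \<delta>")
      case True
      then show ?thesis using bd[OF True] bumpD(3)[OF b, of t]
        by (simp add: scaleR_diff_right[symmetric] mult_left_mono)
    next
      case False then show ?thesis using bumpD(4)[OF b, of t] by simp
    qed
  qed
  also have "\<dots> = B" using bumpD(5)[OF b] by simp
  finally show ?thesis .
qed

lemma conv_diff:
  assumes b: "bump \<delta> \<kappa> D K" and F: "continuous_on UNIV F"
  shows "conv \<kappa> F y - conv \<kappa> F x = conv \<kappa> (\<lambda>w. F (w + (y - x)) - F w) x"
proof -
  have "conv \<kappa> F y - conv \<kappa> F x = integral (cbox (- One) One) (\<lambda>t. \<kappa> t *\<^sub>R F (y + t) - \<kappa> t *\<^sub>R F (x + t))"
    unfolding conv_def by (intro integral_diff[symmetric] conv_integrable[OF b F])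
  then show ?thesis by (simp add: conv_def scaleR_diff_right algebra_simps)
qed

lemma conv_lipschitz:
  assumes b: "bump \<delta> \<kappa> D K" and F: "M-lipschitz_on UNIV F"
  shows "norm (conv \<kappa> F y - conv \<kappa> F x) \<le> M * norm (y - x)"
proof -
  have cF: "continuous_on UNIV F" using lipschitz_on_continuous_on[OF F] .
  have "norm (conv \<kappa> (\<lambda>w. F (w + (y - x)) - F w) x - 0) \<le> M * norm (y - x)"
  proof (rule conv_near_const[OF b])
    show "continuous_on UNIV (\<lambda>w. F (w + (y - x)) - F w)"
      by (intro continuous_intros cF continuous_on_compose2[OF cF]) auto
    fix t show "norm (F (x + t + (y - x)) - F (x + t) - 0) \<le> M * norm (y - x)"
      using lipschitz_onD[OF F, of "x + t + (y - x)" "x + t"] by (simp add: dist_norm)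
  qed
  then show ?thesis by (simp add: conv_diff[OF b cF])
qed

text \<open>Moves the translation onto the kernel. The freedom in \<open>T\<close> lets several base
  points share one domain of integration, so that their kernels can be subtracted or differentiated
  under the integral.\<close>

lemma conv_has_integral:
  fixes F :: "'a::euclidean_space \<Rightarrow> 'b::euclidean_space"
  assumes b: "bump \<delta> \<kappa> D K" and \<delta>: "\<delta> \<le> 1" and F: "continuous_on UNIV F" and T: "cball w \<delta> \<subseteq> T"
  shows "((\<lambda>y. \<kappa> (y - w) *\<^sub>R F y) has_integral conv \<kappa> F w) T"
proof -
  let ?f = "\<lambda>y. \<kappa> (y - w) *\<^sub>R F y"
  have 0: "?f y = 0" if "y \<notin> cball w \<delta>" for y
    using that bumpD(4)[OF b, of "y - w"] by (simp add: dist_norm norm_minus_commute)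
  have "((?f \<circ> ((+) w)) has_integral conv \<kappa> F w) (cbox (- One) One)"
    using integrable_integral[OF conv_integrable[OF b F]] by (simp add: conv_def o_def)
  then have "(?f has_integral conv \<kappa> F w) (cbox (- One + w) (One + w))"
    by (simp only: has_integral_shift_cbox_iff)
  then have U: "(?f has_integral conv \<kappa> F w) UNIV"
  proof (rule has_integral_on_superset)
    fix y assume "y \<notin> cbox (- One + w) (One + w)"
    then have "y \<notin> cball w \<delta>" using cball_subset_One[of w 1] subset_cball[OF \<delta>, of w] by (auto simp: add.commute)
    then show "?f y = 0" by (rule 0)
  qed auto
  have "(\<lambda>y. if y \<in> T then ?f y else 0) = ?f"
  proof
    fix y show "(if y \<in> T then ?f y else 0) = ?f y"
    proof (cases "y \<in> T")
      case False
      then have "?f y = 0" using T by (intro 0) blast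
      then show ?thesis by simp
    qed simp
  qed
  then show ?thesis using U has_integral_restrict_UNIV[of T ?f] by metis
qed

lemma conv_has_gradient:
  fixes g :: "'a::euclidean_space \<Rightarrow> real"
  assumes b: "bump \<delta> \<kappa> D K" and g: "\<And>x. (g has_derivative (\<lambda>h. G x \<bullet> h)) (at x)" and G: "continuous_on UNIV G"
  shows "(conv \<kappa> g has_derivative (\<lambda>h. conv \<kappa> G w \<bullet> h)) (at w)"
proof -
  let ?Q = "cbox (- One) (One::'a)"
  have cg: "continuous_on UNIV g" using g by (meson continuous_at_imp_continuous_on has_derivative_continuous)
  let ?fx = "\<lambda>x t. blinfun_inner_right (\<kappa> t *\<^sub>R G (x + t))"
  have "((\<lambda>x. integral ?Q (\<lambda>t. \<kappa> t *\<^sub>R g (x + t))) has_derivative integral ?Q (?fx w)) (at w within UNIV)"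
  proof (rule leibniz_rule)
    fix x t
    have "((\<lambda>x. g (x + t)) has_derivative (\<lambda>h. G (x + t) \<bullet> h)) (at x)"
      by (rule has_derivative_compose[where g = g, OF _ g, simplified]) (auto intro!: derivative_eq_intros)
    then show "((\<lambda>x. \<kappa> t *\<^sub>R g (x + t)) has_derivative blinfun_apply (?fx x t)) (at x within UNIV)"
      by (auto intro!: derivative_eq_intros)
  next
    show "(\<lambda>t. \<kappa> t *\<^sub>R g (x + t)) integrable_on ?Q" for x by (rule conv_integrable[OF b cg])
    have "continuous_on (UNIV \<times> ?Q) (\<lambda>p. ?fx (fst p) (snd p))"
      by (intro bounded_linear.continuous_on[OF bounded_linear_blinfun_inner_right] continuous_intros
          continuous_on_compose2[OF bumpD(7)[OF b]] continuous_on_compose2[OF G]) auto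
    then show "continuous_on (UNIV \<times> ?Q) (\<lambda>(x, t). ?fx x t)" by (simp add: case_prod_unfold)
  qed auto
  moreover have "integral ?Q (?fx w) = blinfun_inner_right (conv \<kappa> G w)"
    using integral_linear[OF conv_integrable[OF b G, of w] bounded_linear_blinfun_inner_right]
    by (simp add: o_def conv_def)
  ultimately show ?thesis by (simp add: conv_def[abs_def])
qed

text \<open>The derivative falls on the kernel, so continuity of \<open>G\<close> is enough. The
  Leibniz rule wants a fixed domain, available only near a given \<open>w0\<close>: the cube of
  half-side 2 holds the supports for all w within 1 of \<open>w0\<close>. Uniqueness of derivatives
  (\<open>HB\<close>) shows that these local formulas agree, and continuity of \<open>H\<close>
  follows.\<close>

lemma conv_C1:
  fixes G :: "'a::euclidean_space \<Rightarrow> 'a"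
  assumes b: "bump \<delta> \<kappa> D K" and \<delta>: "\<delta> \<le> 1" and G: "continuous_on UNIV G"
  obtains H where "\<And>w. (conv \<kappa> G has_derivative blinfun_apply (H w)) (at w)" "continuous_on UNIV H"
proof -
  define B where "B w0 = cbox (w0 - 2 *\<^sub>R One) (w0 + 2 *\<^sub>R (One::'a))" for w0
  define fx where "fx w y = rank_one (G y) (- D (y - w))" for w y
  define H where "H w = integral (B w) (fx w)" for w
  have cfx: "continuous_on S (\<lambda>p. fx (fst p) (snd p))" for S
    unfolding fx_def
    by (intro continuous_intros continuous_on_compose2[OF G] continuous_on_compose2[OF bumpD(2)[OF b, of UNIV]]) auto
  have sub: "cball w \<delta> \<subseteq> B w0" if "w \<in> ball w0 1" for w w0
  proof -
    have "cball w \<delta> \<subseteq> cball w0 2"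
      using that \<delta> by (simp add: cball_subset_cball_iff dist_commute)
    also have "\<dots> \<subseteq> B w0" unfolding B_def by (rule cball_subset_One)
    finally show ?thesis .
  qed
  have der: "(conv \<kappa> G has_derivative blinfun_apply (integral (B w0) (fx w))) (at w)" if w: "w \<in> ball w0 1" for w w0
  proof -
    have "((\<lambda>w. integral (B w0) (\<lambda>y. \<kappa> (y - w) *\<^sub>R G y)) has_derivative integral (B w0) (fx w)) (at w within ball w0 1)"
      unfolding B_def
    proof (rule leibniz_rule[OF _ _ _ w])
      fix x y
      have "((\<lambda>x. \<kappa> (y - x)) has_derivative (\<lambda>h. D (y - x) \<bullet> (- h))) (at x within ball w0 1)"
        by (rule has_derivative_compose[OF _ bumpD(1)[OF b]]) (auto intro!: derivative_eq_intros)
      then show "((\<lambda>x. \<kappa> (y - x) *\<^sub>R G y) has_derivative blinfun_apply (fx x y)) (at x within ball w0 1)"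
        by (auto intro!: derivative_eq_intros simp: fx_def)
    next
      show "(\<lambda>y. \<kappa> (y - x) *\<^sub>R G y) integrable_on cbox (w0 - 2 *\<^sub>R One) (w0 + 2 *\<^sub>R One)" for x
        by (intro integrable_continuous continuous_intros continuous_on_compose2[OF bumpD(7)[OF b, of UNIV]]
            continuous_on_subset[OF G]) auto
      show "continuous_on (ball w0 1 \<times> cbox (w0 - 2 *\<^sub>R One) (w0 + 2 *\<^sub>R One)) (\<lambda>(x, t). fx x t)"
        using cfx by (simp add: case_prod_unfold)
    qed auto
    then have "((\<lambda>w. integral (B w0) (\<lambda>y. \<kappa> (y - w) *\<^sub>R G y)) has_derivative blinfun_apply (integral (B w0) (fx w))) (at w)"
      using w at_within_open[of w "ball w0 1"] by simp
    then show ?thesis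
    proof (rule has_derivative_transform_within_open[OF _ open_ball w])
      fix x assume "x \<in> ball w0 1"
      then show "integral (B w0) (\<lambda>y. \<kappa> (y - x) *\<^sub>R G y) = conv \<kappa> G x"
        using conv_has_integral[OF b \<delta> G sub] by (intro integral_unique) blast
    qed
  qed
  have HB: "H w = integral (B w0) (fx w)" if "w \<in> ball w0 1" for w w0
  proof -
    have "blinfun_apply (H w) = blinfun_apply (integral (B w0) (fx w))"
      using has_derivative_unique[OF der[of w w] der[OF that]] by (simp add: H_def)
    then show ?thesis by (metis blinfun_apply_inject)
  qed
  show thesis
  proof (rule that[of H])
    show "(conv \<kappa> G has_derivative blinfun_apply (H w)) (at w)" for w
      unfolding H_def by (rule der) simp
    have "isCont H w0" for w0
    proof -
      have "continuous_on (ball w0 1) (\<lambda>w. integral (B w0) (fx w))"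
        unfolding B_def by (rule integral_continuous_on_param) (use cfx in \<open>simp add: case_prod_unfold\<close>)
      then have "continuous_on (ball w0 1) H"
        by (rule continuous_on_eq) (simp add: HB)
      then show ?thesis by (rule continuous_on_interior) simp
    qed
    then show "continuous_on UNIV H" by (simp add: continuous_at_imp_continuous_on)
  qed
qed

lemma lipschitz_imp_norm_derivative_le:
  assumes d: "(F has_derivative blinfun_apply A) (at x)" and l: "\<And>y. norm (F y - F x) \<le> M * norm (y - x)" and M: "M \<ge> 0"
  shows "norm A \<le> M"
proof (rule norm_blinfun_bound[OF M])
  fix v
  show "norm (blinfun_apply A v) \<le> M * norm v"
  proof (cases "v = 0")
    case False
    show ?thesis
    proof (rule field_le_epsilon)
      fix e :: real assume "e > 0"
      then have e': "e / norm v > 0" using False by simp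
      then obtain r where r: "r > 0" "\<And>y. norm (y - x) < r \<Longrightarrow> norm (F y - F x - A (y - x)) \<le> e / norm v * norm (y - x)"
        using d unfolding has_derivative_at_alt by blast
      define t where "t = r / (2 * norm v)"
      have t: "t > 0" "norm (t *\<^sub>R v) < r" using r False by (auto simp: t_def)
      have "norm (A (t *\<^sub>R v)) \<le> norm (F (x + t *\<^sub>R v) - F x) + norm (F (x + t *\<^sub>R v) - F x - A (t *\<^sub>R v))"
        by (metis norm_triangle_sub norm_minus_commute add.commute)
      also have "\<dots> \<le> M * norm (t *\<^sub>R v) + e / norm v * norm (t *\<^sub>R v)"
        using l[of "x + t *\<^sub>R v"] r(2)[of "x + t *\<^sub>R v"] t(2) by (intro add_mono) auto
      finally have "t * norm (A v) \<le> t * (M * norm v + e)"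
        using t(1) False by (simp add: blinfun.scaleR_right algebra_simps)
      then show "norm (A v) \<le> M * norm v + e" using t(1) by simp
    qed
  qed (simp add: blinfun.zero_right)
qed

text \<open>At scales comparable with \<open>\<delta>\<close> the smoothing is controlled by the affine approximation of \<open>G\<close>
  at the point \<open>x\<close>, which it reproduces up to a constant.\<close>

lemma conv_near_affine:
  fixes G :: "'a::euclidean_space \<Rightarrow> 'a" and A :: "'a \<Rightarrow>\<^sub>L 'a"
  assumes b: "bump \<delta> \<kappa> D (C / \<delta> ^ Suc DIM('a))" and \<delta>: "0 < \<delta>" "\<delta> \<le> 1" and C: "C > 0"
    and G: "continuous_on UNIV G" and \<Lambda>: "\<Lambda> \<ge> 0" and \<eta>: "\<eta> \<ge> 0"
    and A: "\<And>w. norm (w - x) \<le> real DIM('a) * ((\<Lambda> + 1) * \<delta>) \<Longrightarrow> norm (G w - G x - A (w - x)) \<le> \<eta> * norm (w - x)"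
    and y: "norm (y - x) \<le> \<Lambda> * \<delta>"
  shows "norm (conv \<kappa> G y - conv \<kappa> G x - A (y - x))
     \<le> C * real DIM('a) * 2 ^ DIM('a) * (\<Lambda> + 1) ^ Suc DIM('a) * \<eta> * norm (y - x)"
proof -
  define n where "n = DIM('a)"
  define \<rho> where "\<rho> = (\<Lambda> + 1) * \<delta>"
  have \<rho>: "\<rho> > 0" using \<Lambda> \<delta> by (simp add: \<rho>_def)
  define E where "E w = G w - G x - A (w - x)" for w
  have cE: "continuous_on UNIV E"
    unfolding E_def by (intro continuous_intros G)
  define Q where "Q = cbox (x - \<rho> *\<^sub>R One) (x + \<rho> *\<^sub>R One)"
  have cyQ: "cball y \<delta> \<subseteq> Q" and cxQ: "cball x \<delta> \<subseteq> Q"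
  proof -
    have "cball y \<delta> \<subseteq> cball x \<rho>"
    proof
      fix z assume "z \<in> cball y \<delta>"
      then have "norm (z - y) \<le> \<delta>" by (simp add: dist_norm norm_minus_commute)
      then have "norm (z - x) \<le> \<rho>" using norm_triangle_ineq[of "z - y" "y - x"] y by (simp add: \<rho>_def algebra_simps)
      then show "z \<in> cball x \<rho>" by (simp add: dist_norm norm_minus_commute)
    qed
    moreover have "cball x \<delta> \<subseteq> cball x \<rho>"
      using \<Lambda> \<delta> by (intro subset_cball) (simp add: \<rho>_def algebra_simps)
    moreover have "cball x \<rho> \<subseteq> Q" unfolding Q_def by (rule cball_subset_One)
    ultimately show "cball y \<delta> \<subseteq> Q" "cball x \<delta> \<subseteq> Q" by blast+
  qed
  have "conv \<kappa> E y - conv \<kappa> E x = conv \<kappa> (\<lambda>w. G (w + (y - x)) - G w - A (y - x)) x"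
    unfolding conv_diff[OF b cE] by (simp add: E_def blinfun.diff_right blinfun.add_right algebra_simps)
  also have "\<dots> = conv \<kappa> (\<lambda>w. G (w + (y - x)) - G w) x - A (y - x)"
  proof -
    have "conv \<kappa> (\<lambda>w. G (w + (y - x)) - G w - A (y - x)) x
        = integral (cbox (- One) One) (\<lambda>t. \<kappa> t *\<^sub>R (G (x + t + (y - x)) - G (x + t)) - \<kappa> t *\<^sub>R A (y - x))"
      by (simp add: conv_def scaleR_diff_right)
    also have "\<dots> = conv \<kappa> (\<lambda>w. G (w + (y - x)) - G w) x - integral (cbox (- One) One) (\<lambda>t. \<kappa> t *\<^sub>R A (y - x))"
      unfolding conv_def
      by (intro integral_diff integrable_continuous continuous_intros bumpD(7)[OF b] continuous_on_compose2[OF G]) auto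
    also have "integral (cbox (- One) One) (\<lambda>t. \<kappa> t *\<^sub>R A (y - x)) = A (y - x)"
    proof -
      have "(\<kappa> has_integral 1) (cbox (- One) One)"
        using integrable_integral[OF integrable_continuous[OF bumpD(7)[OF b]], of "- One" One] bumpD(5)[OF b] by simp
      from integral_unique[OF has_integral_scaleR_left[OF this, of "A (y - x)"]] show ?thesis by simp
    qed
    finally show ?thesis .
  qed
  also have "\<dots> = conv \<kappa> G y - conv \<kappa> G x - A (y - x)" by (simp add: conv_diff[OF b G])
  finally have eq: "conv \<kappa> G y - conv \<kappa> G x - A (y - x) = conv \<kappa> E y - conv \<kappa> E x" ..
  \<comment> \<open>\<open>B\<close> bounds the integrand pointwise. The difference of kernels
    contributes \<delta>^-(n+1), the error of the affine approximation \<delta>, and the volume of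
    \<open>Q\<close> contributes \<delta>^n, so all powers of \<delta> cancel.\<close>
  define B where "B = (C / \<delta> ^ Suc n * norm (y - x)) * (\<eta> * (real n * \<rho>))"
  have B: "B \<ge> 0" using C \<delta> \<eta> \<rho> by (simp add: B_def)
  have "((\<lambda>w. \<kappa> (w - y) *\<^sub>R E w - \<kappa> (w - x) *\<^sub>R E w) has_integral conv \<kappa> E y - conv \<kappa> E x) Q"
    by (intro has_integral_diff conv_has_integral[OF b \<delta>(2) cE] cyQ cxQ)
  then have "norm (conv \<kappa> E y - conv \<kappa> E x) \<le> B * measure lborel Q"
    unfolding Q_def
  proof (rule has_integral_bound[OF B])
    fix w assume w: "w \<in> cbox (x - \<rho> *\<^sub>R One) (x + \<rho> *\<^sub>R One)"
    have "w - x \<in> cbox (- (\<rho> *\<^sub>R One)) (\<rho> *\<^sub>R One)" using w by (auto simp: mem_box inner_simps algebra_simps)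
    then have wx: "norm (w - x) \<le> real n * \<rho>" using norm_le_One n_def by blast
    then have "norm (E w) \<le> \<eta> * norm (w - x)" unfolding E_def by (intro A) (simp add: n_def \<rho>_def)
    also have "\<dots> \<le> \<eta> * (real n * \<rho>)" using wx \<eta> by (intro mult_left_mono)
    finally have E: "norm (E w) \<le> \<eta> * (real n * \<rho>)" .
    have k: "\<bar>\<kappa> (w - y) - \<kappa> (w - x)\<bar> \<le> C / \<delta> ^ Suc n * norm (y - x)"
      using bumpD(6)[OF b, of "w - y" "w - x"] by (simp add: n_def norm_minus_commute)
    have "norm (\<kappa> (w - y) *\<^sub>R E w - \<kappa> (w - x) *\<^sub>R E w) = \<bar>\<kappa> (w - y) - \<kappa> (w - x)\<bar> * norm (E w)"
      by (simp add: scaleR_diff_left[symmetric])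
    also have "\<dots> \<le> B" unfolding B_def using k E by (intro mult_mono) auto
    finally show "norm (\<kappa> (w - y) *\<^sub>R E w - \<kappa> (w - x) *\<^sub>R E w) \<le> B" .
  qed
  also have "measure lborel Q = (2 * \<rho>) ^ n"
    using \<rho> unfolding Q_def by (subst content_cbox) (auto simp: n_def inner_simps)
  also have "(2 * \<rho>) ^ n = 2 ^ n * (\<Lambda> + 1) ^ n * \<delta> ^ n" by (simp add: \<rho>_def power_mult_distrib)
  also have "B * (2 ^ n * (\<Lambda> + 1) ^ n * \<delta> ^ n) = C * real n * 2 ^ n * (\<Lambda> + 1) ^ Suc n * \<eta> * norm (y - x)"
    using \<delta> by (simp add: B_def \<rho>_def field_simps)
  finally show ?thesis unfolding eq n_def .
qed

section \<open>Rademacher's theorem\<close>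

text \<open>Adding (L + 1) t makes the function increasing and bi-Lipschitz. The length of the image
  of a set is then an absolutely continuous measure; its Radon-Nikodym density integrates to
  increments of \<open>w\<close>, and Lebesgue's differentiation theorem gives the
  derivative.\<close>

lemma lipschitz_real_negligible_not_differentiable:
  fixes v :: "real \<Rightarrow> real"
  assumes v: "L-lipschitz_on UNIV v"
  shows "negligible {t. \<not> v differentiable (at t)}"
proof -
  define w where "w t = v t + (L + 1) * t" for t
  have L: "L \<ge> 0" using v lipschitz_on_nonneg by blast
  have vd: "\<bar>v t - v s\<bar> \<le> L * \<bar>t - s\<bar>" for s t
    using lipschitz_onD[OF v, of t s] by (simp add: dist_real_def)
  have lo: "w t - w s \<ge> t - s" if "s \<le> t" for s t
    using vd[of t s] that by (simp add: w_def algebra_simps abs_if split: if_splits)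
  have hi: "\<bar>w t - w s\<bar> \<le> (2 * L + 1) * \<bar>t - s\<bar>" for s t
  proof -
    have "w t - w s = (v t - v s) + (L + 1) * (t - s)" by (simp add: w_def algebra_simps)
    also have "\<bar>\<dots>\<bar> \<le> \<bar>v t - v s\<bar> + (L + 1) * \<bar>t - s\<bar>"
      using abs_triangle_ineq[of "v t - v s" "(L + 1) * (t - s)"] L by (simp add: abs_mult)
    finally show ?thesis using vd[of t s] by (simp add: algebra_simps)
  qed
  have mono: "strict_mono w" using lo by (intro strict_monoI) (smt (verit))
  have "continuous_on UNIV v" using lipschitz_on_continuous_on[OF v] .
  then have cont: "continuous_on UNIV w" unfolding w_def by (intro continuous_intros)
  have surj: "surj w"
  proof -
    have "\<exists>x. w x = y" for y
    proof -
      define r where "r = \<bar>y\<bar> + \<bar>w 0\<bar>"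
      have "r \<ge> 0" by (simp add: r_def)
      then have "w (-r) \<le> w 0 - r" "w 0 + r \<le> w r" using lo[of "-r" 0] lo[of 0 r] by auto
      then have "w (-r) \<le> y" "y \<le> w r" "-r \<le> r" using \<open>r \<ge> 0\<close> unfolding r_def by linarith+
      moreover have "continuous_on {-r..r} w" using cont continuous_on_subset by blast
      ultimately show ?thesis using IVT'[of w "-r" y r] by blast
    qed
    then show ?thesis by (metis surj_def)
  qed
  have bij: "bij w" using strict_mono_imp_inj_on[OF mono] surj by (auto simp: bij_def)
  define k where "k = inv w"
  have wk: "w (k y) = y" "k (w y) = y" for y
    using bij by (auto simp: k_def bij_is_surj surj_f_inv_f bij_is_inj)
  have kl: "\<bar>k y - k z\<bar> \<le> \<bar>y - z\<bar>" for y z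
    using lo[of "k y" "k z"] lo[of "k z" "k y"] wk by (cases "k y \<le> k z") auto
  have "1-lipschitz_on UNIV k" using kl by (intro lipschitz_onI) (auto simp: dist_real_def)
  then have [measurable]: "k \<in> borel_measurable borel"
    using borel_measurable_continuous_onI lipschitz_on_continuous_on by blast
  have kv: "k -` A = w ` A" for A
  proof (rule set_eqI)
    fix y show "y \<in> k -` A \<longleftrightarrow> y \<in> w ` A"
      using wk by (metis imageE image_eqI vimageE vimageI)
  qed
  define \<mu> where "\<mu> = distr lborel borel k"
  have em: "emeasure \<mu> A = emeasure lborel (w ` A)" if "A \<in> sets borel" for A
    unfolding \<mu>_def using that kv by (simp add: emeasure_distr)
  have "absolutely_continuous lborel \<mu>"
    unfolding absolutely_continuous_def
  proof
    fix A :: "real set" assume A: "A \<in> null_sets lborel"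
    then have "negligible A" using negligible_iff_null_sets null_sets_completionI by blast
    then have "negligible (w ` A)"
      using hi by (intro negligible_locally_Lipschitz_image) (auto intro!: exI[of _ UNIV] exI[of _ "2 * L + 1"])
    moreover have Ab: "A \<in> sets borel" using A by auto
    moreover have "w ` A \<in> sets borel"
      using Ab measurable_sets[of k borel borel A] kv by simp
    ultimately have "emeasure lborel (w ` A) = 0"
      using negligible_iff_emeasure0[of "w ` A"] by (simp add: emeasure_completion)
    then show "A \<in> null_sets \<mu>" using em[OF Ab] Ab by (auto simp: null_sets_def \<mu>_def)
  qed
  moreover have "sets \<mu> = sets lborel" by (simp add: \<mu>_def)
  ultimately obtain \<psi> where [measurable]: "\<psi> \<in> borel_measurable lborel" and \<psi>: "density lborel \<psi> = \<mu>"
    using sigma_finite_measure.Radon_Nikodym[OF sigma_finite_lborel] by blast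
  \<comment> \<open>\<open>enn2real\<close> sends an infinite density to 0; this changes it only on
    a null set, as \<open>ae\<close> shows on every interval.\<close>
  define \<phi> where "\<phi> x = enn2real (\<psi> x)" for x
  have [measurable]: "\<phi> \<in> borel_measurable borel" unfolding \<phi>_def by simp
  have int: "(\<phi> has_integral (w b - w a)) {a..b}" if "a \<le> b" for a b
  proof -
    have "w ` {a..b} = {w a..w b}"
    proof
      show "w ` {a..b} \<subseteq> {w a..w b}" using mono by (auto simp: strict_mono_less_eq)
      show "{w a..w b} \<subseteq> w ` {a..b}"
      proof
        fix y assume "y \<in> {w a..w b}"
        then have "k y \<in> {a..b}" using wk mono by (metis atLeastAtMost_iff strict_mono_less_eq)
        then show "y \<in> w ` {a..b}" by (metis image_eqI wk(1))
      qed
    qed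
    then have "emeasure \<mu> {a..b} = ennreal (w b - w a)"
      using em[of "{a..b}"] that mono by (simp add: strict_mono_less_eq)
    then have I: "(\<integral>\<^sup>+x. \<psi> x * indicator {a..b} x \<partial>lborel) = ennreal (w b - w a)"
      unfolding \<psi>[symmetric] by (simp add: emeasure_density)
    have "AE x in lborel. \<psi> x * indicator {a..b} x \<noteq> \<infinity>"
      using I by (intro nn_integral_PInf_AE) auto
    then have ae: "AE x in lborel. \<psi> x * indicator {a..b} x = ennreal (\<phi> x * indicator {a..b} x)"
    proof eventually_elim
      case (elim x) then show ?case
        by (cases "x \<in> {a..b}") (auto simp: \<phi>_def ennreal_enn2real_if)
    qed
    have I2: "(\<integral>\<^sup>+x. ennreal (\<phi> x * indicator {a..b} x) \<partial>lborel) = ennreal (w b - w a)"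
      using nn_integral_cong_AE[OF ae] I by simp
    have "((\<lambda>x. \<phi> x * indicator {a..b} x) has_integral (w b - w a)) UNIV"
      by (rule nn_integral_has_integral[OF _ _ I2])
         (use that mono in \<open>auto simp: \<phi>_def strict_mono_less_eq\<close>)
    then have "((\<lambda>x. if x \<in> {a..b} then \<phi> x else 0) has_integral (w b - w a)) UNIV"
      by (rule has_integral_eq[rotated]) auto
    then show ?thesis by (simp only: has_integral_restrict_UNIV)
  qed
  have i1: "\<phi> integrable_on cbox a b" for a b
    using int[of a b] by (cases "a \<le> b") (auto simp: integrable_on_def)
  \<comment> \<open>The averages below run over intervals that start at the point and so control
    right derivatives only. The reflected density yields the left derivative at t as a right one at
    -t.\<close>
  have int': "((\<lambda>x. \<phi> (- x)) has_integral (w (-a) - w (-b))) {a..b}" if "a \<le> b" for a b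
    using int[of "-b" "-a"] that has_integral_reflect_real[where f=\<phi> and i="w (-a) - w (-b)" and a="-b" and b="-a"] by simp
  then have i2: "(\<lambda>x. \<phi> (-x)) integrable_on cbox a b" for a b
    by (cases "a \<le> b") (auto simp: integrable_on_def)
  obtain N1 where N1: "negligible N1" and d1: "\<And>x e. \<lbrakk>x \<notin> N1; 0 < e\<rbrakk> \<Longrightarrow> \<exists>d>0. \<forall>h. 0 < h \<and> h < d \<longrightarrow>
      norm (integral (cbox x (x + h *\<^sub>R One)) \<phi> /\<^sub>R h ^ DIM(real) - \<phi> x) < e"
    using integrable_ccontinuous_explicit[OF i1] by blast
  obtain N2 where N2: "negligible N2" and d2: "\<And>x e. \<lbrakk>x \<notin> N2; 0 < e\<rbrakk> \<Longrightarrow> \<exists>d>0. \<forall>h. 0 < h \<and> h < d \<longrightarrow>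
      norm (integral (cbox x (x + h *\<^sub>R One)) (\<lambda>x. \<phi> (-x)) /\<^sub>R h ^ DIM(real) - \<phi> (-x)) < e"
    using integrable_ccontinuous_explicit[OF i2] by blast
  have diff: "v differentiable (at t)" if t: "t \<notin> N1" "-t \<notin> N2" for t
  proof -
    have "(w has_real_derivative \<phi> t) (at t)"
      unfolding DERIV_def LIM_eq
    proof (intro allI impI)
      fix e :: real assume "0 < e"
      obtain r1 where r1: "r1 > 0" "\<And>h. 0 < h \<Longrightarrow> h < r1 \<Longrightarrow>
          norm (integral (cbox t (t + h *\<^sub>R One)) \<phi> /\<^sub>R h ^ DIM(real) - \<phi> t) < e"
        using d1[OF t(1) \<open>0 < e\<close>] by blast
      obtain r2 where r2: "r2 > 0" "\<And>h. 0 < h \<Longrightarrow> h < r2 \<Longrightarrow>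
          norm (integral (cbox (-t) (-t + h *\<^sub>R One)) (\<lambda>x. \<phi> (-x)) /\<^sub>R h ^ DIM(real) - \<phi> (- (-t))) < e"
        using d2[OF t(2) \<open>0 < e\<close>] by blast
      show "\<exists>s>0. \<forall>h. h \<noteq> 0 \<and> norm (h - 0) < s \<longrightarrow> norm ((w (t + h) - w t) / h - \<phi> t) < e"
      proof (intro exI conjI allI impI)
        show "min r1 r2 > 0" using r1 r2 by simp
        fix h :: real assume h: "h \<noteq> 0 \<and> norm (h - 0) < min r1 r2"
        show "norm ((w (t + h) - w t) / h - \<phi> t) < e"
        proof (cases "h > 0")
          case True
          have "integral (cbox t (t + h *\<^sub>R One)) \<phi> = w (t + h) - w t"
            using int[of t "t + h"] True by (simp add: integral_unique)
          then show ?thesis using r1(2)[of h] True h by (simp add: divide_inverse mult.commute)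
        next
          case False
          then have h': "0 < -h" using h by simp
          have eq: "-t + (-h) *\<^sub>R One = -t-h" "- (-t-h) = t + h" by simp_all
          have "((\<lambda>x. \<phi> (-x)) has_integral (w (- (-t)) - w (- (-t-h)))) {-t..-t-h}"
            using h' by (intro int') simp
          then have I: "integral (cbox (-t) (-t + (-h) *\<^sub>R One)) (\<lambda>x. \<phi> (-x)) = w t - w (t + h)"
            unfolding eq cbox_interval minus_minus by (rule integral_unique)
          have "-h < r2" using h by (auto simp: abs_if split: if_splits)
          from r2(2)[OF h' this] have "norm ((w t - w (t + h)) /\<^sub>R (-h) ^ DIM(real) - \<phi> t) < e"
            unfolding I minus_minus .
          moreover have "(w t - w (t + h)) /\<^sub>R (-h) ^ DIM(real) = (w (t + h) - w t) / h"
            using h' by (simp add: divide_simps)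
          ultimately show ?thesis by simp
        qed
      qed
    qed
    then have "((\<lambda>t. w t - (L + 1) * t) has_real_derivative (\<phi> t - (L + 1))) (at t)"
      by (auto intro!: derivative_eq_intros)
    moreover have "(\<lambda>t. w t - (L + 1) * t) = v" by (auto simp: w_def)
    ultimately show ?thesis using real_differentiable_def by blast
  qed
  have "negligible (uminus ` N2)"
    using N2 by (intro negligible_locally_Lipschitz_image) (auto intro!: exI[of _ "UNIV::real set"] exI[of _ "1::real"])
  moreover have "{t. \<not> v differentiable (at t)} \<subseteq> N1 \<union> uminus ` N2"
    using diff by (force simp: image_iff)
  ultimately show ?thesis using N1 by (meson negligible_Un negligible_subset)
qed

text \<open>These are the points where \<open>A\<close> has holes of fixed proportion at arbitrarily
  small scales. Vitali's theorem covers almost all of them in a large ball by disjoint balls of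
  radius 2 |v| inside an open \<open>U\<close> that barely exceeds \<open>T\<close>. Each ball
  contains a hole of proportion 1/q = (\<epsilon>/2)^n, and the holes lie in \<open>U - T\<close>,
  so the balls together have at most q times its measure.\<close>

lemma closed_porous_negligible:
  fixes A :: "'a::euclidean_space set"
  assumes A: "closed A" and \<epsilon>: "0 < \<epsilon>" "\<epsilon> \<le> 1"
  shows "negligible {x \<in> A. \<forall>r>0. \<exists>v. v \<noteq> 0 \<and> norm v < r \<and> ball (x + v) (\<epsilon> * norm v) \<inter> A = {}}"
proof -
  define S where "S = {x \<in> A. \<forall>r>0. \<exists>v. v \<noteq> 0 \<and> norm v < r \<and> ball (x + v) (\<epsilon> * norm v) \<inter> A = {}}"
  have neg: "negligible (S \<inter> cball 0 R)" for R
    unfolding negligible_outer_le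
  proof (intro allI impI)
    fix e :: real assume e: "e > 0"
    define q where "q = (2 / \<epsilon>) ^ DIM('a)"
    have q: "q > 0" using \<epsilon> by (simp add: q_def)
    define T where "T = A \<inter> cball 0 R"
    have "T \<in> sets lebesgue" unfolding T_def using A by (intro fmeasurableD lmeasurable_compact closed_Int_compact) auto
    then obtain U where U: "open U" "T \<subseteq> U" "U - T \<in> lmeasurable" "emeasure lebesgue (U - T) < ennreal (e / q)"
      using sets_lebesgue_outer_open[of T "e / q"] e q by auto
    then have mU: "measure lebesgue (U - T) \<le> e / q"
      using e q by (metis divide_pos_pos emeasure_eq_measure2 ennreal_le_iff less_imp_le)
    define K where "K = {i. fst i \<in> S \<inter> cball 0 R \<and> snd i \<noteq> 0 \<and> cball (fst i) (2 * norm (snd i)) \<subseteq> U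
        \<and> ball (fst i + snd i) (\<epsilon> * norm (snd i)) \<inter> A = {}}"
    define H where "H i = ball (fst i + snd i) (\<epsilon> * norm (snd i))" for i :: "'a \<times> 'a"
    obtain C where C: "countable C" "C \<subseteq> K"
      and pw: "pairwise (\<lambda>i j. disjnt (cball (fst i) (2 * norm (snd i))) (cball (fst j) (2 * norm (snd j)))) C"
      and N: "negligible (S \<inter> cball 0 R - (\<Union>i\<in>C. cball (fst i) (2 * norm (snd i))))"
    proof (rule Vitali_covering_theorem_cballs[of K "\<lambda>i. 2 * norm (snd i)" "S \<inter> cball 0 R" fst])
      show "0 < 2 * norm (snd i)" if "i \<in> K" for i using that by (auto simp: K_def)
      fix x d assume x: "x \<in> S \<inter> cball 0 R" and d: "(0::real) < d"
      have "x \<in> U" using x U by (auto simp: S_def T_def)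
      then obtain r where r: "r > 0" "cball x r \<subseteq> U" using U(1) open_contains_cball by blast
      have "min (d / 2) (r / 2) > 0" using d r by simp
      then obtain v where v: "v \<noteq> 0" "norm v < min (d / 2) (r / 2)" "ball (x + v) (\<epsilon> * norm v) \<inter> A = {}"
        using x by (auto simp: S_def simp del: min_less_iff_conj)
      have "cball x (2 * norm v) \<subseteq> U" using v r by (auto simp: subset_iff)
      then have "(x, v) \<in> K" using x v by (auto simp: K_def)
      then show "\<exists>i. i \<in> K \<and> x \<in> cball (fst i) (2 * norm (snd i)) \<and> 2 * norm (snd i) < d"
        using v by (intro exI[of _ "(x, v)"]) auto
    qed blast
    have Hsub: "H i \<subseteq> cball (fst i) (2 * norm (snd i))" for i
    proof
      fix y assume "y \<in> H i"
      then have "norm (fst i + snd i - y) < \<epsilon> * norm (snd i)" by (simp add: H_def dist_norm)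
      also have "\<dots> \<le> norm (snd i)" using \<epsilon> by (simp add: mult_left_le_one_le)
      finally show "y \<in> cball (fst i) (2 * norm (snd i))"
        using norm_triangle_ineq4[of "fst i + snd i - y" "snd i"] by (simp add: dist_norm)
    qed
    have bound: "measure lebesgue (\<Union>i\<in>I. cball (fst i) (2 * norm (snd i))) \<le> e" if I: "I \<subseteq> C" "finite I" for I
    proof -
      have "measure lebesgue (\<Union>i\<in>I. cball (fst i) (2 * norm (snd i))) \<le> (\<Sum>i\<in>I. measure lebesgue (cball (fst i) (2 * norm (snd i))))"
        using I by (intro measure_UNION_le) auto
      also have "\<dots> = (\<Sum>i\<in>I. q * measure lebesgue (H i))"
        using \<epsilon> by (intro sum.cong) (auto simp: H_def q_def content_cball content_ball power_mult_distrib power_divide)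
      also have "\<dots> = q * measure lebesgue (\<Union>i\<in>I. H i)"
      proof -
        have "disjoint_family_on H I"
          unfolding disjoint_family_on_def
        proof (intro ballI impI)
          fix i j assume "i \<in> I" "j \<in> I" "i \<noteq> j"
          then have "disjnt (cball (fst i) (2 * norm (snd i))) (cball (fst j) (2 * norm (snd j)))"
            using pw I by (meson pairwiseD subsetD)
          then show "H i \<inter> H j = {}" using Hsub[of i] Hsub[of j] by (auto simp: disjnt_def)
        qed
        then have "measure lebesgue (\<Union>i\<in>I. H i) = (\<Sum>i\<in>I. measure lebesgue (H i))"
          using I fmeasurableD2[OF lmeasurable_ball] unfolding H_def by (intro measure_finite_Union) auto
        then show ?thesis by (simp add: sum_distrib_left)
      qed
      also have "\<dots> \<le> q * measure lebesgue (U - T)"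
      proof (intro mult_left_mono measure_mono_fmeasurable U)
        show "(\<Union>i\<in>I. H i) \<subseteq> U - T"
        proof (intro UN_least)
          fix i assume "i \<in> I"
          then have "i \<in> K" using I C by blast
          then show "H i \<subseteq> U - T" using Hsub[of i] by (auto simp: K_def H_def T_def)
        qed
      qed (use q in \<open>auto simp: H_def intro!: sets.finite_UN I\<close>)
      also have "\<dots> \<le> e" using mU q by (simp add: field_simps)
      finally show ?thesis .
    qed
    let ?W = "\<Union>i\<in>C. cball (fst i) (2 * norm (snd i))"
    let ?N = "S \<inter> cball 0 R - ?W"
    have W: "?W \<in> lmeasurable" "measure lebesgue ?W \<le> e"
      using fmeasurable_UN_bound[OF C(1) _ bound] measure_UN_bound[OF C(1) _ bound] by auto
    show "\<exists>T. S \<inter> cball 0 R \<subseteq> T \<and> T \<in> lmeasurable \<and> measure lebesgue T \<le> e"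
    proof (intro exI conjI)
      show "S \<inter> cball 0 R \<subseteq> ?W \<union> ?N" by blast
      show "?W \<union> ?N \<in> lmeasurable" using W N by (intro fmeasurable.Un) (auto intro: negligible_imp_measurable)
      have "measure lebesgue (?W \<union> ?N) \<le> measure lebesgue ?W + measure lebesgue ?N"
        using W N by (intro measure_Un_le) (auto intro: negligible_imp_sets)
      then show "measure lebesgue (?W \<union> ?N) \<le> e" using W N by (simp add: negligible_imp_measure0)
    qed
  qed
  have "S = \<Union> (range (\<lambda>n::nat. S \<inter> cball 0 (real n)))"
    using real_arch_simple by (auto simp: )
  moreover have "negligible (\<Union> (range (\<lambda>n::nat. S \<inter> cball 0 (real n))))"
    using neg by (intro negligible_countable_Union) auto
  ultimately have "negligible S" by simp
  then show ?thesis by (simp add: S_def)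
qed

text \<open>The linear map may change with the accuracy. Two maps that are good to accuracies e and
  e' near \<open>x\<close> differ by at most e + e', so they converge, and the limit is the
  derivative.\<close>

lemma approx_imp_differentiable:
  fixes u :: "'a::euclidean_space \<Rightarrow> real"
  assumes appr: "\<And>e. e > 0 \<Longrightarrow> \<exists>a. \<exists>r>0. \<forall>v. norm v < r \<longrightarrow> \<bar>u (x + v) - u x - a \<bullet> v\<bar> \<le> e * norm v"
  shows "u differentiable (at x)"
proof -
  have "\<exists>a r. r > 0 \<and> (\<forall>v. norm v < r \<longrightarrow> \<bar>u (x + v) - u x - a \<bullet> v\<bar> \<le> inverse (real (Suc n)) * norm v)" for n
    using appr[of "inverse (real (Suc n))"] by auto
  then obtain a r where r: "\<And>n. r n > 0"
    and a: "\<And>n v. norm v < r n \<Longrightarrow> \<bar>u (x + v) - u x - a n \<bullet> v\<bar> \<le> inverse (real (Suc n)) * norm v"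
    by metis
  have d: "norm (a m - a n) \<le> inverse (real (Suc m)) + inverse (real (Suc n))" for m n
  proof (cases "a m = a n")
    case False
    define w where "w = a m - a n"
    define t where "t = min (r m) (r n) / (2 * norm w)"
    have w: "norm w > 0" using False by (simp add: w_def)
    have t: "t > 0" using r w by (simp add: t_def)
    have "norm (t *\<^sub>R w) = t * norm w" using t by simp
    also have "\<dots> = min (r m) (r n) / 2" using w by (simp add: t_def)
    finally have "norm (t *\<^sub>R w) = min (r m) (r n) / 2" .
    then have "norm (t *\<^sub>R w) < r m" "norm (t *\<^sub>R w) < r n" using r[of m] r[of n] by auto
    then have "\<bar>a m \<bullet> (t *\<^sub>R w) - a n \<bullet> (t *\<^sub>R w)\<bar>
        \<le> inverse (real (Suc m)) * norm (t *\<^sub>R w) + inverse (real (Suc n)) * norm (t *\<^sub>R w)"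
      using a[of "t *\<^sub>R w" m] a[of "t *\<^sub>R w" n] by linarith
    moreover have "a m \<bullet> (t *\<^sub>R w) - a n \<bullet> (t *\<^sub>R w) = t * norm w * norm w"
      by (simp add: w_def inner_simps dot_square_norm[symmetric] power2_eq_square[symmetric] algebra_simps flip: power2_eq_square)
    ultimately have "(t * norm w) * norm w \<le> (t * norm w) * (inverse (real (Suc m)) + inverse (real (Suc n)))"
      using t by (simp add: algebra_simps abs_le_iff)
    then show ?thesis using t w unfolding w_def[symmetric] by (simp add: mult_le_cancel_left)
  qed (simp add: inverse_nonnegative_iff_nonnegative)
  have inv0: "(\<lambda>n. inverse (real (Suc n))) \<longlonglongrightarrow> 0" by (rule LIMSEQ_inverse_real_of_nat)
  have "Cauchy a"
  proof (rule metric_CauchyI)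
    fix e :: real assume "e > 0"
    then obtain N where N: "\<And>n. n \<ge> N \<Longrightarrow> inverse (real (Suc n)) < e / 2"
      using order_tendstoD(2)[OF inv0, of "e / 2"] by (auto simp: eventually_sequentially)
    show "\<exists>M. \<forall>m\<ge>M. \<forall>n\<ge>M. dist (a m) (a n) < e"
    proof (intro exI allI impI)
      fix m n assume "N \<le> m" "N \<le> n"
      then show "dist (a m) (a n) < e" using d[of m n] N[of m] N[of n] by (simp add: dist_norm)
    qed
  qed
  then obtain l where l: "a \<longlonglongrightarrow> l" using Cauchy_convergent convergent_def by blast
  have dl: "norm (l - a n) \<le> inverse (real (Suc n))" for n
  proof -
    have "(\<lambda>m. norm (a m - a n)) \<longlonglongrightarrow> norm (l - a n)" by (intro tendsto_intros l)
    moreover have "(\<lambda>m. inverse (real (Suc m)) + inverse (real (Suc n))) \<longlonglongrightarrow> 0 + inverse (real (Suc n))"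
      by (intro tendsto_intros inv0)
    ultimately show ?thesis using LIMSEQ_le[of "\<lambda>m. norm (a m - a n)"] d by force
  qed
  have "(u has_derivative (\<lambda>h. l \<bullet> h)) (at x)"
    unfolding has_derivative_at_alt
  proof (intro conjI allI impI)
    show "bounded_linear ((\<bullet>) l)" by (rule bounded_linear_inner_right)
    fix e :: real assume "e > 0"
    then obtain n where n: "inverse (real (Suc n)) < e / 2"
      using order_tendstoD(2)[OF inv0, of "e / 2"] by (auto simp: eventually_sequentially)
    show "\<exists>d>0. \<forall>y. norm (y - x) < d \<longrightarrow> norm (u y - u x - l \<bullet> (y - x)) \<le> e * norm (y - x)"
    proof (intro exI conjI allI impI)
      show "r n > 0" by (rule r)
      fix y assume y: "norm (y - x) < r n"
      have 1: "\<bar>u y - u x - a n \<bullet> (y - x)\<bar> \<le> inverse (real (Suc n)) * norm (y - x)" using a[OF y] by simp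
      have "\<bar>(l - a n) \<bullet> (y - x)\<bar> \<le> norm (l - a n) * norm (y - x)" by (rule Cauchy_Schwarz_ineq2)
      also have "\<dots> \<le> inverse (real (Suc n)) * norm (y - x)" using dl by (intro mult_right_mono) auto
      finally have "\<bar>u y - u x - l \<bullet> (y - x)\<bar> \<le> 2 * inverse (real (Suc n)) * norm (y - x)"
        using 1 by (simp add: inner_simps)
      also have "\<dots> \<le> e * norm (y - x)" using n by (intro mult_right_mono) auto
      finally show "norm (u y - u x - l \<bullet> (y - x)) \<le> e * norm (y - x)" by simp
    qed
  qed
  then show ?thesis by (rule differentiableI)
qed

text \<open>Fubini without a choice of coordinates: by translation invariance the measure of
  \<open>N\<close> is the mean over t in [0,1] of the measures of N - t e, and exchanging the
  integrals leaves the sections along lines.\<close>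

lemma negligible_lines_imp_negligible:
  fixes N :: "'a::euclidean_space set"
  assumes N: "N \<in> sets borel" and lines: "\<And>x. negligible {t::real. x + t *\<^sub>R e \<in> N}"
  shows "negligible N"
proof -
  let ?f = "\<lambda>x t. indicator N (x + t *\<^sub>R e) * indicator {0..1} (t::real) :: ennreal"
  note [measurable] = N
  have "emeasure lborel N = (\<integral>\<^sup>+t. emeasure lborel N * indicator {0..1::real} t \<partial>lborel)"
    by (simp add: nn_integral_cmult_indicator)
  also have "\<dots> = (\<integral>\<^sup>+t. (\<integral>\<^sup>+x. ?f x t \<partial>lborel) \<partial>lborel)"
  proof (intro nn_integral_cong)
    fix t :: real
    have "emeasure lborel N = (\<integral>\<^sup>+x. indicator N x \<partial>distr lborel borel ((+) (t *\<^sub>R e)))"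
      by (simp add: lborel_distr_plus)
    also have "\<dots> = (\<integral>\<^sup>+x. indicator N (x + t *\<^sub>R e) \<partial>lborel)"
      by (subst nn_integral_distr) (auto simp: add.commute)
    finally show "emeasure lborel N * indicator {0..1} t = (\<integral>\<^sup>+x. ?f x t \<partial>lborel)"
      by (simp add: nn_integral_multc)
  qed
  also have "\<dots> = (\<integral>\<^sup>+x. (\<integral>\<^sup>+t. ?f x t \<partial>lborel) \<partial>lborel)"
    by (subst lborel_pair.Fubini') (auto simp: case_prod_unfold cong: measurable_cong_sets)
  also have "\<dots> = (\<integral>\<^sup>+x. 0 \<partial>(lborel::'a measure))"
  proof (intro nn_integral_cong)
    fix x :: 'a
    have "{t::real. x + t *\<^sub>R e \<in> N} \<in> sets borel" by measurable
    then have "{t::real. x + t *\<^sub>R e \<in> N} \<in> null_sets lborel"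
      using lines[of x] negligible_iff_emeasure0[of "{t::real. x + t *\<^sub>R e \<in> N}"]
      by (simp add: null_sets_def emeasure_completion)
    then have "AE t in lborel. \<not> x + t *\<^sub>R e \<in> N" using AE_not_in by force
    then have "AE t in lborel. ?f x t = 0" by eventually_elim simp
    then show "(\<integral>\<^sup>+t. ?f x t \<partial>lborel) = 0" by (subst nn_integral_0_iff_AE) auto
  qed
  finally have "emeasure lborel N = 0" by simp
  then show ?thesis
    using N negligible_iff_emeasure0[of N] by (simp add: emeasure_completion)
qed

text \<open>A fixed scale makes the set closed for continuous \<open>u\<close>. This serves twice:
  directional differentiability becomes a Borel condition, and
  \<open>closed_porous_negligible\<close> becomes applicable.\<close>

definition dir_approx :: "('a::euclidean_space \<Rightarrow> real) \<Rightarrow> 'a \<Rightarrow> real \<Rightarrow> real \<Rightarrow> real \<Rightarrow> 'a set" where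
  "dir_approx u e \<alpha> \<epsilon> r = {x. \<forall>t. \<bar>t\<bar> \<le> r \<longrightarrow> \<bar>u (x + t *\<^sub>R e) - u x - \<alpha> * t\<bar> \<le> \<epsilon> * \<bar>t\<bar>}"

lemma closed_dir_approx:
  assumes "continuous_on UNIV u"
  shows "closed (dir_approx u e \<alpha> \<epsilon> r)"
proof -
  have "continuous_on UNIV (\<lambda>x. u (x + t *\<^sub>R e))" for t
    by (rule continuous_on_compose2[OF assms]) (auto intro!: continuous_intros)
  then have cl: "closed {x. \<bar>u (x + t *\<^sub>R e) - u x - \<alpha> * t\<bar> \<le> \<epsilon> * \<bar>t\<bar>}" for t
    using assms by (intro closed_Collect_le continuous_intros) auto
  have eq: "dir_approx u e \<alpha> \<epsilon> r = (\<Inter>t\<in>{t. \<bar>t\<bar> \<le> r}. {x. \<bar>u (x + t *\<^sub>R e) - u x - \<alpha> * t\<bar> \<le> \<epsilon> * \<bar>t\<bar>})"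
    by (auto simp: dir_approx_def)
  show ?thesis unfolding eq by (intro closed_INT ballI cl)
qed

text \<open>The slope may vary with the accuracy \<open>k\<close>, and rational slopes keep the
  union countable.\<close>

definition dir_diff :: "('a::euclidean_space \<Rightarrow> real) \<Rightarrow> 'a \<Rightarrow> 'a set" where
  "dir_diff u e = (\<Inter>k::nat. \<Union>m::nat. \<Union>\<alpha>\<in>\<rat>. dir_approx u e \<alpha> (inverse (real (Suc k))) (inverse (real (Suc m))))"

lemma dir_diffI:
  assumes "(\<lambda>t::real. u (x + t *\<^sub>R e)) differentiable (at 0)"
  shows "x \<in> dir_diff u e"
proof -
  obtain D where D: "((\<lambda>t. u (x + t *\<^sub>R e)) has_real_derivative D) (at 0)"
    using assms real_differentiable_def by blast
  have "\<exists>m::nat. \<exists>\<alpha>\<in>\<rat>. x \<in> dir_approx u e \<alpha> (inverse (real (Suc k))) (inverse (real (Suc m)))" for k :: nat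
  proof -
    define c where "c = inverse (real (Suc k))"
    have c: "c > 0" by (simp add: c_def)
    obtain \<alpha> where \<alpha>: "\<alpha> \<in> \<rat>" "D - c / 2 < \<alpha>" "\<alpha> < D + c / 2"
      using Rats_dense_in_real[of "D - c / 2" "D + c / 2"] c by auto
    have "(\<lambda>h. (u (x + h *\<^sub>R e) - u x) / h) \<midarrow>0\<rightarrow> D" using D by (simp add: DERIV_def)
    then obtain s where s: "s > 0" "\<And>h. h \<noteq> 0 \<Longrightarrow> \<bar>h\<bar> < s \<Longrightarrow> \<bar>(u (x + h *\<^sub>R e) - u x) / h - D\<bar> < c / 2"
      using c half_gt_zero unfolding LIM_eq by (metis diff_zero real_norm_def)
    obtain m :: nat where m: "inverse (real (Suc m)) < s" using s(1) reals_Archimedean by blast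
    have "\<bar>u (x + t *\<^sub>R e) - u x - \<alpha> * t\<bar> \<le> c * \<bar>t\<bar>" if t: "\<bar>t\<bar> \<le> inverse (real (Suc m))" for t
    proof (cases "t = 0")
      case False
      have "\<bar>(u (x + t *\<^sub>R e) - u x) / t - \<alpha>\<bar> \<le> c" using s(2)[of t] False t m \<alpha> by linarith
      then have "\<bar>(u (x + t *\<^sub>R e) - u x) / t - \<alpha>\<bar> * \<bar>t\<bar> \<le> c * \<bar>t\<bar>" by (rule mult_right_mono) simp
      moreover have "((u (x + t *\<^sub>R e) - u x) / t - \<alpha>) * t = u (x + t *\<^sub>R e) - u x - \<alpha> * t"
        using False by (simp add: field_simps)
      ultimately show ?thesis by (metis abs_mult)
    qed simp
    then show ?thesis using \<alpha>(1) unfolding dir_approx_def c_def by blast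
  qed
  then show ?thesis by (simp add: dir_diff_def)
qed

lemma negligible_not_dir_diff:
  fixes u :: "'a::euclidean_space \<Rightarrow> real"
  assumes u: "L-lipschitz_on UNIV u"
  shows "negligible (- dir_diff u e)"
proof (rule negligible_lines_imp_negligible[where e = e])
  have "continuous_on UNIV u" using lipschitz_on_continuous_on[OF u] .
  then show "- dir_diff u e \<in> sets borel"
    unfolding dir_diff_def
    by (intro borel_comp sets.countable_INT'' sets.countable_UN'' borel_closed closed_dir_approx)
       (auto simp: countable_rat)
  fix x
  have "(L * norm e)-lipschitz_on UNIV (\<lambda>t. u (x + t *\<^sub>R e))"
  proof (rule lipschitz_onI)
    show "0 \<le> L * norm e" using lipschitz_on_nonneg[OF u] by simp
    fix s t :: real
    have "dist (u (x + s *\<^sub>R e)) (u (x + t *\<^sub>R e)) \<le> L * dist (x + s *\<^sub>R e) (x + t *\<^sub>R e)"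
      using lipschitz_onD[OF u] by blast
    also have "\<dots> = L * norm e * dist s t"
      by (simp add: dist_norm scaleR_diff_left[symmetric])
    finally show "dist (u (x + s *\<^sub>R e)) (u (x + t *\<^sub>R e)) \<le> L * norm e * dist s t" .
  qed
  from lipschitz_real_negligible_not_differentiable[OF this]
  show "negligible {t. x + t *\<^sub>R e \<in> - dir_diff u e}"
  proof (rule negligible_subset, safe)
    fix t assume nd: "x + t *\<^sub>R e \<notin> dir_diff u e" and d: "(\<lambda>t. u (x + t *\<^sub>R e)) differentiable (at t)"
    have "((\<lambda>t. u (x + t *\<^sub>R e)) \<circ> (\<lambda>s. t + s)) differentiable (at 0)"
      using d by (intro differentiable_chain_at) (auto intro!: derivative_intros)
    then have "(\<lambda>s. u ((x + t *\<^sub>R e) + s *\<^sub>R e)) differentiable (at 0)"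
      by (simp add: o_def algebra_simps)
    then show False using dir_diffI nd by blast
  qed
qed

text \<open>On the closed set \<open>A a k m\<close> the partial difference quotients are within
  1/(k+1) of the components of \<open>a\<close>, uniformly up to scale 1/(m+1). Where this set is
  not porous it comes so close to every nearby point that its partial increments can be borrowed
  there, which turns approximate partial derivatives into an approximate total one. Countably many
  porous sets are discarded.\<close>

lemma rademacher_real:
  fixes u :: "'a::euclidean_space \<Rightarrow> real"
  assumes u: "L-lipschitz_on UNIV u"
  shows "negligible {x. \<not> u differentiable (at x)}"
proof -
  have L: "L \<ge> 0" using u lipschitz_on_nonneg by blast
  have ul: "\<bar>u y - u x\<bar> \<le> L * norm (y - x)" for x y
    using lipschitz_onD[OF u, of y x] by (simp add: dist_norm)
  have cont: "continuous_on UNIV u" using lipschitz_on_continuous_on[OF u] .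
  obtain D :: "'a set" where D: "countable D" "\<And>X. open X \<Longrightarrow> X \<noteq> {} \<Longrightarrow> \<exists>d\<in>D. d \<in> X"
    by (rule countable_dense_setE) blast
  let ?i = "\<lambda>k::nat. inverse (real (Suc k))"
  define A where "A a k m = (\<Inter>i\<in>Basis. dir_approx u i (a \<bullet> i) (?i k) (?i m))" for a k m
  define P where "P a k m = {x \<in> A a k m. \<forall>r>0. \<exists>v. v \<noteq> 0 \<and> norm v < r \<and> ball (x + v) (?i k * norm v) \<inter> A a k m = {}}" for a k m
  define N where "N = (\<Union>i\<in>Basis. - dir_diff u i) \<union> (\<Union>a\<in>D. \<Union>k. \<Union>m. P a k m)"
  have clA: "closed (A a k m)" for a k m
    unfolding A_def by (intro closed_INT ballI closed_dir_approx cont)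
  have nP: "negligible (P a k m)" for a k m
    unfolding P_def by (rule closed_porous_negligible[OF clA]) (auto simp: field_simps)
  have nN: "negligible N"
  proof -
    have "negligible (\<Union>m. P a k m)" for a k using nP by (intro negligible_countable_Union) auto
    then have "negligible (\<Union>k. \<Union>m. P a k m)" for a by (intro negligible_countable_Union) auto
    then have "negligible (\<Union>a\<in>D. \<Union>k. \<Union>m. P a k m)" using D(1) by (intro negligible_countable_Union) auto
    moreover have "negligible (\<Union>i\<in>Basis. - dir_diff u i)"
      using negligible_not_dir_diff[OF u] by (intro negligible_Union) auto
    ultimately show ?thesis unfolding N_def by (rule negligible_Un[rotated])
  qed
  have "u differentiable (at x)" if x: "x \<notin> N" for x
  proof (rule approx_imp_differentiable)
    fix e :: real assume e: "e > 0"
    define n where "n = real DIM('a)"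
    have n: "n > 0" by (simp add: n_def)
    define C where "C = n * (2 + 2 * L)"
    have C: "C > 0" using n L by (simp add: C_def)
    obtain k :: nat where k: "?i k < e / C" using e C reals_Archimedean divide_pos_pos by blast
    \<comment> \<open>The accuracy of index \<open>2 * k + 1\<close> is half that of index
      \<open>k\<close>; the other half pays for moving the slopes to a vector of the countable dense
      set \<open>D\<close>.\<close>
    have "\<forall>i\<in>Basis. \<exists>m \<alpha>. x \<in> dir_approx u i \<alpha> (?i (2 * k + 1)) (?i m)"
    proof
      fix i :: 'a assume "i \<in> Basis"
      then have "x \<in> dir_diff u i" using x by (auto simp: N_def)
      then have "x \<in> (\<Union>m::nat. \<Union>\<alpha>\<in>\<rat>. dir_approx u i \<alpha> (?i (2 * k + 1)) (?i m))"
        unfolding dir_diff_def by (rule INT_D) simp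
      then show "\<exists>m \<alpha>. x \<in> dir_approx u i \<alpha> (?i (2 * k + 1)) (?i m)" by blast
    qed
    then obtain mm \<alpha> where \<alpha>: "\<And>i. i \<in> Basis \<Longrightarrow> x \<in> dir_approx u i (\<alpha> i) (?i (2 * k + 1)) (?i (mm i))"
      by metis
    have i2: "?i (2 * k + 1) = ?i k / 2" by (simp add: field_simps)
    define m where "m = Max (mm ` Basis)"
    have mm: "?i m \<le> ?i (mm i)" if "i \<in> Basis" for i
      using that by (intro le_imp_inverse_le) (auto simp: m_def)
    obtain a where a: "a \<in> D" "a \<in> ball (\<Sum>i\<in>Basis. \<alpha> i *\<^sub>R i) (?i k / 2)"
      using D(2)[of "ball (\<Sum>i\<in>Basis. \<alpha> i *\<^sub>R i) (?i k / 2)"] by auto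
    have ai: "\<bar>a \<bullet> i - \<alpha> i\<bar> \<le> ?i k / 2" if "i \<in> Basis" for i
    proof -
      have "\<bar>(a - (\<Sum>i\<in>Basis. \<alpha> i *\<^sub>R i)) \<bullet> i\<bar> \<le> norm (a - (\<Sum>i\<in>Basis. \<alpha> i *\<^sub>R i))"
        using that by (rule Basis_le_norm)
      then show ?thesis using a that by (simp add: inner_simps dist_norm norm_minus_commute)
    qed
    have xA: "x \<in> A a k m"
      unfolding A_def
    proof
      fix i :: 'a assume i: "i \<in> Basis"
      have "\<bar>u (x + t *\<^sub>R i) - u x - (a \<bullet> i) * t\<bar> \<le> ?i k * \<bar>t\<bar>" if t: "\<bar>t\<bar> \<le> ?i m" for t
      proof -
        have "\<bar>u (x + t *\<^sub>R i) - u x - \<alpha> i * t\<bar> \<le> ?i k / 2 * \<bar>t\<bar>"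
          using \<alpha>[OF i] t mm[OF i] unfolding dir_approx_def i2 by (simp add: order_trans)
        moreover have "\<bar>(a \<bullet> i - \<alpha> i) * t\<bar> \<le> ?i k / 2 * \<bar>t\<bar>"
          unfolding abs_mult using ai[OF i] by (rule mult_right_mono) simp
        moreover have "u (x + t *\<^sub>R i) - u x - (a \<bullet> i) * t = (u (x + t *\<^sub>R i) - u x - \<alpha> i * t) - (a \<bullet> i - \<alpha> i) * t"
          by (simp add: algebra_simps)
        moreover have "?i k / 2 * \<bar>t\<bar> + ?i k / 2 * \<bar>t\<bar> = ?i k * \<bar>t\<bar>" by simp
        ultimately show ?thesis by linarith
      qed
      then show "x \<in> dir_approx u i (a \<bullet> i) (?i k) (?i m)" by (auto simp: dir_approx_def)
    qed
    have "x \<notin> P a k m" using x a unfolding N_def by blast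
    then obtain r where r: "r > 0" "\<And>v. v \<noteq> 0 \<Longrightarrow> norm v < r \<Longrightarrow> ball (x + v) (?i k * norm v) \<inter> A a k m \<noteq> {}"
      using xA unfolding P_def by blast
    show "\<exists>a. \<exists>r>0. \<forall>v. norm v < r \<longrightarrow> \<bar>u (x + v) - u x - a \<bullet> v\<bar> \<le> e * norm v"
    proof (intro exI conjI allI impI)
      show "min r (?i m) > 0" using r by simp
      fix v :: 'a assume v: "norm v < min r (?i m)"
      \<comment> \<open>Walk from \<open>x\<close> to \<open>x + v\<close> one coordinate at a time.
        At each corner \<open>x + w\<close> a point x' of \<open>A a k m\<close> within |v|/(k+1)
        supplies the next increment, and the two passages between x' and the corner cost 2 L
        |v|/(k+1).\<close>
      have step: "\<bar>u (x + (\<Sum>i\<in>B. (v \<bullet> i) *\<^sub>R i)) - u x - a \<bullet> (\<Sum>i\<in>B. (v \<bullet> i) *\<^sub>R i)\<bar>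
          \<le> real (card B) * ((2 + 2 * L) * ?i k * norm v)" if "finite B" "B \<subseteq> Basis" for B
        using that
      proof (induction B rule: finite_induct)
        case empty then show ?case by simp
      next
        case (insert i B)
        define w where "w = (\<Sum>i\<in>B. (v \<bullet> i) *\<^sub>R i)"
        define t where "t = v \<bullet> i"
        have i: "i \<in> Basis" using insert by auto
        have IH: "\<bar>u (x + w) - u x - a \<bullet> w\<bar> \<le> real (card B) * ((2 + 2 * L) * ?i k * norm v)"
          using insert by (simp add: w_def)
        have tv: "\<bar>t\<bar> \<le> norm v" using i by (simp add: t_def Basis_le_norm)
        have wv: "norm w \<le> norm v"
        proof (rule norm_le_componentwise)
          fix j :: 'a assume j: "j \<in> Basis"
          have "w \<bullet> j = (\<Sum>i\<in>B. (v \<bullet> i) * (i \<bullet> j))" by (simp add: w_def inner_sum_left)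
          also have "\<dots> = (\<Sum>i\<in>B. if i = j then v \<bullet> j else 0)"
            using insert j by (intro sum.cong) (auto simp: inner_Basis)
          also have "\<dots> = (if j \<in> B then v \<bullet> j else 0)" using insert(1) by (simp add: sum.delta)
          finally show "\<bar>w \<bullet> j\<bar> \<le> \<bar>v \<bullet> j\<bar>" by simp
        qed
        obtain x' where x': "x' \<in> A a k m" "norm (x + w - x') \<le> ?i k * norm v"
        proof (cases "w = 0")
          case True then show thesis using that[of x] xA by simp
        next
          case False
          then obtain y where y: "y \<in> ball (x + w) (?i k * norm w)" "y \<in> A a k m"
            using r(2)[of w] wv v by auto
          have "norm (x + w - y) \<le> ?i k * norm w" using y(1) by (simp add: dist_norm)
          also have "\<dots> \<le> ?i k * norm v" using wv by (intro mult_left_mono) auto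
          finally show thesis by (rule that[OF y(2)])
        qed
        have "x' \<in> dir_approx u i (a \<bullet> i) (?i k) (?i m)" using x'(1) i by (auto simp: A_def)
        then have 1: "\<bar>u (x' + t *\<^sub>R i) - u x' - (a \<bullet> i) * t\<bar> \<le> ?i k * \<bar>t\<bar>"
          using tv v by (auto simp: dir_approx_def)
        have 2: "?i k * \<bar>t\<bar> \<le> ?i k * norm v" using tv by (intro mult_left_mono) auto
        have 3: "\<bar>u (x + w) - u x'\<bar> \<le> L * (?i k * norm v)"
          using ul[of "x + w" x'] x'(2) L by (meson mult_left_mono order_trans)
        have "\<bar>u (x + w + t *\<^sub>R i) - u (x' + t *\<^sub>R i)\<bar> \<le> L * norm (x + w - x')"
          using ul[of "x + w + t *\<^sub>R i" "x' + t *\<^sub>R i"] by simp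
        then have 4: "\<bar>u (x + w + t *\<^sub>R i) - u (x' + t *\<^sub>R i)\<bar> \<le> L * (?i k * norm v)"
          using x'(2) L by (meson mult_left_mono order_trans)
        have 5: "0 \<le> ?i k * norm v" by simp
        have "\<bar>u (x + w + t *\<^sub>R i) - u x - (a \<bullet> w + (a \<bullet> i) * t)\<bar>
            \<le> real (card B) * ((2 + 2 * L) * ?i k * norm v) + (2 * L * (?i k * norm v) + 2 * (?i k * norm v))"
          using IH 1 2 3 4 5 by linarith
        moreover have "(\<Sum>i\<in>insert i B. (v \<bullet> i) *\<^sub>R i) = w + t *\<^sub>R i"
          using insert by (simp add: w_def t_def add.commute)
        ultimately show ?case using insert by (simp add: algebra_simps inner_simps)
      qed
      have "(\<Sum>i\<in>Basis. (v \<bullet> i) *\<^sub>R i) = v" by (rule euclidean_representation)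
      then have "\<bar>u (x + v) - u x - a \<bullet> v\<bar> \<le> C * ?i k * norm v"
        using step[of Basis] by (simp add: C_def n_def mult_ac)
      also have "\<dots> \<le> e * norm v"
        using k C by (intro mult_right_mono) (auto simp: field_simps)
      finally show "\<bar>u (x + v) - u x - a \<bullet> v\<bar> \<le> e * norm v" .
    qed
  qed
  then have "{x. \<not> u differentiable (at x)} \<subseteq> N" by blast
  then show ?thesis using nN negligible_subset by blast
qed

theorem rademacher:
  fixes J :: "'a::euclidean_space \<Rightarrow> 'b::euclidean_space"
  assumes J: "L-lipschitz_on UNIV J"
  shows "negligible {x. \<not> J differentiable (at x)}"
proof -
  have "L-lipschitz_on UNIV (\<lambda>x. J x \<bullet> i)" if i: "i \<in> Basis" for i
  proof (rule lipschitz_onI)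
    fix x y
    have "\<bar>(J x - J y) \<bullet> i\<bar> \<le> norm (J x - J y)" using i by (rule Basis_le_norm)
    also have "\<dots> \<le> L * dist x y" using lipschitz_onD[OF J, of x y] by (simp add: dist_norm)
    finally show "dist (J x \<bullet> i) (J y \<bullet> i) \<le> L * dist x y" by (simp add: dist_real_def inner_simps)
  qed (use lipschitz_on_nonneg[OF J] in auto)
  then have "negligible (\<Union>i\<in>Basis. {x. \<not> (\<lambda>x. J x \<bullet> i) differentiable (at x)})"
    by (intro negligible_Union) (auto intro: rademacher_real)
  then show ?thesis
    by (rule negligible_subset) (auto simp: differentiable_componentwise_within[of J])
qed

section \<open>Images of singular points\<close>

text \<open>Shifting the slab by k R/N along \<open>n\<close>, for k < N, gives disjoint copies
  because its thickness 2R/(3N) is below the step R/N. All copies lie in the ball of radius 2R about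
  \<open>p\<close>.\<close>

lemma measure_slab_le:
  fixes n :: "'a::euclidean_space"
  assumes n: "norm n = 1" and N: "N > 0" and R: "R > 0"
  shows "measure lebesgue {w. norm (w - p) \<le> R \<and> \<bar>(w - p) \<bullet> n\<bar> \<le> R / (3 * real N)}
           \<le> measure lebesgue (cball (0::'a) (2 * R)) / real N"
proof -
  define d where "d = R / real N"
  have d: "d > 0" using R N by (simp add: d_def)
  define W where "W = cball p R \<inter> {w. (w - p) \<bullet> n \<le> d / 3} \<inter> {w. - (d / 3) \<le> (w - p) \<bullet> n}"
  have Weq: "{w. norm (w - p) \<le> R \<and> \<bar>(w - p) \<bullet> n\<bar> \<le> R / (3 * real N)} = W"
    unfolding W_def d_def by (auto simp: dist_norm norm_minus_commute abs_le_iff)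
  have "compact W"
    unfolding W_def by (intro compact_Int_closed closed_Collect_le continuous_intros) auto
  then have Wm: "W \<in> lmeasurable" by (rule lmeasurable_compact)
  define T where "T k = (+) ((real k * d) *\<^sub>R n) ` W" for k :: nat
  have Tm: "T k \<in> lmeasurable" "measure lebesgue (T k) = measure lebesgue W" for k
    unfolding T_def using Wm by (auto simp: measurable_translation measure_translation)
  have Tin: "\<bar>(w - p) \<bullet> n - real k * d\<bar> \<le> d / 3" if wT: "w \<in> T k" for w k
  proof -
    obtain y where "y \<in> W" and w: "w = (real k * d) *\<^sub>R n + y" using wT unfolding T_def by blast
    moreover have "(w - p) \<bullet> n - real k * d = (y - p) \<bullet> n"
      using n by (simp add: w inner_simps dot_square_norm)
    moreover have "(y - p) \<bullet> n \<le> d / 3 \<and> - (d / 3) \<le> (y - p) \<bullet> n" using \<open>y \<in> W\<close> by (simp only: W_def Int_iff mem_Collect_eq)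
    ultimately show ?thesis by linarith
  qed
  have "disjoint_family_on T {..<N}"
    unfolding disjoint_family_on_def
  proof (intro ballI impI)
    fix i j :: nat assume "i \<noteq> j"
    then have ij: "1 \<le> \<bar>real i - real j\<bar>" by linarith
    show "T i \<inter> T j = {}"
    proof (rule ccontr)
      assume "T i \<inter> T j \<noteq> {}"
      then obtain w where "w \<in> T i" "w \<in> T j" by blast
      from Tin[OF this(1)] Tin[OF this(2)] have "\<bar>real i * d - real j * d\<bar> \<le> 2 * d / 3" by linarith
      then have "\<bar>real i - real j\<bar> * d \<le> 2 * d / 3" using d by (simp add: left_diff_distrib[symmetric] abs_mult)
      moreover have "1 * d \<le> \<bar>real i - real j\<bar> * d" using ij d by (intro mult_right_mono) auto
      ultimately show False using d by linarith
    qed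
  qed
  then have "measure lebesgue (\<Union>k<N. T k) = (\<Sum>k<N. measure lebesgue (T k))"
    using Tm fmeasurableD2[OF Tm(1)] by (intro measure_finite_Union) (auto dest: fmeasurableD)
  then have "real N * measure lebesgue W = measure lebesgue (\<Union>k<N. T k)" by (simp add: Tm)
  also have "\<dots> \<le> measure lebesgue (cball p (2 * R))"
  proof (rule measure_mono_fmeasurable)
    show "(\<Union>k<N. T k) \<subseteq> cball p (2 * R)"
    proof
      fix w assume "w \<in> (\<Union>k<N. T k)"
      then obtain k y where k: "k < N" and y: "y \<in> W" and w: "w = (real k * d) *\<^sub>R n + y" by (auto simp: T_def)
      have "real k * d \<le> real N * d" using k d by (intro mult_right_mono) auto
      also have "\<dots> = R" using N by (simp add: d_def)
      finally have "norm ((real k * d) *\<^sub>R n) \<le> R" using d n by simp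
      moreover have "norm (y - p) \<le> R" using y by (simp add: W_def dist_norm norm_minus_commute)
      ultimately have "norm (w - p) \<le> R + R"
        unfolding w using norm_triangle_ineq[of "(real k * d) *\<^sub>R n" "y - p"] by (simp add: algebra_simps)
      then show "w \<in> cball p (2 * R)" by (simp add: dist_norm norm_minus_commute)
    qed
  qed (use Tm in \<open>auto intro: fmeasurableD\<close>)
  also have "\<dots> = measure lebesgue (cball (0::'a) (2 * R))" using R by (simp add: content_cball)
  finally show ?thesis unfolding Weq using N by (simp add: field_simps)
qed

lemma singular_image_flat:
  fixes D :: "'a::euclidean_space \<Rightarrow> 'a"
  assumes D: "linear D" and ninj: "\<not> inj D"
  obtains n where "norm n = 1" "\<And>v. D v \<bullet> n = 0"
proof -
  have "\<not> surj D" using D ninj linear_surjective_imp_injective by blast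
  moreover have "subspace (range D)" using D by (simp add: linear_subspace_image)
  ultimately have "dim (range D) < DIM('a)"
    by (metis dim_eq_full dim_subset_UNIV le_neq_implies_less span_eq_iff)
  then obtain z where z: "z \<noteq> 0" "\<And>y. y \<in> span (range D) \<Longrightarrow> orthogonal z y"
    using orthogonal_to_subspace_exists by blast
  show thesis
  proof (rule that[of "z /\<^sub>R norm z"])
    show "norm (z /\<^sub>R norm z) = 1" using z(1) by simp
    show "D v \<bullet> (z /\<^sub>R norm z) = 0" for v
      using z(2)[of "D v"] by (simp add: span_base orthogonal_def inner_commute)
  qed
qed

text \<open>\<open>baby_Sard\<close> of the library is confined to the types \<open>real^'n\<close>.\<close>

theorem negligible_image_singular_derivative:
  fixes J :: "'a::euclidean_space \<Rightarrow> 'a"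
  assumes J: "L-lipschitz_on UNIV J"
    and S: "\<And>z. z \<in> S \<Longrightarrow> \<exists>D. (J has_derivative D) (at z) \<and> \<not> inj D"
  shows "negligible (J ` S)"
proof -
  have L0: "L \<ge> 0" using J lipschitz_on_nonneg by blast
  define K where "K = L + 1"
  have K: "K > 0" using L0 by (simp add: K_def)
  have Jl: "norm (J y - J x) \<le> K * norm (y - x)" for x y
  proof -
    have "norm (J y - J x) \<le> L * norm (y - x)" using lipschitz_onD[OF J, of y x] by (simp add: dist_norm)
    also have "\<dots> \<le> K * norm (y - x)" by (intro mult_right_mono) (auto simp: K_def)
    finally show ?thesis .
  qed
  have neg: "negligible (J ` (S \<inter> ball 0 R))" if R: "R > 0" for R
    unfolding negligible_outer_le
  proof (intro allI impI)
    fix e :: real assume e: "e > 0"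
    let ?V = "(2 * K) ^ DIM('a) * measure lebesgue (ball (0::'a) R)"
    obtain N :: nat where N: "?V / e < real N" using reals_Archimedean2 by blast
    have V: "?V > 0" using R K by (simp add: content_ball_pos)
    have N0: "N > 0" using N V e by (metis divide_pos_pos gr0I less_trans of_nat_0 order_less_irrefl)
    have NV: "?V / real N \<le> e" using N N0 e by (simp add: field_simps)
    define \<eta> where "\<eta> = K / (3 * real N)"
    have \<eta>: "\<eta> > 0" using K N0 by (simp add: \<eta>_def)
    \<comment> \<open>Balls whose image stays in a thin slab about the hyperplane that contains the
      image of a singular derivative. Their images gain the factor 1/N of
      \<open>measure_slab_le\<close> over the volume of the balls, and \<open>N\<close> was chosen
      so that this outweighs (2K)^n times the volume of the ball of radius \<open>R\<close>.\<close>
    define I where "I = {i. fst i \<in> S \<inter> ball 0 R \<and> snd i > 0 \<and> cball (fst i) (snd i) \<subseteq> ball 0 R \<and>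
      (\<exists>n. norm n = 1 \<and> (\<forall>y\<in>cball (fst i) (snd i). \<bar>(J y - J (fst i)) \<bullet> n\<bar> \<le> \<eta> * snd i))}"
    obtain C where C: "countable C" "C \<subseteq> I"
      and pw: "pairwise (\<lambda>i j. disjnt (cball (fst i) (snd i)) (cball (fst j) (snd j))) C"
      and Ng: "negligible (S \<inter> ball 0 R - (\<Union>i\<in>C. cball (fst i) (snd i)))"
    proof (rule Vitali_covering_theorem_cballs[of I snd "S \<inter> ball 0 R" fst])
      show "0 < snd i" if "i \<in> I" for i using that by (auto simp: I_def)
      fix z d assume z: "z \<in> S \<inter> ball 0 R" and d: "(0::real) < d"
      obtain D where D: "(J has_derivative D) (at z)" "\<not> inj D" using S z by blast
      have lin: "linear D" using D(1) has_derivative_linear by blast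
      obtain n where n: "norm n = 1" "\<And>v. D v \<bullet> n = 0" using singular_image_flat[OF lin D(2)] by blast
      obtain s where s: "s > 0" "\<And>y. norm (y - z) < s \<Longrightarrow> norm (J y - J z - D (y - z)) \<le> \<eta> * norm (y - z)"
        using D(1) \<eta> unfolding has_derivative_at_alt by blast
      obtain r where r: "r > 0" "cball z r \<subseteq> ball 0 R"
        using z open_contains_cball[of "ball (0::'a) R"] by (meson IntD2 open_ball)
      define t where "t = Min {d / 2, s / 2, r}"
      have t: "t > 0" "t < d" "t < s" "t \<le> r" using d s r by (auto simp: t_def min_def)
      have "\<bar>(J y - J z) \<bullet> n\<bar> \<le> \<eta> * t" if y: "y \<in> cball z t" for y
      proof -
        have yz: "norm (y - z) \<le> t" using y by (simp add: dist_norm norm_minus_commute)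
        have "(J y - J z) \<bullet> n = (J y - J z - D (y - z)) \<bullet> n" using n by (simp add: inner_simps)
        also have "\<bar>\<dots>\<bar> \<le> norm (J y - J z - D (y - z)) * norm n" by (rule Cauchy_Schwarz_ineq2)
        also have "\<dots> \<le> \<eta> * norm (y - z)" using s(2)[of y] yz t n by simp
        also have "\<dots> \<le> \<eta> * t" using yz \<eta> by simp
        finally show ?thesis .
      qed
      then have "(z, t) \<in> I" using z t r n by (auto simp: I_def)
      then show "\<exists>i. i \<in> I \<and> z \<in> cball (fst i) (snd i) \<and> snd i < d"
        using t by (intro exI[of _ "(z, t)"]) auto
    qed blast
    have "\<exists>n. norm n = 1 \<and> (\<forall>y\<in>cball (fst i) (snd i). \<bar>(J y - J (fst i)) \<bullet> n\<bar> \<le> \<eta> * snd i)" if "i \<in> C" for i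
      using that C by (auto simp: I_def)
    then obtain n where n: "\<And>i. i \<in> C \<Longrightarrow> norm (n i) = 1"
      "\<And>i y. i \<in> C \<Longrightarrow> y \<in> cball (fst i) (snd i) \<Longrightarrow> \<bar>(J y - J (fst i)) \<bullet> n i\<bar> \<le> \<eta> * snd i" by metis
    define W where "W i = {w. norm (w - J (fst i)) \<le> K * snd i \<and> \<bar>(w - J (fst i)) \<bullet> n i\<bar> \<le> K * snd i / (3 * real N)}" for i
    have JW: "J ` cball (fst i) (snd i) \<subseteq> W i" if "i \<in> C" for i
    proof clarify
      fix y assume y: "y \<in> cball (fst i) (snd i)"
      have "norm (J y - J (fst i)) \<le> K * norm (y - fst i)" by (rule Jl)
      also have "\<dots> \<le> K * snd i" using y K by (simp add: dist_norm norm_minus_commute)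
      finally show "J y \<in> W i" using n(2)[OF that y] by (simp add: W_def \<eta>_def)
    qed
    have pos: "snd i > 0" if "i \<in> C" for i using that C by (auto simp: I_def)
    have Wm: "W i \<in> lmeasurable" for i
    proof -
      have "W i = cball (J (fst i)) (K * snd i) \<inter> {w. \<bar>(w - J (fst i)) \<bullet> n i\<bar> \<le> K * snd i / (3 * real N)}"
        by (auto simp: W_def dist_norm norm_minus_commute)
      also have "compact \<dots>" by (intro compact_Int_closed closed_Collect_le continuous_intros) auto
      finally show ?thesis by (rule lmeasurable_compact)
    qed
    have Wle: "measure lebesgue (W i) \<le> (2 * K) ^ DIM('a) / real N * measure lebesgue (cball (fst i) (snd i))" if "i \<in> C" for i
    proof -
      have "measure lebesgue (W i) \<le> measure lebesgue (cball (0::'a) (2 * (K * snd i))) / real N"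
        unfolding W_def using n(1)[OF that] N0 K pos[OF that] by (intro measure_slab_le) auto
      also have "\<dots> = (2 * K) ^ DIM('a) / real N * measure lebesgue (cball (fst i) (snd i))"
        using K pos[OF that] by (simp add: content_cball power_mult_distrib)
      finally show ?thesis .
    qed
    have bound: "measure lebesgue (\<Union>i\<in>F. W i) \<le> e" if F: "F \<subseteq> C" "finite F" for F
    proof -
      have "measure lebesgue (\<Union>i\<in>F. W i) \<le> (\<Sum>i\<in>F. measure lebesgue (W i))"
        using F Wm by (intro measure_UNION_le) (auto dest: fmeasurableD)
      also have "\<dots> \<le> (\<Sum>i\<in>F. (2 * K) ^ DIM('a) / real N * measure lebesgue (cball (fst i) (snd i)))"
        using F Wle by (intro sum_mono) blast
      also have "\<dots> = (2 * K) ^ DIM('a) / real N * measure lebesgue (\<Union>i\<in>F. cball (fst i) (snd i))"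
      proof -
        have "disjoint_family_on (\<lambda>i. cball (fst i) (snd i)) F"
          unfolding disjoint_family_on_def using pairwiseD[OF pw] F by (metis disjnt_def subsetD)
        then have "measure lebesgue (\<Union>i\<in>F. cball (fst i) (snd i)) = (\<Sum>i\<in>F. measure lebesgue (cball (fst i) (snd i)))"
          using F fmeasurableD2[OF lmeasurable_cball] by (intro measure_finite_Union) auto
        then show ?thesis by (simp only: sum_distrib_left)
      qed
      also have "\<dots> \<le> (2 * K) ^ DIM('a) / real N * measure lebesgue (ball (0::'a) R)"
      proof (intro mult_left_mono measure_mono_fmeasurable)
        show "(\<Union>i\<in>F. cball (fst i) (snd i)) \<subseteq> ball 0 R" using F C by (auto simp: I_def)
      qed (use K F in auto)
      also have "\<dots> \<le> e" using NV by simp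
      finally show ?thesis .
    qed
    let ?W = "\<Union>i\<in>C. W i"
    let ?N = "J ` (S \<inter> ball 0 R - (\<Union>i\<in>C. cball (fst i) (snd i)))"
    have N: "negligible ?N"
      using Ng Jl by (intro negligible_locally_Lipschitz_image) (auto intro!: exI[of _ "UNIV::'a set"] exI[of _ K])
    have W: "?W \<in> lmeasurable" "measure lebesgue ?W \<le> e"
      using fmeasurable_UN_bound[OF C(1) _ bound] measure_UN_bound[OF C(1) _ bound] Wm by auto
    show "\<exists>T. J ` (S \<inter> ball 0 R) \<subseteq> T \<and> T \<in> lmeasurable \<and> measure lebesgue T \<le> e"
    proof (intro exI conjI)
      show "J ` (S \<inter> ball 0 R) \<subseteq> ?W \<union> ?N" using JW by blast
      show "?W \<union> ?N \<in> lmeasurable" using W N by (intro fmeasurable.Un) (auto intro: negligible_imp_measurable)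
      have "measure lebesgue (?W \<union> ?N) \<le> measure lebesgue ?W + measure lebesgue ?N"
        using W N by (intro measure_Un_le) (auto intro: negligible_imp_sets)
      then show "measure lebesgue (?W \<union> ?N) \<le> e" using W N by (simp add: negligible_imp_measure0)
    qed
  qed
  have "J ` S = \<Union> (range (\<lambda>n::nat. J ` (S \<inter> ball 0 (real (Suc n)))))"
  proof -
    have "\<exists>n::nat. norm z < real (Suc n)" for z :: 'a
      by (metis reals_Archimedean2 less_trans lessI of_nat_less_iff)
    then show ?thesis by (fastforce simp del: of_nat_Suc)
  qed
  moreover have "negligible (\<Union> (range (\<lambda>n::nat. J ` (S \<inter> ball 0 (real (Suc n))))))"
    by (intro negligible_countable_Union) (auto intro!: neg simp del: of_nat_Suc)
  ultimately show ?thesis by simp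
qed

section \<open>From bounded to continuous second derivatives\<close>

text \<open>Rademacher's theorem with a uniform radius, in the manner of Egorov. The sets are closed
  because the linear maps involved are bounded by M + \<eta> and thus subconverge; they grow as
  \<open>s\<close> decreases and contain every point of differentiability in the end, so continuity
  of the measure from above applies.\<close>

lemma nearly_affine_exhaustion:
  fixes G :: "'a::euclidean_space \<Rightarrow> 'a"
  assumes G: "M-lipschitz_on UNIV G" and \<eta>: "\<eta> > 0" and \<epsilon>: "\<epsilon> > 0"
  obtains s where "s > 0"
    "measure lebesgue (cball 0 R - {x. \<exists>A::'a \<Rightarrow>\<^sub>L 'a. \<forall>y. norm (y - x) \<le> s \<longrightarrow>
        norm (G y - G x - A (y - x)) \<le> \<eta> * norm (y - x)}) < \<epsilon>"
    "closed {x. \<exists>A::'a \<Rightarrow>\<^sub>L 'a. \<forall>y. norm (y - x) \<le> s \<longrightarrow>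
        norm (G y - G x - A (y - x)) \<le> \<eta> * norm (y - x)}"
proof -
  define T where "T s = {x. \<exists>A::'a \<Rightarrow>\<^sub>L 'a. \<forall>y. norm (y - x) \<le> s \<longrightarrow>
        norm (G y - G x - A (y - x)) \<le> \<eta> * norm (y - x)}" for s
  have M: "M \<ge> 0" using G lipschitz_on_nonneg by blast
  have Gl: "norm (G y - G x) \<le> M * norm (y - x)" for x y
    using lipschitz_onD[OF G, of y x] by (simp add: dist_norm)
  have cG: "continuous_on UNIV G" using lipschitz_on_continuous_on[OF G] .
  have clT: "closed (T s)" if s: "s > 0" for s
    unfolding closed_sequential_limits
  proof (intro allI impI, elim conjE)
    fix x l assume x: "\<forall>n. x n \<in> T s" and l: "x \<longlonglongrightarrow> l"
    obtain A :: "nat \<Rightarrow> 'a \<Rightarrow>\<^sub>L 'a" where A: "\<And>n y. norm (y - x n) \<le> s \<Longrightarrow>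
        norm (G y - G (x n) - A n (y - x n)) \<le> \<eta> * norm (y - x n)"
      using x unfolding T_def by simp metis
    have nA: "norm (A n) \<le> M + \<eta>" for n
    proof (rule norm_blinfun_bound)
      fix v
      show "norm (A n v) \<le> (M + \<eta>) * norm v"
      proof (cases "v = 0")
        case False
        define t where "t = s / norm v"
        have t: "t > 0" "norm (t *\<^sub>R v) = s" using s False by (auto simp: t_def)
        have "norm (A n (t *\<^sub>R v)) \<le> norm (G (x n + t *\<^sub>R v) - G (x n)) + norm (G (x n + t *\<^sub>R v) - G (x n) - A n (t *\<^sub>R v))"
          by (metis norm_triangle_sub norm_minus_commute add.commute)
        also have "\<dots> \<le> M * norm (t *\<^sub>R v) + \<eta> * norm (t *\<^sub>R v)"
          using Gl[of "x n + t *\<^sub>R v" "x n"] A[of "x n + t *\<^sub>R v" n] t(2) by (intro add_mono) auto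
        finally have "t * norm (A n v) \<le> t * ((M + \<eta>) * norm v)"
          using t(1) by (simp add: blinfun.scaleR_right algebra_simps)
        then show ?thesis using t(1) by simp
      qed (simp add: blinfun.zero_right)
    qed (use M \<eta> in simp)
    then have "bounded (range A)" by (auto simp: bounded_iff)
    then obtain B r where r: "strict_mono (r::nat \<Rightarrow> nat)" and B: "(A \<circ> r) \<longlonglongrightarrow> B"
      using bounded_imp_convergent_subsequence by blast
    have xr: "(\<lambda>n. x (r n)) \<longlonglongrightarrow> l" using LIMSEQ_subseq_LIMSEQ[OF l r] by (simp add: o_def)
    have Gx: "(\<lambda>n. G (x (r n))) \<longlonglongrightarrow> G l"
      using continuous_on_tendsto_compose[OF cG xr] by simp
    \<comment> \<open>A strict inequality passes from \<open>l\<close> to the nearby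
      \<open>x (r n)\<close>; the sphere |y - l| = s is recovered by closure.\<close>
    have lim: "norm (G y - G l - B (y - l)) \<le> \<eta> * norm (y - l)" if y: "norm (y - l) < s" for y
    proof (rule tendsto_le[OF sequentially_bot])
      show "(\<lambda>n. \<eta> * norm (y - x (r n))) \<longlonglongrightarrow> \<eta> * norm (y - l)" by (intro tendsto_intros xr)
      show "(\<lambda>n. norm (G y - G (x (r n)) - (A \<circ> r) n (y - x (r n)))) \<longlonglongrightarrow> norm (G y - G l - B (y - l))"
        by (intro tendsto_intros Gx xr blinfun.tendsto B)
      have "(\<lambda>n. norm (y - x (r n))) \<longlonglongrightarrow> norm (y - l)" by (intro tendsto_intros xr)
      then have "\<forall>\<^sub>F n in sequentially. norm (y - x (r n)) < s" using y by (rule order_tendstoD)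
      then show "\<forall>\<^sub>F n in sequentially. norm (G y - G (x (r n)) - (A \<circ> r) n (y - x (r n))) \<le> \<eta> * norm (y - x (r n))"
        by eventually_elim (auto intro: A)
    qed
    have "norm (G y - G l - B (y - l)) \<le> \<eta> * norm (y - l)" if y: "norm (y - l) \<le> s" for y
    proof -
      have "closed {y. norm (G y - G l - B (y - l)) \<le> \<eta> * norm (y - l)}"
        by (intro closed_Collect_le continuous_intros cG)
      moreover have "ball l s \<subseteq> {y. norm (G y - G l - B (y - l)) \<le> \<eta> * norm (y - l)}"
        using lim by (auto simp: dist_norm norm_minus_commute)
      ultimately have "closure (ball l s) \<subseteq> {y. norm (G y - G l - B (y - l)) \<le> \<eta> * norm (y - l)}"
        by (rule closure_minimal[rotated])
      then show ?thesis using y s by (auto simp: subset_iff dist_norm norm_minus_commute)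
    qed
    then show "l \<in> T s" by (auto simp: T_def)
  qed
  define i where "i m = inverse (real (Suc m))" for m
  have i: "i m > 0" for m by (simp add: i_def)
  define N where "N = {x. \<not> G differentiable (at x)}"
  have N: "negligible N" unfolding N_def by (rule rademacher[OF G])
  have cov: "x \<in> N \<or> (\<exists>m. x \<in> T (i m))" for x
  proof (cases "x \<in> N")
    case False
    then obtain D where D: "(G has_derivative D) (at x)" by (auto simp: N_def differentiable_def)
    then have bl: "bounded_linear D" by (rule has_derivative_bounded_linear)
    obtain r where r: "r > 0" "\<And>y. norm (y - x) < r \<Longrightarrow> norm (G y - G x - D (y - x)) \<le> \<eta> * norm (y - x)"
      using D \<eta> unfolding has_derivative_at_alt by blast
    obtain m where m: "i m < r" using r(1) reals_Archimedean unfolding i_def by blast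
    have "\<forall>y. norm (y - x) \<le> i m \<longrightarrow> norm (G y - G x - Blinfun D (y - x)) \<le> \<eta> * norm (y - x)"
      using r(2) m by (auto simp: bounded_linear_Blinfun_apply[OF bl])
    then show ?thesis unfolding T_def by blast
  qed simp
  define S where "S m = cball 0 R - T (i m)" for m
  have Sm: "S m \<in> lmeasurable" for m
    unfolding S_def using clT[OF i] by (intro fmeasurable.Diff lmeasurable_cball fmeasurable_Diff) auto
  have "(\<lambda>m. measure lebesgue (S m)) \<longlonglongrightarrow> measure lebesgue (\<Inter>m. S m)"
  proof (rule Lim_measure_decseq)
    show "range S \<subseteq> sets lebesgue" using Sm by (auto dest: fmeasurableD)
    have "T (i m) \<subseteq> T (i n)" if "m \<le> n" for m n
    proof -
      have "i n \<le> i m" using that by (simp add: i_def)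
      then show ?thesis unfolding T_def by (intro Collect_mono ex_mono) (meson order_trans)
    qed
    then show "decseq S" unfolding decseq_def S_def by blast
    show "emeasure lebesgue (S m) \<noteq> \<infinity>" for m using fmeasurableD2[OF Sm] by simp
  qed
  moreover have "negligible (\<Inter>m. S m)"
    using cov by (intro negligible_subset[OF N]) (auto simp: S_def)
  ultimately have "(\<lambda>m. measure lebesgue (S m)) \<longlonglongrightarrow> 0" by (simp add: negligible_imp_measure0)
  then have "\<forall>\<^sub>F m in sequentially. measure lebesgue (S m) < \<epsilon>" using order_tendstoD(2) \<epsilon> by blast
  then obtain m where "measure lebesgue (S m) < \<epsilon>" by (auto simp: eventually_sequentially)
  then show thesis using that[of "i m"] i clT[OF i, of m] unfolding S_def T_def by blast
qed

text \<open>The gradient estimate is centred at the single point \<open>x\<close>, which is the form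
  available at points of near affinity, where \<open>y\<close> is arbitrary but \<open>x\<close> is
  not.\<close>

lemma gradient_lipschitz_at_imp_quadratic_bound:
  fixes r :: "'a::euclidean_space \<Rightarrow> real"
  assumes d: "\<And>x. (r has_derivative (\<lambda>h. \<rho> x \<bullet> h)) (at x)"
    and l: "\<And>y. norm (\<rho> y - \<rho> x) \<le> \<eta> * norm (y - x)" and \<eta>: "\<eta> \<ge> 0"
  shows "\<bar>r y - r x - \<rho> x \<bullet> (y - x)\<bar> \<le> \<eta> * (norm (y - x))\<^sup>2"
proof -
  let ?F = "\<lambda>w. r w - \<rho> x \<bullet> w"
  have "norm (?F y - ?F x) \<le> (\<eta> * norm (y - x)) * norm (y - x)"
  proof (rule differentiable_bound[of "closed_segment x y" ?F "\<lambda>w h. (\<rho> w - \<rho> x) \<bullet> h"])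
    show "(?F has_derivative (\<lambda>h. (\<rho> w - \<rho> x) \<bullet> h)) (at w within closed_segment x y)" for w
      by (rule has_derivative_at_withinI) (auto intro!: derivative_eq_intros d simp: inner_simps)
    fix w assume w: "w \<in> closed_segment x y"
    have "norm (\<rho> w - \<rho> x) \<le> \<eta> * norm (w - x)" by (rule l)
    also have "\<dots> \<le> \<eta> * norm (y - x)"
      using segment_bound1[OF w] \<eta> by (intro mult_left_mono) (auto simp: norm_minus_commute)
    finally have n: "norm (\<rho> w - \<rho> x) \<le> \<eta> * norm (y - x)" .
    show "onorm (\<lambda>h. (\<rho> w - \<rho> x) \<bullet> h) \<le> \<eta> * norm (y - x)"
    proof (rule onorm_le)
      fix h
      have "norm ((\<rho> w - \<rho> x) \<bullet> h) \<le> norm (\<rho> w - \<rho> x) * norm h" using Cauchy_Schwarz_ineq2 by simp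
      also have "\<dots> \<le> \<eta> * norm (y - x) * norm h" using n by (intro mult_right_mono) auto
      finally show "norm ((\<rho> w - \<rho> x) \<bullet> h) \<le> \<eta> * norm (y - x) * norm h" .
    qed
  qed auto
  then show ?thesis by (simp add: inner_simps power2_eq_square algebra_simps)
qed

text \<open>The jet bound is global while the size is measured on a ball: mollifying near the
  boundary samples points outside the ball.\<close>

definition C11_ball :: "real \<Rightarrow> ('a::euclidean_space \<Rightarrow> real) \<Rightarrow> ('a \<Rightarrow> 'a) \<Rightarrow> real \<Rightarrow> bool" where
  "C11_ball R g G M \<longleftrightarrow> jet_bound UNIV g G M \<and> (\<forall>x. norm x \<le> R \<longrightarrow> \<bar>g x\<bar> \<le> M \<and> norm (G x) \<le> M)"

text \<open>At points of \<open>T\<close> the remainder \<open>g - \<phi>\<close> satisfies the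
  small jet bound at every distance, for two reasons. Up to \<Lambda> \<delta>, \<open>G\<close> and
  its mollification are both close to the same affine map up to constants
  (\<open>conv_near_affine\<close>). Beyond it, the gradient of the remainder is at most M \<delta>
  everywhere, which is small compared with the distance. The scale \<delta> is fixed last because it
  depends on the radius \<open>s\<close> of near affinity.\<close>

lemma C11_ball_smooth_step:
  fixes g :: "'a::euclidean_space \<Rightarrow> real"
  assumes g: "C11_ball R g G M" and R: "R > 0" and \<eta>: "\<eta> > 0" and \<epsilon>: "\<epsilon> > 0"
  obtains \<phi> \<Phi> H g' G' where "C2_jet \<phi> \<Phi> H" "\<And>x. norm (H x) \<le> M" "\<bar>\<phi> 0\<bar> \<le> M" "norm (\<Phi> 0) \<le> M"
    "C11_ball R g' G' \<eta>" "measure lebesgue {x \<in> cball 0 R. g x \<noteq> \<phi> x + g' x} \<le> \<epsilon>"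
proof -
  have jg: "jet_bound UNIV g G M" and bg: "\<And>x. norm x \<le> R \<Longrightarrow> \<bar>g x\<bar> \<le> M" "\<And>x. norm x \<le> R \<Longrightarrow> norm (G x) \<le> M"
    using g by (auto simp: C11_ball_def)
  have M: "M \<ge> 0" by (rule jet_bound_nonneg[OF jg])
  have GL: "M-lipschitz_on UNIV G" by (rule jet_bound_lipschitz[OF jg])
  have cG: "continuous_on UNIV G" using lipschitz_on_continuous_on[OF GL] .
  have cg: "continuous_on UNIV g" by (rule jet_bound_continuous[OF jg])
  have gd: "(g has_derivative (\<lambda>h. G x \<bullet> h)) (at x)" for x by (rule jet_bound_has_derivative[OF jg])
  define n where "n = real DIM('a)"
  have n: "n \<ge> 1" by (simp add: n_def Suc_leI)
  obtain C where C: "C > 0" "\<And>\<delta>. 0 < \<delta> \<Longrightarrow> \<delta> \<le> 1 \<Longrightarrow> \<exists>\<kappa> D. bump \<delta> (\<kappa> :: 'a \<Rightarrow> real) D (C / \<delta> ^ Suc DIM('a))"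
    using bump_exists by blast
  \<comment> \<open>\<open>Z\<close> accounts for the growth of the extension across the ball:
    expanding at a point of \<open>T\<close> in the ball, where it is small, involves displacements
    of length up to 2R. The 72 is the loss in \<open>jet_extension\<close>.\<close>
  define Z where "Z = 1 + 2 * R + 4 * R\<^sup>2"
  have Z: "Z > 0" using R by (simp add: Z_def add_pos_nonneg)
  define \<eta>1 where "\<eta>1 = \<eta> / (72 * Z)"
  have \<eta>1: "\<eta>1 > 0" using \<eta> Z by (simp add: \<eta>1_def)
  have "\<eta> = 72 * \<eta>1 * Z" using Z by (simp add: \<eta>1_def)
  then have \<eta>1': "\<eta> = 72 * \<eta>1 * (1 + 2 * R + 4 * R\<^sup>2)" by (simp only: Z_def)
  \<comment> \<open>Chosen so that 2 M \<delta>, the crude bound for a difference of remainder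
    gradients, is at most \<eta>1 |y - x| once |y - x| exceeds \<Lambda> \<delta>.\<close>
  define \<Lambda> where "\<Lambda> = 2 * M / \<eta>1 + 1"
  have \<Lambda>: "\<Lambda> \<ge> 1" "2 * M \<le> \<eta>1 * \<Lambda>" using M \<eta>1 by (auto simp: \<Lambda>_def field_simps)
  \<comment> \<open>The summand 1 is for the affine error of \<open>G\<close>, the rest for that of
    its mollification.\<close>
  define c where "c = 1 + C * real DIM('a) * 2 ^ DIM('a) * (\<Lambda> + 1) ^ Suc DIM('a)"
  have c: "c \<ge> 1" using C(1) \<Lambda> by (simp add: c_def)
  define \<eta>2 where "\<eta>2 = \<eta>1 / c"
  have \<eta>2: "\<eta>2 > 0" "\<eta>2 * c = \<eta>1" using c \<eta>1 by (auto simp: \<eta>2_def)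
  obtain s where s: "s > 0" and
    Ts: "measure lebesgue (cball 0 R - {x. \<exists>A::'a \<Rightarrow>\<^sub>L 'a. \<forall>y. norm (y - x) \<le> s \<longrightarrow>
        norm (G y - G x - A (y - x)) \<le> \<eta>2 * norm (y - x)}) < \<epsilon>"
    and clT: "closed {x. \<exists>A::'a \<Rightarrow>\<^sub>L 'a. \<forall>y. norm (y - x) \<le> s \<longrightarrow>
        norm (G y - G x - A (y - x)) \<le> \<eta>2 * norm (y - x)}"
    using nearly_affine_exhaustion[OF GL \<eta>2(1) \<epsilon>, of R] by blast
  define T where "T = {x. \<exists>A::'a \<Rightarrow>\<^sub>L 'a. \<forall>y. norm (y - x) \<le> s \<longrightarrow>
        norm (G y - G x - A (y - x)) \<le> \<eta>2 * norm (y - x)}"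
  \<comment> \<open>In order: the bump fits the unit cube; at 0 it averages only over the ball of
    radius \<open>R\<close>; the cube used in \<open>conv_near_affine\<close> stays within distance
    \<open>s\<close>; and 2 M \<delta> is at most \<eta>1, which makes the remainder and its
    gradient small.\<close>
  define \<delta> where "\<delta> = Min {1, R, s / (n * (\<Lambda> + 1)), \<eta>1 / (2 * M + 1)}"
  have nL: "n * (\<Lambda> + 1) > 0" using n \<Lambda> by simp
  have \<delta>0: "\<delta> > 0" using R s nL \<eta>1 M by (simp add: \<delta>_def)
  have \<delta>1: "\<delta> \<le> 1" "\<delta> \<le> R" by (auto simp: \<delta>_def)
  have "\<delta> \<le> s / (n * (\<Lambda> + 1))" by (simp add: \<delta>_def)
  then have \<delta>2: "n * ((\<Lambda> + 1) * \<delta>) \<le> s" using nL by (simp add: field_simps)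
  have "\<delta> \<le> \<eta>1 / (2 * M + 1)" by (simp add: \<delta>_def)
  then have "\<delta> * (2 * M + 1) \<le> \<eta>1" using M by (simp add: field_simps)
  then have \<delta>3: "2 * M * \<delta> \<le> \<eta>1" using \<delta>0 by (simp add: algebra_simps)
  have "M * \<delta> \<ge> 0" using M \<delta>0 by simp
  then have \<delta>4: "M * \<delta> \<le> \<eta>1" using \<delta>3 by linarith
  obtain \<kappa> D where b: "bump \<delta> (\<kappa> :: 'a \<Rightarrow> real) D (C / \<delta> ^ Suc DIM('a))" using C(2)[OF \<delta>0 \<delta>1(1)] by blast
  define \<phi> where "\<phi> = conv \<kappa> g"
  define \<Phi> where "\<Phi> = conv \<kappa> G"
  obtain H where H: "\<And>w. (\<Phi> has_derivative blinfun_apply (H w)) (at w)" "continuous_on UNIV H"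
    using conv_C1[OF b \<delta>1(1) cG] unfolding \<Phi>_def by blast
  have \<phi>d: "(\<phi> has_derivative (\<lambda>h. \<Phi> w \<bullet> h)) (at w)" for w
    unfolding \<phi>_def \<Phi>_def by (rule conv_has_gradient[OF b gd cG])
  have C2: "C2_jet \<phi> \<Phi> H" unfolding C2_jet_def using \<phi>d H by blast
  have \<Phi>l: "norm (\<Phi> y - \<Phi> x) \<le> M * norm (y - x)" for x y
    unfolding \<Phi>_def by (rule conv_lipschitz[OF b GL])
  have nH: "norm (H x) \<le> M" for x by (rule lipschitz_imp_norm_derivative_le[OF H(1) \<Phi>l M])
  have \<phi>0: "\<bar>\<phi> 0\<bar> \<le> M"
    using conv_near_const[OF b cg, of 0 0 M] bg(1) \<delta>1 by (simp add: \<phi>_def)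
  have \<Phi>0: "norm (\<Phi> 0) \<le> M"
    using conv_near_const[OF b cG, of 0 0 M] bg(2) \<delta>1 by (simp add: \<Phi>_def)
  define r where "r x = g x - \<phi> x" for x
  define \<rho> where "\<rho> x = G x - \<Phi> x" for x
  have rd: "(r has_derivative (\<lambda>h. \<rho> x \<bullet> h)) (at x)" for x
    unfolding r_def \<rho>_def by (auto intro!: derivative_eq_intros gd \<phi>d simp: inner_simps)
  have \<rho>M: "norm (\<rho> x) \<le> M * \<delta>" for x
  proof -
    have "norm (\<Phi> x - G x) \<le> M * \<delta>" unfolding \<Phi>_def
    proof (rule conv_near_const[OF b cG])
      fix t :: 'a assume t: "norm t \<le> \<delta>"
      have "norm (G (x + t) - G x) \<le> M * norm t" using lipschitz_onD[OF GL, of "x + t" x] by (simp add: dist_norm)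
      also have "\<dots> \<le> M * \<delta>" using t M by (rule mult_left_mono)
      finally show "norm (G (x + t) - G x) \<le> M * \<delta>" .
    qed
    then show ?thesis by (simp add: \<rho>_def norm_minus_commute)
  qed
  have r\<eta>: "\<bar>r x\<bar> \<le> \<eta>1" if x: "norm x \<le> R" for x
  proof -
    have "norm (\<phi> x - g x) \<le> \<eta>1" unfolding \<phi>_def
    proof (rule conv_near_const[OF b cg])
      fix t :: 'a assume t: "norm t \<le> \<delta>"
      have "\<bar>g (x + t) - g x - G x \<bullet> t\<bar> \<le> M * (norm t)\<^sup>2" using jet_boundD(1)[OF jg, of x "x + t"] by simp
      moreover have "\<bar>G x \<bullet> t\<bar> \<le> M * norm t"
        using Cauchy_Schwarz_ineq2[of "G x" t] bg(2)[OF x] by (meson mult_right_mono norm_ge_zero order_trans)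
      moreover have "(norm t)\<^sup>2 \<le> norm t" using t \<delta>1 by (simp add: power2_eq_square mult_left_le)
      then have "M * (norm t)\<^sup>2 \<le> M * norm t" using M by (rule mult_left_mono)
      moreover have "M * norm t \<le> M * \<delta>" using t M by (rule mult_left_mono)
      ultimately show "norm (g (x + t) - g x) \<le> \<eta>1" using \<delta>3 by simp
    qed
    then show ?thesis by (simp add: r_def)
  qed
  have \<rho>T: "norm (\<rho> y - \<rho> x) \<le> \<eta>1 * norm (y - x)" if x: "x \<in> T" for x y
  proof (cases "norm (y - x) \<le> \<Lambda> * \<delta>")
    case True
    obtain A :: "'a \<Rightarrow>\<^sub>L 'a" where A: "\<And>y. norm (y - x) \<le> s \<Longrightarrow> norm (G y - G x - A (y - x)) \<le> \<eta>2 * norm (y - x)"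
      using x unfolding T_def by blast
    have ge: "\<Lambda> * \<delta> \<le> s"
    proof -
      have "\<Lambda> * \<delta> \<le> 1 * ((\<Lambda> + 1) * \<delta>)" using \<delta>0 by (simp add: algebra_simps)
      also have "\<dots> \<le> n * ((\<Lambda> + 1) * \<delta>)" using n \<Lambda> \<delta>0 by (intro mult_right_mono) auto
      finally show ?thesis using \<delta>2 by linarith
    qed
    have 1: "norm (G y - G x - A (y - x)) \<le> \<eta>2 * norm (y - x)" using A True ge by simp
    have 2: "norm (\<Phi> y - \<Phi> x - A (y - x)) \<le> C * real DIM('a) * 2 ^ DIM('a) * (\<Lambda> + 1) ^ Suc DIM('a) * \<eta>2 * norm (y - x)"
      unfolding \<Phi>_def
    proof (rule conv_near_affine[OF b \<delta>0 \<delta>1(1) C(1) cG _ _ _ True])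
      show "norm (G w - G x - A (w - x)) \<le> \<eta>2 * norm (w - x)" if "norm (w - x) \<le> real DIM('a) * ((\<Lambda> + 1) * \<delta>)" for w
        using that \<delta>2 by (intro A) (simp add: n_def)
    qed (use \<Lambda> \<eta>2 in auto)
    have "\<rho> y - \<rho> x = (G y - G x - A (y - x)) - (\<Phi> y - \<Phi> x - A (y - x))" by (simp add: \<rho>_def)
    then have "norm (\<rho> y - \<rho> x) \<le> norm (G y - G x - A (y - x)) + norm (\<Phi> y - \<Phi> x - A (y - x))"
      by (metis norm_triangle_ineq4)
    also have "\<dots> \<le> (\<eta>2 * c) * norm (y - x)" using 1 2 by (simp add: c_def algebra_simps)
    finally show ?thesis using \<eta>2 by simp
  next
    case False
    have "norm (\<rho> y - \<rho> x) \<le> M * \<delta> + M * \<delta>" using norm_triangle_ineq4[of "\<rho> y" "\<rho> x"] \<rho>M[of x] \<rho>M[of y] by linarith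
    also have "\<dots> = 2 * M * \<delta>" by simp
    also have "\<dots> \<le> \<eta>1 * \<Lambda> * \<delta>" using \<Lambda>(2) \<delta>0 by (intro mult_right_mono) auto
    also have "\<dots> = \<eta>1 * (\<Lambda> * \<delta>)" by simp
    also have "\<dots> \<le> \<eta>1 * norm (y - x)" using False \<eta>1 by (intro mult_left_mono) auto
    finally show ?thesis .
  qed
  have jr: "jet_bound (T \<inter> cball 0 R) r \<rho> \<eta>1"
    unfolding jet_bound_def using \<rho>T \<eta>1 gradient_lipschitz_at_imp_quadratic_bound[OF rd \<rho>T] by auto
  obtain g' G' where g': "C11_ball R g' G' \<eta>" "\<And>x. x \<in> T \<inter> cball 0 R \<Longrightarrow> g' x = r x"
  proof (cases "T \<inter> cball 0 R = {}")
    case True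
    have "C11_ball R (\<lambda>_. 0) (\<lambda>_::'a. 0) \<eta>" using \<eta> by (auto simp: C11_ball_def jet_bound_def)
    then show thesis using that True by blast
  next
    case False
    then obtain x0 where x0: "x0 \<in> T" "norm x0 \<le> R" by auto
    obtain g' G' where e: "jet_bound UNIV g' G' (72 * \<eta>1)" "\<And>x. x \<in> T \<inter> cball 0 R \<Longrightarrow> g' x = r x"
        "\<And>x. x \<in> T \<inter> cball 0 R \<Longrightarrow> G' x = \<rho> x"
      using jet_extension[OF jr] \<eta>1 by (metis less_imp_le)
    have le: "72 * \<eta>1 \<le> \<eta>"
    proof -
      have "72 * \<eta>1 * 1 \<le> 72 * \<eta>1 * (1 + 2 * R + 4 * R\<^sup>2)" using \<eta>1 R by (intro mult_left_mono) auto
      then show ?thesis by (simp add: \<eta>1')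
    qed
    have j: "jet_bound UNIV g' G' \<eta>" by (rule jet_bound_mono[OF e(1) le])
    have r0: "\<bar>g' x0\<bar> \<le> \<eta>1" "norm (G' x0) \<le> \<eta>1"
      using e x0 r\<eta>[of x0] \<rho>M[of x0] \<delta>4 by auto
    have bd: "\<bar>g' x\<bar> \<le> \<eta> \<and> norm (G' x) \<le> \<eta>" if x: "norm x \<le> R" for x
    proof -
      have nx: "norm (x - x0) \<le> 2 * R" using norm_triangle_ineq4[of x x0] x x0 by linarith
      then have nx2: "(norm (x - x0))\<^sup>2 \<le> 4 * R\<^sup>2" using power_mono[OF nx, of 2] by (simp add: power_mult_distrib)
      have "\<bar>G' x0 \<bullet> (x - x0)\<bar> \<le> norm (G' x0) * norm (x - x0)" by (rule Cauchy_Schwarz_ineq2)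
      also have "\<dots> \<le> \<eta>1 * (2 * R)" using r0 nx \<eta>1 by (intro mult_mono) auto
      finally have 1: "\<bar>G' x0 \<bullet> (x - x0)\<bar> \<le> \<eta>1 * (2 * R)" .
      have "\<bar>g' x - g' x0 - G' x0 \<bullet> (x - x0)\<bar> \<le> 72 * \<eta>1 * (norm (x - x0))\<^sup>2" using jet_boundD(1)[OF e(1), of x0 x] by simp
      also have "\<dots> \<le> 72 * \<eta>1 * (4 * R\<^sup>2)" using nx2 \<eta>1 by (intro mult_left_mono) auto
      finally have "\<bar>g' x\<bar> \<le> \<eta>1 + \<eta>1 * (2 * R) + 72 * \<eta>1 * (4 * R\<^sup>2)" using 1 r0 by linarith
      also have "\<dots> \<le> \<eta>" using \<eta>1 R by (simp add: \<eta>1' algebra_simps)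
      finally have A: "\<bar>g' x\<bar> \<le> \<eta>" .
      have "norm (G' x - G' x0) \<le> 72 * \<eta>1 * norm (x - x0)" using jet_boundD(2)[OF e(1), of x0 x] by simp
      also have "\<dots> \<le> 72 * \<eta>1 * (2 * R)" using nx \<eta>1 by (intro mult_left_mono) auto
      finally have "norm (G' x) \<le> \<eta>1 + 72 * \<eta>1 * (2 * R)" using r0 norm_triangle_ineq2[of "G' x" "G' x0"] by linarith
      also have "\<dots> \<le> \<eta>" using \<eta>1 R by (simp add: \<eta>1' algebra_simps)
      finally show ?thesis using A by blast
    qed
    show thesis using that[of g' G'] e j bd by (auto simp: C11_ball_def)
  qed
  have sub: "{x \<in> cball 0 R. g x \<noteq> \<phi> x + g' x} \<subseteq> cball 0 R - T"
    using g'(2) by (auto simp: r_def)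
  have "measure lebesgue {x \<in> cball 0 R. g x \<noteq> \<phi> x + g' x} \<le> measure lebesgue (cball 0 R - T)"
  proof (rule measure_mono_fmeasurable[OF sub])
    have "continuous_on UNIV g'" using g'(1) jet_bound_continuous by (auto simp: C11_ball_def)
    then have "open {x. g x \<noteq> \<phi> x + g' x}" by (intro open_Collect_neq continuous_intros cg C2_jetD(5)[OF C2])
    moreover have "{x \<in> cball 0 R. g x \<noteq> \<phi> x + g' x} = cball 0 R \<inter> {x. g x \<noteq> \<phi> x + g' x}" by auto
    ultimately show "{x \<in> cball 0 R. g x \<noteq> \<phi> x + g' x} \<in> sets lebesgue" by auto
    show "cball 0 R - T \<in> lmeasurable" using clT unfolding T_def by (intro fmeasurable_Diff) auto
  qed
  then have "measure lebesgue {x \<in> cball 0 R. g x \<noteq> \<phi> x + g' x} \<le> \<epsilon>" using Ts unfolding T_def by linarith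
  then show thesis using that[OF C2 nH \<phi>0 \<Phi>0 g'(1)] by blast
qed

lemma neq_sets_lebesgue:
  fixes f g :: "'a::euclidean_space \<Rightarrow> real"
  assumes "continuous_on UNIV f" "continuous_on UNIV g" "S \<in> sets lebesgue"
  shows "{x \<in> S. f x \<noteq> g x} \<in> sets lebesgue"
proof -
  have "open {x. f x \<noteq> g x}" using assms by (intro open_Collect_neq)
  moreover have "{x \<in> S. f x \<noteq> g x} = S \<inter> {x. f x \<noteq> g x}" by auto
  ultimately show ?thesis using assms(3) by auto
qed

lemma measure_UN_geometric:
  assumes B: "\<And>k::nat. B k \<in> lmeasurable" and le: "\<And>k. measure lebesgue (B k) \<le> \<epsilon> / 2 ^ Suc k"
  shows "(\<Union>k. B k) \<in> lmeasurable" "measure lebesgue (\<Union>k. B k) \<le> \<epsilon>"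
proof -
  have s: "(\<lambda>k. \<epsilon> / 2 ^ Suc k) sums \<epsilon>"
    using sums_mult[OF power_half_series, of \<epsilon>] by (simp add: power_divide)
  have nn: "0 \<le> \<epsilon> / 2 ^ Suc k" for k using order_trans[OF measure_nonneg le] .
  have bound: "measure lebesgue (\<Union>k\<in>I. B k) \<le> \<epsilon>" if "finite I" for I
  proof -
    have "measure lebesgue (\<Union>k\<in>I. B k) \<le> (\<Sum>k\<in>I. measure lebesgue (B k))"
      using that B by (intro measure_UNION_le) (auto dest: fmeasurableD)
    also have "\<dots> \<le> (\<Sum>k\<in>I. \<epsilon> / 2 ^ Suc k)" using le by (rule sum_mono)
    also have "\<dots> \<le> (\<Sum>k. \<epsilon> / 2 ^ Suc k)"
      using s that nn by (intro sum_le_suminf) (auto simp: sums_iff)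
    finally show ?thesis using s by (simp add: sums_iff)
  qed
  show "(\<Union>k. B k) \<in> lmeasurable" "measure lebesgue (\<Union>k. B k) \<le> \<epsilon>"
    using fmeasurable_UN_bound[of UNIV B lebesgue \<epsilon>] measure_UN_bound[of UNIV B lebesgue \<epsilon>] B bound by auto
qed

text \<open>Off the exceptional sets the equation telescopes: \<open>g\<close> minus the first n
  mollifications is the n-th remainder, which is at most \<open>m n\<close> on the ball and tends to
  0. The derivatives of the n-th mollification are controlled by \<open>m n\<close> as well, hence
  summable however large the first constant is.\<close>

lemma C11_lusin_C2:
  fixes g :: "'a::euclidean_space \<Rightarrow> real"
  assumes g: "jet_bound UNIV g G M" and R: "R > 0" and \<epsilon>: "\<epsilon> > 0"
  obtains \<phi> where "C2_on_UNIV \<phi>" "measure lebesgue {x \<in> cball 0 R. g x \<noteq> \<phi> x} \<le> \<epsilon>"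
proof -
  have cg: "continuous_on S g" for S by (rule jet_bound_continuous[OF g])
  have cG: "continuous_on S G" for S using lipschitz_on_continuous_on[OF jet_bound_lipschitz[OF g]] .
  obtain B1 where B1: "\<And>x. x \<in> cball 0 R \<Longrightarrow> norm (g x) \<le> B1"
    using compact_imp_bounded[OF compact_continuous_image[OF cg compact_cball]] unfolding bounded_iff by blast
  obtain B2 where B2: "\<And>x. x \<in> cball 0 R \<Longrightarrow> norm (G x) \<le> B2"
    using compact_imp_bounded[OF compact_continuous_image[OF cG compact_cball]] unfolding bounded_iff by blast
  define M0 where "M0 = max M (max B1 B2)"
  \<comment> \<open>The constant of index 0 is forced by \<open>g\<close>; from index 1 on it may be
    prescribed.\<close>
  define m where "m k = (if k = 0 then M0 else (1 / 2) ^ k)" for k :: nat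
  have M0: "M0 \<ge> 0" using jet_bound_nonneg[OF g] by (simp add: M0_def)
  have m0: "m k \<ge> 0" for k using M0 by (simp add: m_def)
  have mS: "m (Suc k) > 0" for k by (simp add: m_def)
  have g0: "C11_ball R g G (m 0)"
    using jet_bound_mono[OF g, of M0] B1 B2 unfolding C11_ball_def m_def M0_def
    by (auto simp: le_max_iff_disj)
  define Q where "Q n p p' \<longleftrightarrow> (\<exists>\<phi> \<Phi> H. C2_jet \<phi> \<Phi> H \<and> (\<forall>x. norm (H x) \<le> m n) \<and> \<bar>\<phi> 0\<bar> \<le> m n \<and> norm (\<Phi> 0) \<le> m n \<and>
      measure lebesgue {x \<in> cball 0 R. fst p x \<noteq> \<phi> x + fst p' x} \<le> \<epsilon> / 2 ^ Suc n)"
    for n and p p' :: "('a \<Rightarrow> real) \<times> ('a \<Rightarrow> 'a)"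
  have "\<exists>p. \<forall>n. (C11_ball R (fst (p n)) (snd (p n)) (m n) \<and> (n = 0 \<longrightarrow> p n = (g, G))) \<and> Q n (p n) (p (Suc n))"
  proof (rule dependent_nat_choice)
    show "\<exists>p. C11_ball R (fst p) (snd p) (m 0) \<and> (0 = 0 \<longrightarrow> p = (g, G))" using g0 by auto
    fix p n assume "C11_ball R (fst p) (snd p) (m n) \<and> (n = 0 \<longrightarrow> p = (g, G))"
    then have p: "C11_ball R (fst p) (snd p) (m n)" by simp
    have "\<epsilon> / 2 ^ Suc n > 0" using \<epsilon> by simp
    then obtain \<phi> \<Phi> H g' G' where *: "C2_jet \<phi> \<Phi> H" "\<And>x. norm (H x) \<le> m n" "\<bar>\<phi> 0\<bar> \<le> m n" "norm (\<Phi> 0) \<le> m n"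
      "C11_ball R g' G' (m (Suc n))" "measure lebesgue {x \<in> cball 0 R. fst p x \<noteq> \<phi> x + g' x} \<le> \<epsilon> / 2 ^ Suc n"
      using C11_ball_smooth_step[OF p R mS] by blast
    have "Q n p (g', G')" unfolding Q_def using * by auto
    then show "\<exists>y. (C11_ball R (fst y) (snd y) (m (Suc n)) \<and> (Suc n = 0 \<longrightarrow> y = (g, G))) \<and> Q n p y"
      using *(5) by (intro exI[of _ "(g', G')"]) auto
  qed
  then obtain p where p: "\<And>n. C11_ball R (fst (p n)) (snd (p n)) (m n)" "p 0 = (g, G)" "\<And>n. Q n (p n) (p (Suc n))"
    by blast
  define gg where "gg n = fst (p n)" for n
  have "\<forall>n. \<exists>t. C2_jet (fst t) (fst (snd t)) (snd (snd t)) \<and> (\<forall>x. norm (snd (snd t) x) \<le> m n) \<and>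
      \<bar>fst t 0\<bar> \<le> m n \<and> norm (fst (snd t) 0) \<le> m n \<and>
      measure lebesgue {x \<in> cball 0 R. gg n x \<noteq> fst t x + gg (Suc n) x} \<le> \<epsilon> / 2 ^ Suc n"
  proof
    fix n
    obtain \<phi> \<Phi> H where "C2_jet \<phi> \<Phi> H \<and> (\<forall>x. norm (H x) \<le> m n) \<and> \<bar>\<phi> 0\<bar> \<le> m n \<and> norm (\<Phi> 0) \<le> m n \<and>
        measure lebesgue {x \<in> cball 0 R. gg n x \<noteq> \<phi> x + gg (Suc n) x} \<le> \<epsilon> / 2 ^ Suc n"
      using p(3)[of n] unfolding Q_def gg_def by blast
    then show "\<exists>t. C2_jet (fst t) (fst (snd t)) (snd (snd t)) \<and> (\<forall>x. norm (snd (snd t) x) \<le> m n) \<and>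
      \<bar>fst t 0\<bar> \<le> m n \<and> norm (fst (snd t) 0) \<le> m n \<and>
      measure lebesgue {x \<in> cball 0 R. gg n x \<noteq> fst t x + gg (Suc n) x} \<le> \<epsilon> / 2 ^ Suc n"
      by (intro exI[of _ "(\<phi>, \<Phi>, H)"]) simp
  qed
  from choice[OF this] obtain t where t: "\<And>n. C2_jet (fst (t n)) (fst (snd (t n))) (snd (snd (t n))) \<and>
      (\<forall>x. norm (snd (snd (t n)) x) \<le> m n) \<and> \<bar>fst (t n) 0\<bar> \<le> m n \<and> norm (fst (snd (t n)) 0) \<le> m n \<and>
      measure lebesgue {x \<in> cball 0 R. gg n x \<noteq> fst (t n) x + gg (Suc n) x} \<le> \<epsilon> / 2 ^ Suc n" by blast
  define \<phi> where "\<phi> n = fst (t n)" for n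
  define \<Phi> where "\<Phi> n = fst (snd (t n))" for n
  define H where "H n = snd (snd (t n))" for n
  have C2: "C2_jet (\<phi> n) (\<Phi> n) (H n)" and H: "norm (H n x) \<le> m n"
    and \<phi>0: "\<bar>\<phi> n 0\<bar> \<le> m n" and \<Phi>0: "norm (\<Phi> n 0) \<le> m n"
    and me: "measure lebesgue {x \<in> cball 0 R. gg n x \<noteq> \<phi> n x + gg (Suc n) x} \<le> \<epsilon> / 2 ^ Suc n" for n x
    using t[of n] by (auto simp: \<phi>_def \<Phi>_def H_def)
  have gg: "continuous_on UNIV (gg n)" "norm x \<le> R \<Longrightarrow> \<bar>gg n x\<bar> \<le> m n" for n x
    using p(1)[of n] jet_bound_continuous unfolding C11_ball_def gg_def by auto
  have sm: "summable m"
  proof -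
    have "summable (\<lambda>k. (1 / 2 :: real) ^ Suc k)" using power_half_series by (simp add: sums_iff)
    then have "summable (\<lambda>k. m (Suc k))" by (simp add: m_def)
    then show ?thesis by (simp only: summable_Suc_iff)
  qed
  have C2s: "C2_on_UNIV (\<lambda>x. \<Sum>n. \<phi> n x)"
  proof (rule C2_on_UNIV_suminf[OF C2])
    fix r :: real
    show "\<exists>a. summable a \<and> (\<forall>n x. norm x < r \<longrightarrow> norm (\<phi> n x) \<le> a n \<and> norm (\<Phi> n x) \<le> a n \<and> norm (H n x) \<le> a n)"
    proof (intro exI conjI allI impI)
      \<comment> \<open>The majorant comes from integrating the Hessian bound \<open>m n\<close>
        twice from 0, where value and gradient are at most \<open>m n\<close> too.\<close>
      show "summable (\<lambda>n. m n * (1 + r)\<^sup>2)" using sm by (rule summable_mult2)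
      fix n and x :: 'a assume x: "norm x < r"
      then have r: "r > 0" using norm_ge_zero le_less_trans by blast
      have \<Phi>: "norm (\<Phi> n y) \<le> m n * (1 + r)" if y: "norm y < r" for y
      proof -
        have "norm (\<Phi> n y - \<Phi> n 0) \<le> m n * norm (y - 0)"
          by (rule differentiable_bound[of UNIV _ "\<lambda>x. blinfun_apply (H n x)"])
             (use H C2_jetD(2)[OF C2] in \<open>auto simp: norm_blinfun.rep_eq[symmetric]\<close>)
        also have "\<dots> \<le> m n * r" using y m0 by (intro mult_left_mono) auto
        finally show ?thesis using \<Phi>0[of n] norm_triangle_sub[of "\<Phi> n y" "\<Phi> n 0"] by (simp add: algebra_simps)
      qed
      have "norm (\<phi> n x - \<phi> n 0) \<le> (m n * (1 + r)) * norm (x - 0)"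
      proof (rule differentiable_bound[of "ball 0 r" _ "\<lambda>x h. \<Phi> n x \<bullet> h"])
        show "(\<phi> n has_derivative (\<lambda>h. \<Phi> n y \<bullet> h)) (at y within ball 0 r)" for y
          by (rule has_derivative_at_withinI[OF C2_jetD(1)[OF C2]])
        fix y :: 'a assume "y \<in> ball 0 r"
        then have y: "norm (\<Phi> n y) \<le> m n * (1 + r)" using \<Phi> by simp
        show "onorm (\<lambda>h. \<Phi> n y \<bullet> h) \<le> m n * (1 + r)"
        proof (rule onorm_le)
          fix h
          have "norm (\<Phi> n y \<bullet> h) \<le> norm (\<Phi> n y) * norm h" using Cauchy_Schwarz_ineq2 by simp
          also have "\<dots> \<le> m n * (1 + r) * norm h" using y by (intro mult_right_mono) auto
          finally show "norm (\<Phi> n y \<bullet> h) \<le> m n * (1 + r) * norm h" .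
        qed
      qed (use x r in auto)
      also have "\<dots> \<le> (m n * (1 + r)) * r" using x m0 r by (intro mult_left_mono) auto
      finally have \<phi>1: "\<bar>\<phi> n x\<bar> \<le> m n + (m n * (1 + r)) * r" using \<phi>0[of n] by simp
      have mr: "m n * r \<ge> 0" using m0 r by simp
      have mrr: "m n * (r * r) \<ge> 0" using m0 r by simp
      show "norm (\<phi> n x) \<le> m n * (1 + r)\<^sup>2"
        using \<phi>1 mr by (simp add: power2_eq_square algebra_simps)
      show "norm (\<Phi> n x) \<le> m n * (1 + r)\<^sup>2"
        using \<Phi>[OF x] mr mrr by (simp add: power2_eq_square algebra_simps)
      show "norm (H n x) \<le> m n * (1 + r)\<^sup>2"
        using H[of n x] mr mrr by (simp add: power2_eq_square algebra_simps)
    qed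
  qed
  define B where "B n = {x \<in> cball 0 R. gg n x \<noteq> \<phi> n x + gg (Suc n) x}" for n
  have Bm: "B n \<in> lmeasurable" for n
    unfolding B_def
  proof (rule bounded_set_imp_lmeasurable)
    show "bounded {x \<in> cball 0 R. gg n x \<noteq> \<phi> n x + gg (Suc n) x}"
      by (rule bounded_subset[OF bounded_cball[of 0 R]]) blast
    show "{x \<in> cball 0 R. gg n x \<noteq> \<phi> n x + gg (Suc n) x} \<in> sets lebesgue"
      by (rule neq_sets_lebesgue[OF gg(1) continuous_on_add[OF C2_jetD(5)[OF C2] gg(1)]]) simp
  qed
  have "g x = (\<Sum>n. \<phi> n x)" if x: "norm x \<le> R" "\<And>n. x \<notin> B n" for x
  proof -
    have step: "gg n x = \<phi> n x + gg (Suc n) x" for n using x(1) x(2)[of n] unfolding B_def by auto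
    have part: "(\<Sum>k<n. \<phi> k x) = g x - gg n x" for n
    proof (induction n)
      case 0 then show ?case using p(2) by (simp add: gg_def)
    next
      case (Suc n) then show ?case using step[of n] by simp
    qed
    have "(\<lambda>n. gg n x) \<longlonglongrightarrow> 0"
      by (rule Lim_null_comparison[OF _ summable_LIMSEQ_zero[OF sm]]) (use gg(2)[OF x(1)] in auto)
    then have "(\<lambda>n. g x - gg n x) \<longlonglongrightarrow> g x - 0" by (intro tendsto_intros)
    then have "(\<lambda>n. \<phi> n x) sums g x" by (simp add: sums_def part)
    then show ?thesis by (rule sums_unique)
  qed
  then have sub: "{x \<in> cball 0 R. g x \<noteq> (\<Sum>n. \<phi> n x)} \<subseteq> (\<Union>n. B n)" by auto
  have B: "(\<Union>n. B n) \<in> lmeasurable" "measure lebesgue (\<Union>n. B n) \<le> \<epsilon>"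
    using measure_UN_geometric[OF Bm me[folded B_def]] by auto
  have "measure lebesgue {x \<in> cball 0 R. g x \<noteq> (\<Sum>n. \<phi> n x)} \<le> measure lebesgue (\<Union>n. B n)"
    by (rule measure_mono_fmeasurable[OF sub _ B(1)]) (rule neq_sets_lebesgue[OF cg C2_on_UNIV_continuous[OF C2s]], simp)
  then show thesis using that[OF C2s] B(2) by linarith
qed

section \<open>Functions with lower quadratic bounds\<close>

text \<open>McShane's formula, the largest extension with the same constant.\<close>

lemma lipschitz_extend_real:
  fixes u :: "'a::euclidean_space \<Rightarrow> real"
  assumes u: "\<And>x y. x \<in> S \<Longrightarrow> y \<in> S \<Longrightarrow> \<bar>u x - u y\<bar> \<le> L * norm (x - y)" and L: "L \<ge> 0"
  obtains U where "L-lipschitz_on UNIV U" "\<And>x. x \<in> S \<Longrightarrow> U x = u x"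
proof (cases "S = {}")
  case True
  have "L-lipschitz_on UNIV (\<lambda>_::'a. 0::real)" using L by (auto simp: lipschitz_on_def)
  then show thesis using that True by blast
next
  case False
  define U where "U x = (INF s\<in>S. u s + L * norm (x - s))" for x
  obtain s0 where s0: "s0 \<in> S" using False by blast
  have bb: "bdd_below ((\<lambda>s. u s + L * norm (x - s)) ` S)" for x
  proof (rule bdd_belowI2)
    fix s assume s: "s \<in> S"
    have "u s0 - u s \<le> L * norm (s0 - s)" using u[OF s0 s] by linarith
    also have "\<dots> \<le> L * (norm (x - s0) + norm (x - s))"
      using norm_triangle_ineq4[of "x - s" "x - s0"] L by (intro mult_left_mono) auto
    finally show "u s0 - L * norm (x - s0) \<le> u s + L * norm (x - s)" by (simp add: algebra_simps)
  qed
  have le: "U x \<le> U y + L * norm (x - y)" for x y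
  proof -
    have "U x - L * norm (x - y) \<le> U y"
      unfolding U_def[of y]
    proof (rule cINF_greatest[OF False])
      fix s assume s: "s \<in> S"
      have "U x \<le> u s + L * norm (x - s)" unfolding U_def by (rule cINF_lower[OF bb s])
      also have "\<dots> \<le> u s + L * (norm (x - y) + norm (y - s))"
        using norm_triangle_ineq[of "x - y" "y - s"] L by (intro add_left_mono mult_left_mono) auto
      finally show "U x - L * norm (x - y) \<le> u s + L * norm (y - s)" by (simp add: algebra_simps)
    qed
    then show ?thesis by simp
  qed
  show thesis
  proof (rule that[of U])
    show "L-lipschitz_on UNIV U"
    proof (rule lipschitz_onI[OF _ L])
      fix x y show "dist (U x) (U y) \<le> L * dist x y"
        using le[of x y] le[of y x] by (simp add: dist_norm norm_minus_commute abs_le_iff)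
    qed
    fix x assume x: "x \<in> S"
    have "u x \<le> U x" unfolding U_def
      using u[OF x] False by (intro cINF_greatest) (auto simp: abs_le_iff algebra_simps)
    moreover have "U x \<le> u x" unfolding U_def using cINF_lower[OF bb x, of x] by simp
    ultimately show "U x = u x" by simp
  qed
qed

lemma lipschitz_extend:
  fixes J :: "'a::euclidean_space \<Rightarrow> 'b::euclidean_space"
  assumes J: "\<And>x y. x \<in> S \<Longrightarrow> y \<in> S \<Longrightarrow> norm (J x - J y) \<le> L * norm (x - y)" and L: "L \<ge> 0"
  obtains J' where "(real DIM('b) * L)-lipschitz_on UNIV J'" "\<And>x. x \<in> S \<Longrightarrow> J' x = J x"
proof -
  have "\<exists>U. L-lipschitz_on UNIV U \<and> (\<forall>x\<in>S. U x = J x \<bullet> i)" if i: "i \<in> Basis" for i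
  proof -
    have "\<bar>J x \<bullet> i - J y \<bullet> i\<bar> \<le> L * norm (x - y)" if "x \<in> S" "y \<in> S" for x y
      using J[OF that] Basis_le_norm[OF i, of "J x - J y"] by (simp add: inner_simps)
    from lipschitz_extend_real[OF this L] show ?thesis by metis
  qed
  then obtain U where U: "\<And>i. i \<in> Basis \<Longrightarrow> L-lipschitz_on UNIV (U i)"
    "\<And>i x. i \<in> Basis \<Longrightarrow> x \<in> S \<Longrightarrow> U i x = J x \<bullet> i" by metis
  define J' where "J' x = (\<Sum>i\<in>Basis. U i x *\<^sub>R i)" for x
  show thesis
  proof (rule that[of J'])
    show "(real DIM('b) * L)-lipschitz_on UNIV J'"
    proof (rule lipschitz_onI)
      fix x y
      have "norm (J' x - J' y) = norm (\<Sum>i\<in>Basis. (U i x - U i y) *\<^sub>R i)"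
        by (simp add: J'_def sum_subtractf scaleR_diff_left)
      also have "\<dots> \<le> (\<Sum>i\<in>(Basis::'b set). L * norm (x - y))"
      proof (rule sum_norm_le)
        fix i :: 'b assume i: "i \<in> Basis"
        show "norm ((U i x - U i y) *\<^sub>R i) \<le> L * norm (x - y)"
          using lipschitz_onD[OF U(1)[OF i], of x y] i by (simp add: dist_norm)
      qed
      finally show "dist (J' x) (J' y) \<le> real DIM('b) * L * dist x y" by (simp add: dist_norm)
    qed (use L in simp)
    show "J' x = J x" if "x \<in> S" for x
      using U(2)[OF _ that] by (simp add: J'_def euclidean_representation)
  qed
qed

text \<open>The upper bound comes from inverting \<open>z x = \<xi> x + (2 j + 1) x\<close>. The lower
  bound makes \<open>z\<close> strongly monotone, so \<open>z\<close> has a Lipschitz inverse \<open>J\<close>, which outside a null set of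
  values has an injective derivative; there \<open>z\<close>, and hence \<open>\<xi>\<close>, is itself pointwise Lipschitz.\<close>

lemma lower_jet_decomposition:
  fixes f :: "'a::euclidean_space \<Rightarrow> real"
  assumes low: "\<And>x y. x \<in> E \<Longrightarrow> y \<in> E \<Longrightarrow> f y \<ge> f x + \<xi> x \<bullet> (y - x) - j * (norm (y - x))\<^sup>2"
    and j: "j \<ge> 0"
  obtains \<G> where "countable \<G>" "\<And>g. g \<in> \<G> \<Longrightarrow> \<exists>G M. jet_bound UNIV g G M"
    "negligible {x \<in> E. \<forall>g\<in>\<G>. f x \<noteq> g x}"
proof -
  \<comment> \<open>Adding the lower bounds based at x and at y gives (\<xi> y - \<xi> x) . (y - x)
    >= -2 j |y - x|^2, so this shift makes \<open>z\<close> strongly monotone with constant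
    1.\<close>
  define z where "z x = \<xi> x + (2 * j + 1) *\<^sub>R x" for x
  have mono: "(norm (y - x))\<^sup>2 \<le> (z y - z x) \<bullet> (y - x)" if "x \<in> E" "y \<in> E" for x y
  proof -
    have "0 \<le> (\<xi> y - \<xi> x) \<bullet> (y - x) + 2 * j * (norm (y - x))\<^sup>2"
      using low[OF that] low[OF that(2,1)] by (simp add: inner_simps norm_minus_commute algebra_simps)
    moreover have "(z y - z x) \<bullet> (y - x) = (\<xi> y - \<xi> x) \<bullet> (y - x) + (2 * j + 1) * (norm (y - x))\<^sup>2"
      by (simp add: z_def power2_norm_eq_inner inner_simps algebra_simps)
    ultimately show ?thesis by (simp add: algebra_simps)
  qed
  have exp: "norm (y - x) \<le> norm (z y - z x)" if "x \<in> E" "y \<in> E" for x y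
  proof (cases "y = x")
    case False
    have "norm (y - x) * norm (y - x) \<le> norm (z y - z x) * norm (y - x)"
      using mono[OF that] norm_cauchy_schwarz[of "z y - z x" "y - x"] by (simp add: power2_eq_square)
    then show ?thesis using False by simp
  qed simp
  have inj: "inj_on z E" using exp by (intro inj_onI) force
  have ext: "norm (inv_into E z v - inv_into E z w) \<le> 1 * norm (v - w)" if "v \<in> z ` E" "w \<in> z ` E" for v w
    using that exp inj by auto
  have "\<exists>J. (real DIM('a) * 1)-lipschitz_on UNIV J \<and> (\<forall>v\<in>z ` E. J v = inv_into E z v)"
    by (rule lipschitz_extend[OF ext zero_le_one]) (assumption | blast)+
  then obtain J :: "'a \<Rightarrow> 'a" where Jl: "(real DIM('a) * 1)-lipschitz_on UNIV J"
    and J: "\<And>v. v \<in> z ` E \<Longrightarrow> J v = inv_into E z v" by blast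
  have Jz: "J (z x) = x" if "x \<in> E" for x using J that inj by simp
  define B where "B = {w. \<not> J differentiable (at w)}"
  define S where "S = {w. \<exists>D. (J has_derivative D) (at w) \<and> \<not> inj D}"
  \<comment> \<open>The points to discard are the x in \<open>E\<close> with \<open>z x\<close> in
    \<open>B\<close> or \<open>S\<close>. As x = J (z x), they lie in the images, and it is the
    images that must be null: for \<open>B\<close> since \<open>J\<close> is Lipschitz, for
    \<open>S\<close> by Sard.\<close>
  have "negligible (J ` B)"
  proof (rule negligible_locally_Lipschitz_image)
    show "negligible B" unfolding B_def by (rule rademacher[OF Jl])
    show "\<exists>T C. open T \<and> x \<in> T \<and> (\<forall>y\<in>B \<inter> T. norm (J y - J x) \<le> C * norm (y - x))" for x
      using lipschitz_onD[OF Jl] by (intro exI[of _ "UNIV::'a set"] exI[of _ "real DIM('a)"]) (auto simp: dist_norm)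
  qed simp
  moreover have "negligible (J ` S)"
    by (rule negligible_image_singular_derivative[OF Jl]) (auto simp: S_def)
  ultimately have neg: "negligible (J ` B \<union> J ` S)" by (rule negligible_Un)
  obtain D :: "'a set" where D: "countable D" "\<And>X. open X \<Longrightarrow> X \<noteq> {} \<Longrightarrow> \<exists>d\<in>D. d \<in> X"
    by (rule countable_dense_setE) blast
  define i where "i m = inverse (real (Suc m))" for m
  have i0: "i m > 0" for m by (simp add: i_def)
  \<comment> \<open>The inequality is the Lipschitz estimate for the inverse of \<open>J\<close> at
    \<open>z x\<close>, with constant and radius made uniform. Confining \<open>z x\<close> to a
    small ball about \<open>d\<close> brings any two points of \<open>F m d\<close> within that
    radius.\<close>
  define F where "F m d = {x \<in> E. dist d (z x) < i m / 2 \<and>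
      (\<forall>w. norm (w - z x) < i m \<longrightarrow> norm (w - z x) \<le> real (Suc m) * norm (J w - x))}" for m d
  have cov: "\<exists>m. \<exists>d\<in>D. x \<in> F m d" if x: "x \<in> E" "x \<notin> J ` B \<union> J ` S" for x
  proof -
    have zB: "z x \<notin> B" "z x \<notin> S" using x Jz by (metis UnCI imageI)+
    then obtain A where A: "(J has_derivative A) (at (z x))" by (auto simp: B_def differentiable_def)
    then have "linear A" "inj A" using zB has_derivative_linear by (auto simp: S_def)
    then obtain b where b: "b > 0" "\<And>v. b * norm v \<le> norm (A v)" by (rule linear_inj_bounded_below_pos) blast
    obtain r where r: "r > 0" "\<And>w. norm (w - z x) < r \<Longrightarrow> norm (J w - J (z x) - A (w - z x)) \<le> b / 2 * norm (w - z x)"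
      using A b(1) unfolding has_derivative_at_alt by (meson half_gt_zero)
    obtain m where m: "i m < min r (b / 2)"
      using reals_Archimedean[of "min r (b / 2)"] r(1) b(1) unfolding i_def by auto
    have "norm (w - z x) \<le> real (Suc m) * norm (J w - x)" if w: "norm (w - z x) < i m" for w
    proof -
      have "norm (A (w - z x)) \<le> norm (J w - x) + norm (J w - J (z x) - A (w - z x))"
        using norm_triangle_ineq4[of "J w - x" "J w - J (z x) - A (w - z x)"] Jz[OF x(1)] by simp
      then have "b * norm (w - z x) \<le> norm (J w - x) + b / 2 * norm (w - z x)"
        using b(2)[of "w - z x"] r(2)[of w] w m by simp
      then have "b / 2 * norm (w - z x) \<le> norm (J w - x)" by simp
      moreover have "i m * norm (w - z x) \<le> b / 2 * norm (w - z x)" using m by (intro mult_right_mono) auto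
      ultimately have "i m * norm (w - z x) \<le> norm (J w - x)" by linarith
      then show ?thesis by (simp add: i_def field_simps)
    qed
    moreover obtain d where "d \<in> D" "d \<in> ball (z x) (i m / 2)"
      using D(2)[of "ball (z x) (i m / 2)"] i0[of m] by auto
    ultimately show ?thesis using x(1) by (auto simp: F_def dist_commute)
  qed
  have "\<exists>g G M. jet_bound UNIV g G M \<and> (\<forall>x\<in>F m d. g x = f x)" for m d
  proof -
    define M where "M = real (Suc m) + 3 * j + 1"
    have jet: "jet_bound (F m d) f \<xi> M"
      unfolding jet_bound_def
    proof (intro ballI conjI)
      fix x y assume xF: "x \<in> F m d" and yF: "y \<in> F m d"
      then have xy: "x \<in> E" "y \<in> E" by (auto simp: F_def)
      have "norm (z y - z x) < i m"
        using xF yF dist_triangle_half_r[of d "z y" "i m" "z x"] by (auto simp: F_def dist_norm)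
      then have zl: "norm (z y - z x) \<le> real (Suc m) * norm (y - x)"
        using xF Jz[OF xy(2)] by (auto simp: F_def)
      have "\<xi> y - \<xi> x = (z y - z x) - (2 * j + 1) *\<^sub>R (y - x)" by (simp add: z_def algebra_simps)
      then have "norm (\<xi> y - \<xi> x) \<le> norm (z y - z x) + norm ((2 * j + 1) *\<^sub>R (y - x))" by (metis norm_triangle_ineq4)
      also have "norm ((2 * j + 1) *\<^sub>R (y - x)) = (2 * j + 1) * norm (y - x)" using j by simp
      finally have \<xi>l: "norm (\<xi> y - \<xi> x) \<le> (real (Suc m) + 2 * j + 1) * norm (y - x)"
        using zl by (simp add: algebra_simps)
      also have "\<dots> \<le> M * norm (y - x)" using j by (intro mult_right_mono) (auto simp: M_def)
      finally show "norm (\<xi> y - \<xi> x) \<le> M * norm (y - x)" .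
      have "(\<xi> y - \<xi> x) \<bullet> (y - x) \<le> norm (\<xi> y - \<xi> x) * norm (y - x)" by (rule norm_cauchy_schwarz)
      also have "\<dots> \<le> (real (Suc m) + 2 * j + 1) * (norm (y - x))\<^sup>2"
        using mult_right_mono[OF \<xi>l norm_ge_zero[of "y - x"]] by (simp add: power2_eq_square mult.assoc)
      finally have 1: "(\<xi> y - \<xi> x) \<bullet> (y - x) \<le> (real (Suc m) + 2 * j + 1) * (norm (y - x))\<^sup>2" .
      \<comment> \<open>The lower bound based at y, evaluated at x, is an upper bound based at x up
        to the change of \<xi>, which is already estimated.\<close>
      have 2: "f y - f x - \<xi> x \<bullet> (y - x) \<le> (\<xi> y - \<xi> x) \<bullet> (y - x) + j * (norm (y - x))\<^sup>2"
        using low[OF xy(2,1)] by (simp add: inner_simps norm_minus_commute algebra_simps)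
      have 3: "f y - f x - \<xi> x \<bullet> (y - x) \<le> M * (norm (y - x))\<^sup>2"
        using 1 2 by (simp add: M_def algebra_simps)
      have "j * (norm (y - x))\<^sup>2 \<le> M * (norm (y - x))\<^sup>2" using j by (intro mult_right_mono) (auto simp: M_def)
      then have "- (M * (norm (y - x))\<^sup>2) \<le> f y - f x - \<xi> x \<bullet> (y - x)" using low[OF xy] by linarith
      then show "\<bar>f y - f x - \<xi> x \<bullet> (y - x)\<bar> \<le> M * (norm (y - x))\<^sup>2" using 3 by linarith
    qed
    have "M \<ge> 0" using j by (simp add: M_def)
    show ?thesis by (rule jet_extension[OF jet \<open>M \<ge> 0\<close>]) blast
  qed
  then obtain g where g: "\<And>m d. \<exists>G M. jet_bound UNIV (g m d) G M" "\<And>m d x. x \<in> F m d \<Longrightarrow> g m d x = f x"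
    by metis
  let ?\<G> = "\<Union>m. g m ` D"
  show thesis
  proof (rule that[of ?\<G>])
    show "countable ?\<G>" using D(1) by (intro countable_UN countable_image) auto
    show "\<exists>G M. jet_bound UNIV h G M" if h: "h \<in> ?\<G>" for h
    proof -
      obtain m d where "h = g m d" using h by blast
      then show ?thesis using g(1)[of m d] by simp
    qed
    have "{x \<in> E. \<forall>h\<in>?\<G>. f x \<noteq> h x} \<subseteq> J ` B \<union> J ` S"
    proof (rule subsetI, rule ccontr)
      fix x assume x: "x \<in> {x \<in> E. \<forall>h\<in>?\<G>. f x \<noteq> h x}" and xJ: "x \<notin> J ` B \<union> J ` S"
      have xE: "x \<in> E" using x by simp
      obtain m d where md: "d \<in> D" "x \<in> F m d" using cov[OF xE xJ] by blast
      then have "g m d \<in> ?\<G>" by blast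
      then have "f x \<noteq> g m d x" using x by blast
      then show False using g(2)[OF md(2)] by simp
    qed
    then show "negligible {x \<in> E. \<forall>h\<in>?\<G>. f x \<noteq> h x}"
      by (rule negligible_subset[OF neg])
  qed
qed

text \<open>One integer \<open>j\<close> bounds both the opening and the inverse radius of a lower
  paraboloid; cutting further into balls of diameter 1/(j+1) makes the lower bound hold between any
  two points of a piece, as \<open>lower_jet_decomposition\<close> demands. No measurability of the
  pieces is claimed: only the countable family of functions and the null set are passed on.\<close>

lemma C11_decomposition:
  fixes f :: "'a::euclidean_space \<Rightarrow> real"
  assumes good: "negligible {x \<in> \<Omega>. \<not> (\<exists>\<xi> K r. r > 0 \<and> (\<forall>y\<in>\<Omega>. norm (y - x) < r \<longrightarrow>
      f y \<ge> f x + \<xi> \<bullet> (y - x) - K * (norm (y - x))\<^sup>2))}"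
  obtains \<G> where "countable \<G>" "\<And>g. g \<in> \<G> \<Longrightarrow> \<exists>G M. jet_bound UNIV g G M"
    "negligible {x \<in> \<Omega>. \<forall>g\<in>\<G>. f x \<noteq> g x}"
proof -
  define bad where "bad = {x \<in> \<Omega>. \<not> (\<exists>\<xi> K r. r > 0 \<and> (\<forall>y\<in>\<Omega>. norm (y - x) < r \<longrightarrow>
      f y \<ge> f x + \<xi> \<bullet> (y - x) - K * (norm (y - x))\<^sup>2))}"
  obtain D :: "'a set" where D: "countable D" "\<And>X. open X \<Longrightarrow> X \<noteq> {} \<Longrightarrow> \<exists>d\<in>D. d \<in> X"
    by (rule countable_dense_setE) blast
  define i where "i j = inverse (real (Suc j))" for j
  have i0: "i m > 0" for m by (simp add: i_def)
  define A where "A j = {x \<in> \<Omega>. \<exists>\<xi>. \<forall>y\<in>\<Omega>. norm (y - x) < i j \<longrightarrow> f y \<ge> f x + \<xi> \<bullet> (y - x) - real j * (norm (y - x))\<^sup>2}" for j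
  define E where "E j d = A j \<inter> ball d (i j / 2)" for j d
  have cov: "\<exists>j. \<exists>d\<in>D. x \<in> E j d" if x: "x \<in> \<Omega>" "x \<notin> bad" for x
  proof -
    obtain \<xi> K r where r: "r > 0" "\<And>y. y \<in> \<Omega> \<Longrightarrow> norm (y - x) < r \<Longrightarrow> f y \<ge> f x + \<xi> \<bullet> (y - x) - K * (norm (y - x))\<^sup>2"
      using x unfolding bad_def by blast
    obtain j1 where j1: "i j1 < r" using reals_Archimedean[OF r(1)] unfolding i_def by blast
    obtain j2 :: nat where j2: "K \<le> real j2" using real_arch_simple by blast
    define j where "j = max j1 j2"
    have "i j \<le> i j1" by (simp add: i_def j_def)
    then have ij: "i j < r" using j1 by linarith
    have "f y \<ge> f x + \<xi> \<bullet> (y - x) - real j * (norm (y - x))\<^sup>2" if y: "y \<in> \<Omega>" "norm (y - x) < i j" for y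
    proof -
      have "K * (norm (y - x))\<^sup>2 \<le> real j * (norm (y - x))\<^sup>2" using j2 by (intro mult_right_mono) (auto simp: j_def)
      then show ?thesis using r(2)[OF y(1)] y(2) ij by linarith
    qed
    then have "x \<in> A j" using x(1) unfolding A_def by blast
    moreover obtain d where "d \<in> D" "d \<in> ball x (i j / 2)" using D(2)[of "ball x (i j / 2)"] i0[of j] by auto
    ultimately show ?thesis by (auto simp: E_def dist_commute)
  qed
  have "\<exists>\<G>. countable \<G> \<and> (\<forall>g\<in>\<G>. \<exists>G M. jet_bound UNIV g G M) \<and> negligible {x \<in> E j d. \<forall>g\<in>\<G>. f x \<noteq> g x}" for j d
  proof -
    have "\<exists>\<xi>. \<forall>x\<in>E j d. \<forall>y\<in>\<Omega>. norm (y - x) < i j \<longrightarrow> f y \<ge> f x + \<xi> x \<bullet> (y - x) - real j * (norm (y - x))\<^sup>2"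
      by (rule bchoice) (auto simp: E_def A_def)
    then obtain \<xi> where \<xi>: "\<And>x y. x \<in> E j d \<Longrightarrow> y \<in> \<Omega> \<Longrightarrow> norm (y - x) < i j \<Longrightarrow>
        f y \<ge> f x + \<xi> x \<bullet> (y - x) - real j * (norm (y - x))\<^sup>2" by blast
    have "f y \<ge> f x + \<xi> x \<bullet> (y - x) - real j * (norm (y - x))\<^sup>2" if xy: "x \<in> E j d" "y \<in> E j d" for x y
    proof (rule \<xi>[OF xy(1)])
      show "y \<in> \<Omega>" using xy(2) by (simp add: E_def A_def)
      show "norm (y - x) < i j"
        using xy dist_triangle_half_r[of d y "i j" x] by (auto simp: E_def dist_norm)
    qed
    then have low: "\<And>x y. x \<in> E j d \<Longrightarrow> y \<in> E j d \<Longrightarrow> f y \<ge> f x + \<xi> x \<bullet> (y - x) - real j * (norm (y - x))\<^sup>2" .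
    show ?thesis
    proof (rule lower_jet_decomposition[OF low of_nat_0_le_iff])
      fix \<G> assume "countable \<G>" "\<And>g. g \<in> \<G> \<Longrightarrow> \<exists>G M. jet_bound UNIV g G M"
        "negligible {x \<in> E j d. \<forall>g\<in>\<G>. f x \<noteq> g x}"
      then show ?thesis by blast
    qed
  qed
  note ex = this
  define \<G> where "\<G> j d = (SOME \<G>. countable \<G> \<and> (\<forall>g\<in>\<G>. \<exists>G M. jet_bound UNIV g G M) \<and>
      negligible {x \<in> E j d. \<forall>g\<in>\<G>. f x \<noteq> g x})" for j d
  have \<G>: "countable (\<G> j d)" "\<forall>g\<in>\<G> j d. \<exists>G M. jet_bound UNIV g G M"
    "negligible {x \<in> E j d. \<forall>g\<in>\<G> j d. f x \<noteq> g x}" for j d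
    using someI_ex[OF ex[of j d]] unfolding \<G>_def by blast+
  let ?\<H> = "\<Union>j. \<Union>d\<in>D. \<G> j d"
  show thesis
  proof (rule that[of ?\<H>])
    show "countable ?\<H>" using D(1) \<G>(1) by (intro countable_UN) auto
    show "\<exists>G M. jet_bound UNIV g G M" if gH: "g \<in> ?\<H>" for g
    proof -
      obtain j d where gG: "g \<in> \<G> j d" using gH by (elim UN_E)
      show ?thesis by (rule bspec[OF \<G>(2) gG])
    qed
    have "{x \<in> \<Omega>. \<forall>g\<in>?\<H>. f x \<noteq> g x} \<subseteq> bad \<union> (\<Union>j. \<Union>d\<in>D. {x \<in> E j d. \<forall>g\<in>\<G> j d. f x \<noteq> g x})"
    proof
      fix x assume x: "x \<in> {x \<in> \<Omega>. \<forall>g\<in>?\<H>. f x \<noteq> g x}"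
      show "x \<in> bad \<union> (\<Union>j. \<Union>d\<in>D. {x \<in> E j d. \<forall>g\<in>\<G> j d. f x \<noteq> g x})"
      proof (cases "x \<in> bad")
        case False
        have xO: "x \<in> \<Omega>" using x by simp
        obtain j d where jd: "d \<in> D" "x \<in> E j d" using cov[OF xO False] by (elim exE bexE)
        have "\<forall>g\<in>\<G> j d. f x \<noteq> g x" using x jd(1) by blast
        then show ?thesis using jd by blast
      qed simp
    qed
    moreover have "negligible (\<Union>j. \<Union>d\<in>D. {x \<in> E j d. \<forall>g\<in>\<G> j d. f x \<noteq> g x})"
    proof -
      have "negligible (\<Union>d\<in>D. {x \<in> E j d. \<forall>g\<in>\<G> j d. f x \<noteq> g x})" for j
        using D(1) \<G>(3) by (intro negligible_countable_Union) auto
      then show ?thesis by (intro negligible_countable_Union) auto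
    qed
    ultimately show "negligible {x \<in> \<Omega>. \<forall>g\<in>?\<H>. f x \<noteq> g x}"
      by (rule negligible_subset[OF negligible_Un[OF good[folded bad_def]], rotated])
  qed
qed

section \<open>Pasting\<close>

text \<open>Points closer than the distance d of the two compact sets lie in the same one, where a
  jet bound is given. For all other pairs, boundedness of values and gradients by \<open>B\<close>
  suffices, at the price of the terms 2B/d^2 and 2B/d in the constant.\<close>

lemma C11_glue:
  fixes g1 g2 :: "'a::euclidean_space \<Rightarrow> real"
  assumes j1: "jet_bound UNIV g1 G1 M1" and j2: "jet_bound UNIV g2 G2 M2"
    and K: "compact K1" "compact K2" "K1 \<inter> K2 = {}"
  obtains g G M where "jet_bound UNIV g G M" "\<And>x. x \<in> K1 \<Longrightarrow> g x = g1 x" "\<And>x. x \<in> K2 \<Longrightarrow> g x = g2 x"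
proof -
  obtain d where d: "d > 0" "\<And>x y. x \<in> K1 \<Longrightarrow> y \<in> K2 \<Longrightarrow> d \<le> dist x y"
    using separate_compact_closed[OF K(1) compact_imp_closed[OF K(2)] K(3)] by blast
  define f where "f x = (if x \<in> K1 then g1 x else g2 x)" for x
  define \<xi> where "\<xi> x = (if x \<in> K1 then G1 x else G2 x)" for x
  have bnd: "\<exists>B. \<forall>x\<in>C. norm (h x) \<le> B" if "continuous_on C h" "compact C" for h :: "'a \<Rightarrow> 'b::real_normed_vector" and C
    using compact_imp_bounded[OF compact_continuous_image[OF that]] unfolding bounded_iff by blast
  have c: "continuous_on C g1" "continuous_on C g2" "continuous_on C G1" "continuous_on C G2" for C
    using jet_bound_continuous[OF j1] jet_bound_continuous[OF j2]
      lipschitz_on_continuous_on[OF jet_bound_lipschitz[OF j1]] lipschitz_on_continuous_on[OF jet_bound_lipschitz[OF j2]] by auto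
  have "\<exists>B. \<forall>x\<in>K1 \<union> K2. norm (f x) \<le> B \<and> norm (\<xi> x) \<le> B"
  proof -
    obtain a1 a2 b1 b2 where "\<forall>x\<in>K1 \<union> K2. norm (g1 x) \<le> a1" "\<forall>x\<in>K1 \<union> K2. norm (g2 x) \<le> a2"
      "\<forall>x\<in>K1 \<union> K2. norm (G1 x) \<le> b1" "\<forall>x\<in>K1 \<union> K2. norm (G2 x) \<le> b2"
      using bnd[OF c(1)] bnd[OF c(2)] bnd[OF c(3)] bnd[OF c(4)] compact_Un[OF K(1,2)] by metis
    then show ?thesis
      by (intro exI[of _ "max (max a1 a2) (max b1 b2)"]) (auto simp: f_def \<xi>_def le_max_iff_disj)
  qed
  then obtain B where B: "\<And>x. x \<in> K1 \<union> K2 \<Longrightarrow> norm (f x) \<le> B \<and> norm (\<xi> x) \<le> B" by blast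
  define M where "M = max M1 M2 + 2 * \<bar>B\<bar> / d\<^sup>2 + 2 * \<bar>B\<bar> / d"
  have M12: "M1 \<ge> 0" "M2 \<ge> 0" using jet_bound_nonneg j1 j2 by auto
  have ge: "2 * \<bar>B\<bar> / d\<^sup>2 \<ge> 0" "2 * \<bar>B\<bar> / d \<ge> 0" using d by auto
  have M: "M1 \<le> M" "M2 \<le> M" "M \<ge> 0" "2 * \<bar>B\<bar> / d \<le> M" "2 * \<bar>B\<bar> / d\<^sup>2 + 2 * \<bar>B\<bar> / d \<le> M"
    using ge M12 max.cobounded1[of M1 M2] max.cobounded2[of M2 M1] unfolding M_def by linarith+
  have far: "\<bar>f y - f x - \<xi> x \<bullet> (y - x)\<bar> \<le> M * (norm (y - x))\<^sup>2 \<and> norm (\<xi> y - \<xi> x) \<le> M * norm (y - x)"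
    if x: "x \<in> K1 \<union> K2" and y: "y \<in> K1 \<union> K2" and xy: "d \<le> norm (y - x)" for x y
  proof
    let ?n = "norm (y - x)"
    have n: "?n > 0" using xy d by linarith
    have dn: "1 \<le> ?n / d" using xy d by simp
    have q: "?n / d \<le> (?n / d)\<^sup>2" using mult_left_mono[OF dn, of "?n / d"] dn by (simp add: power2_eq_square)
    have "norm (\<xi> y - \<xi> x) \<le> 2 * \<bar>B\<bar> * 1" using B[OF x] B[OF y] norm_triangle_ineq4[of "\<xi> y" "\<xi> x"] by linarith
    also have "\<dots> \<le> 2 * \<bar>B\<bar> * (?n / d)" using dn by (intro mult_left_mono) auto
    also have "\<dots> = 2 * \<bar>B\<bar> / d * ?n" by simp
    also have "\<dots> \<le> M * ?n" using M by (intro mult_right_mono) auto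
    finally show "norm (\<xi> y - \<xi> x) \<le> M * ?n" .
    have "\<bar>\<xi> x \<bullet> (y - x)\<bar> \<le> norm (\<xi> x) * ?n" by (rule Cauchy_Schwarz_ineq2)
    also have "\<dots> \<le> \<bar>B\<bar> * ?n" using B[OF x] by (intro mult_right_mono) auto
    also have "\<dots> = \<bar>B\<bar> * d * (?n / d)" using d by simp
    also have "\<dots> \<le> \<bar>B\<bar> * d * (?n / d)\<^sup>2" using q d by (intro mult_left_mono) auto
    also have "\<dots> = \<bar>B\<bar> / d * ?n\<^sup>2" using d by (simp add: power2_eq_square field_simps)
    finally have 1: "\<bar>\<xi> x \<bullet> (y - x)\<bar> \<le> \<bar>B\<bar> / d * ?n\<^sup>2" .
    have "\<bar>f y - f x\<bar> \<le> 2 * \<bar>B\<bar> * 1" using B[OF x] B[OF y] unfolding real_norm_def by linarith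
    also have "\<dots> \<le> 2 * \<bar>B\<bar> * (?n / d)\<^sup>2" using dn q by (intro mult_left_mono) linarith+
    also have "\<dots> = 2 * \<bar>B\<bar> / d\<^sup>2 * ?n\<^sup>2" by (simp add: power_divide)
    finally have "\<bar>f y - f x\<bar> \<le> 2 * \<bar>B\<bar> / d\<^sup>2 * ?n\<^sup>2" .
    then have "\<bar>f y - f x - \<xi> x \<bullet> (y - x)\<bar> \<le> 2 * \<bar>B\<bar> / d\<^sup>2 * ?n\<^sup>2 + \<bar>B\<bar> / d * ?n\<^sup>2" using 1 by linarith
    also have "\<dots> \<le> (2 * \<bar>B\<bar> / d\<^sup>2 + 2 * \<bar>B\<bar> / d) * ?n\<^sup>2"
    proof -
      have "0 \<le> \<bar>B\<bar> / d * ?n\<^sup>2" using d by simp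
      then show ?thesis by (simp add: distrib_right)
    qed
    also have "\<dots> \<le> M * ?n\<^sup>2" using M by (intro mult_right_mono) auto
    finally show "\<bar>f y - f x - \<xi> x \<bullet> (y - x)\<bar> \<le> M * ?n\<^sup>2" .
  qed
  have "jet_bound (K1 \<union> K2) f \<xi> M"
    unfolding jet_bound_def
  proof (intro ballI)
    fix x y assume x: "x \<in> K1 \<union> K2" and y: "y \<in> K1 \<union> K2"
    consider "x \<in> K1" "y \<in> K1" | "x \<in> K2" "y \<in> K2" | "x \<in> K1" "y \<in> K2" | "x \<in> K2" "y \<in> K1" using x y by blast
    then show "\<bar>f y - f x - \<xi> x \<bullet> (y - x)\<bar> \<le> M * (norm (y - x))\<^sup>2 \<and> norm (\<xi> y - \<xi> x) \<le> M * norm (y - x)"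
    proof cases
      case 1
      then show ?thesis using jet_boundD[OF jet_bound_mono[OF j1 M(1)], of x y] by (simp add: f_def \<xi>_def)
    next
      case 2
      then have "x \<notin> K1" "y \<notin> K1" using K(3) by auto
      then show ?thesis using jet_boundD[OF jet_bound_mono[OF j2 M(2)], of x y] by (simp add: f_def \<xi>_def)
    next
      case 3
      then show ?thesis using far[OF x y] d(2)[of x y] by (simp add: dist_norm norm_minus_commute)
    next
      case 4
      then show ?thesis using far[OF x y] d(2)[of y x] by (simp add: dist_norm)
    qed
  qed
  then obtain g G where "jet_bound UNIV g G (72 * M)" "\<And>x. x \<in> K1 \<union> K2 \<Longrightarrow> g x = f x"
    using jet_extension M(3) by metis
  moreover have "f x = g1 x" if "x \<in> K1" for x using that by (simp add: f_def)
  moreover have "f x = g2 x" if "x \<in> K2" for x using that K(3) by (auto simp: f_def)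
  ultimately show thesis using that[of g G "72 * M"] by simp
qed

lemma lmeasurable_inner_compact:
  fixes S :: "'a::euclidean_space set"
  assumes S: "S \<in> sets lebesgue" "bounded S" and e: "e > 0"
  obtains K where "compact K" "K \<subseteq> S" "measure lebesgue (S - K) < e"
proof -
  obtain T where T: "closed T" "T \<subseteq> S" "S - T \<in> lmeasurable" "emeasure lebesgue (S - T) < ennreal e"
    using sets_lebesgue_inner_closed[OF S(1) e] by blast
  have "compact T" using T S(2) by (meson bounded_subset compact_eq_bounded_closed)
  moreover have "measure lebesgue (S - T) < e"
    using T(3,4) e by (simp add: emeasure_eq_measure2 ennreal_less_iff)
  ultimately show thesis using that T(2) by blast
qed

text \<open>Disjoint pieces may touch, so each is first shrunk to a compact set, which restores the
  positive distance that gluing requires. Half of the tolerance goes to the new piece, half to the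
  earlier ones.\<close>

lemma C11_agrees_on_finite_UN:
  fixes f :: "'a::euclidean_space \<Rightarrow> real" and N :: nat
  assumes S: "\<And>i. i < N \<Longrightarrow> S i \<in> sets lebesgue" "\<And>i. i < N \<Longrightarrow> bounded (S i)"
    and disj: "\<And>i j. i < N \<Longrightarrow> j < N \<Longrightarrow> i \<noteq> j \<Longrightarrow> S i \<inter> S j = {}"
    and g: "\<And>i. i < N \<Longrightarrow> \<exists>G M. jet_bound UNIV (g i) G M" "\<And>i x. i < N \<Longrightarrow> x \<in> S i \<Longrightarrow> f x = g i x"
    and e: "e > (0::real)"
  shows "\<exists>K h G M. compact K \<and> K \<subseteq> (\<Union>i<N. S i) \<and> measure lebesgue ((\<Union>i<N. S i) - K) \<le> e \<and>
           jet_bound UNIV h G M \<and> (\<forall>x\<in>K. f x = h x)"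
  using S disj g e
proof (induction N arbitrary: e)
  case 0
  have "jet_bound (UNIV::'a set) (\<lambda>_. 0) (\<lambda>_. 0) 0" by (simp add: jet_bound_def)
  then show ?case using 0(6) by (intro exI[of _ "{}"]) auto
next
  case (Suc N)
  have "\<exists>K h G M. compact K \<and> K \<subseteq> (\<Union>i<N. S i) \<and> measure lebesgue ((\<Union>i<N. S i) - K) \<le> e / 2 \<and>
           jet_bound UNIV h G M \<and> (\<forall>x\<in>K. f x = h x)"
    by (rule Suc.IH) (use Suc.prems in auto)
  then obtain K1 h1 G1 M1 where 1: "compact K1" "K1 \<subseteq> (\<Union>i<N. S i)" "measure lebesgue ((\<Union>i<N. S i) - K1) \<le> e / 2"
    "jet_bound UNIV h1 G1 M1" "\<forall>x\<in>K1. f x = h1 x" by blast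
  obtain K2 where 2: "compact K2" "K2 \<subseteq> S N" "measure lebesgue (S N - K2) < e / 2"
    using lmeasurable_inner_compact[of "S N" "e / 2"] Suc.prems by auto
  obtain G2 M2 where j2: "jet_bound UNIV (g N) G2 M2" using Suc.prems(4)[of N] by blast
  have "S i \<inter> S N = {}" if "i < N" for i using Suc.prems(3)[of i N] that by simp
  then have "K1 \<inter> K2 = {}" using 1(2) 2(2) by blast
  then obtain h G M where h: "jet_bound UNIV h G M" "\<And>x. x \<in> K1 \<Longrightarrow> h x = h1 x" "\<And>x. x \<in> K2 \<Longrightarrow> h x = g N x"
    using C11_glue[OF 1(4) j2 1(1) 2(1)] by metis
  have UN: "(\<Union>i<Suc N. S i) = (\<Union>i<N. S i) \<union> S N" by (auto simp: less_Suc_eq)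
  have S1: "(\<Union>i<N. S i) \<in> sets lebesgue" using Suc.prems(1) by (intro sets.finite_UN) auto
  have b1: "bounded (\<Union>i<N. S i)" using Suc.prems(2) by (intro bounded_UN) auto
  have KL: "K1 \<in> sets lebesgue" "K2 \<in> sets lebesgue" using 1(1) 2(1) by (auto intro: fmeasurableD lmeasurable_compact)
  have m1: "(\<Union>i<N. S i) - K1 \<in> lmeasurable"
    using S1 KL b1 by (intro bounded_set_imp_lmeasurable) (auto intro: bounded_subset)
  have m2: "S N - K2 \<in> lmeasurable"
    using Suc.prems(1)[of N] Suc.prems(2)[of N] KL by (intro bounded_set_imp_lmeasurable) (auto intro: bounded_subset)
  have "measure lebesgue ((\<Union>i<Suc N. S i) - (K1 \<union> K2)) \<le> measure lebesgue (((\<Union>i<N. S i) - K1) \<union> (S N - K2))"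
    unfolding UN using m1 m2 S1 Suc.prems(1)[of N] KL by (intro measure_mono_fmeasurable fmeasurable.Un) auto
  also have "\<dots> \<le> measure lebesgue ((\<Union>i<N. S i) - K1) + measure lebesgue (S N - K2)"
    using m1 m2 by (intro measure_Un_le) (auto dest: fmeasurableD)
  also have "\<dots> \<le> e" using 1(3) 2(3) by simp
  finally have "measure lebesgue ((\<Union>i<Suc N. S i) - (K1 \<union> K2)) \<le> e" .
  moreover have "K1 \<union> K2 \<subseteq> (\<Union>i<Suc N. S i)" unfolding UN using 1(2) 2(2) by blast
  moreover have "f x = h x" if "x \<in> K1 \<union> K2" for x
    using that 1(5) h(2,3) 2(2) Suc.prems(5)[of N x] by auto
  ultimately show ?case using h(1) compact_Un[OF 1(1) 2(1)] by blast
qed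

text \<open>Three losses of e/3: keeping finitely many of the disjointed agreement sets, shrinking
  them to compact sets, and replacing the glued C^{1,1} function by a C^2 one. Gluing proceeds pair
  by pair, hence the reduction to finitely many pieces.\<close>

lemma bounded_lusin_C2:
  fixes f :: "'a::euclidean_space \<Rightarrow> real"
  assumes \<Omega>: "\<Omega> \<in> sets lebesgue" "bounded \<Omega>"
    and \<G>: "countable \<G>" "\<And>g. g \<in> \<G> \<Longrightarrow> \<exists>G M. jet_bound UNIV g G M"
    and neg: "negligible {x \<in> \<Omega>. \<forall>g\<in>\<G>. f x \<noteq> g x}"
    and meas: "\<And>g. continuous_on UNIV g \<Longrightarrow> {x \<in> \<Omega>. f x \<noteq> g x} \<in> sets lebesgue"
    and e: "e > 0"
  obtains \<phi> where "C2_on_UNIV \<phi>" "measure lebesgue {x \<in> \<Omega>. f x \<noteq> \<phi> x} \<le> e"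
proof (cases "\<G> = {}")
  case True
  then have "negligible {x \<in> \<Omega>. f x \<noteq> 0}" using neg by (rule_tac negligible_subset) auto
  then show thesis using that[OF C2_on_UNIV_const[of 0]] e by (simp add: negligible_imp_measure0)
next
  case False
  define g where "g = from_nat_into \<G>"
  have rg: "range g = \<G>" using False \<G>(1) by (simp add: g_def range_from_nat_into)
  have gj: "\<exists>G M. jet_bound UNIV (g i) G M" for i using \<G>(2) rg by blast
  have gc: "continuous_on UNIV (g i)" for i using gj[of i] jet_bound_continuous by blast
  define T where "T i = {x \<in> \<Omega>. f x = g i x}" for i
  have "T i = \<Omega> - {x \<in> \<Omega>. f x \<noteq> g i x}" for i by (auto simp: T_def)
  then have Tm: "T i \<in> sets lebesgue" for i using \<Omega>(1) meas[OF gc] by simp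
  define S where "S = disjointed T"
  have Ssub: "S i \<subseteq> T i" for i by (simp add: S_def disjointed_subset)
  have Sm: "S i \<in> sets lebesgue" for i
    using sets.range_disjointed_sets[of T lebesgue] Tm unfolding S_def by blast
  have Sb: "bounded (S i)" for i using Ssub[of i] \<Omega>(2) by (rule_tac bounded_subset[OF \<Omega>(2)]) (auto simp: T_def)
  have UNS: "(\<Union>i. S i) = (\<Union>i. T i)" unfolding S_def by (rule UN_disjointed_eq)
  define A where "A n = \<Omega> - (\<Union>i<n. S i)" for n
  have As: "A n \<in> sets lebesgue" for n using \<Omega>(1) Sm unfolding A_def by auto
  have Am: "A n \<in> lmeasurable" for n
    using As[of n] by (rule_tac bounded_set_imp_lmeasurable) (auto intro: bounded_subset[OF \<Omega>(2)] simp: A_def)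
  have "(\<lambda>n. measure lebesgue (A n)) \<longlonglongrightarrow> measure lebesgue (\<Inter>n. A n)"
  proof (rule Lim_measure_decseq)
    show "range A \<subseteq> sets lebesgue" using As by blast
    show "decseq A" unfolding decseq_def A_def by fastforce
    show "emeasure lebesgue (A n) \<noteq> \<infinity>" for n using fmeasurableD2[OF Am] by simp
  qed
  moreover have "negligible (\<Inter>n. A n)"
  proof (rule negligible_subset[OF neg], rule subsetI)
    fix x assume x: "x \<in> (\<Inter>n. A n)"
    have xO: "x \<in> \<Omega>" using x by (auto simp: A_def)
    have "x \<notin> S i" for i using INT_D[OF x, of "Suc i"] by (auto simp: A_def)
    then have "x \<notin> (\<Union>i. T i)" unfolding UNS[symmetric] by blast
    then have "f x \<noteq> g i x" for i using xO by (auto simp: T_def)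
    then have "\<forall>h\<in>range g. f x \<noteq> h x" by blast
    then show "x \<in> {x \<in> \<Omega>. \<forall>g\<in>\<G>. f x \<noteq> g x}" using xO by (simp add: rg)
  qed
  ultimately have "(\<lambda>n. measure lebesgue (A n)) \<longlonglongrightarrow> 0" by (simp add: negligible_imp_measure0)
  then have "\<forall>\<^sub>F n in sequentially. measure lebesgue (A n) < e / 3" using order_tendstoD(2)[of _ 0 _ "e / 3"] e by simp
  then obtain N where N: "measure lebesgue (A N) < e / 3" by (auto simp: eventually_sequentially)
  have "\<exists>K h G M. compact K \<and> K \<subseteq> (\<Union>i<N. S i) \<and> measure lebesgue ((\<Union>i<N. S i) - K) \<le> e / 3 \<and>
           jet_bound UNIV h G M \<and> (\<forall>x\<in>K. f x = h x)"
  proof (rule C11_agrees_on_finite_UN[OF Sm Sb _ gj])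
    show "S i \<inter> S j = {}" if "i \<noteq> j" for i j
      using disjoint_family_disjointed[of T] that unfolding S_def disjoint_family_on_def by blast
    show "f x = g i x" if "x \<in> S i" for i x using that Ssub[of i] by (auto simp: T_def)
  qed (use e in auto)
  then obtain K h G M where K: "compact K" "K \<subseteq> (\<Union>i<N. S i)" "measure lebesgue ((\<Union>i<N. S i) - K) \<le> e / 3"
    and h: "jet_bound UNIV h G M" "\<forall>x\<in>K. f x = h x" by blast
  obtain R where R: "R > 0" "\<Omega> \<subseteq> cball 0 R" using \<Omega>(2) by (metis bounded_pos mem_cball_0 subsetI)
  have "e / 3 > 0" using e by simp
  then obtain \<phi> where \<phi>: "C2_on_UNIV \<phi>" "measure lebesgue {x \<in> cball 0 R. h x \<noteq> \<phi> x} \<le> e / 3"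
    using C11_lusin_C2[OF h(1) R(1)] by blast
  let ?B = "(\<Union>i<N. S i) - K" and ?C = "{x \<in> cball 0 R. h x \<noteq> \<phi> x}"
  have Bm: "?B \<in> lmeasurable"
  proof (rule bounded_set_imp_lmeasurable)
    show "bounded ?B" using Ssub by (rule_tac bounded_subset[OF \<Omega>(2)]) (auto simp: T_def)
    show "?B \<in> sets lebesgue" using Sm fmeasurableD[OF lmeasurable_compact[OF K(1)]] by auto
  qed
  have Cm: "?C \<in> lmeasurable"
  proof (rule bounded_set_imp_lmeasurable)
    show "bounded ?C" by (rule bounded_subset[OF bounded_cball[of 0 R]]) blast
    show "?C \<in> sets lebesgue"
      by (rule neq_sets_lebesgue[OF jet_bound_continuous[OF h(1)] C2_on_UNIV_continuous[OF \<phi>(1)]]) simp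
  qed
  have sub: "{x \<in> \<Omega>. f x \<noteq> \<phi> x} \<subseteq> A N \<union> ?B \<union> ?C"
  proof
    fix x assume x: "x \<in> {x \<in> \<Omega>. f x \<noteq> \<phi> x}"
    then have "x \<in> cball 0 R" using R(2) by blast
    then show "x \<in> A N \<union> ?B \<union> ?C" using x h(2) by (auto simp: A_def)
  qed
  have "measure lebesgue {x \<in> \<Omega>. f x \<noteq> \<phi> x} \<le> measure lebesgue (A N \<union> ?B \<union> ?C)"
    by (rule measure_mono_fmeasurable[OF sub meas[OF C2_on_UNIV_continuous[OF \<phi>(1)]]]) (intro fmeasurable.Un Am Bm Cm)
  also have "\<dots> \<le> measure lebesgue (A N) + measure lebesgue ?B + measure lebesgue ?C"
    using measure_Un_le[of "A N \<union> ?B" lebesgue ?C] measure_Un_le[of "A N" lebesgue ?B]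
      fmeasurableD[OF Am] fmeasurableD[OF Bm] fmeasurableD[OF Cm] by (simp add: sets.Un)
  also have "\<dots> \<le> e" using N K(3) \<phi>(2) by linarith
  finally show thesis by (rule that[OF \<phi>(1)])
qed

text \<open>Pasting over the shells \<open>k < |x|\<^sup>2 < k + 1\<close>.\<close>

lemma lusin_C2_of_C11_cover:
  fixes f :: "'a::euclidean_space \<Rightarrow> real"
  assumes \<Omega>: "\<Omega> \<in> sets lebesgue"
    and \<G>: "countable \<G>" "\<And>g. g \<in> \<G> \<Longrightarrow> \<exists>G M. jet_bound UNIV g G M"
    and neg: "negligible {x \<in> \<Omega>. \<forall>g\<in>\<G>. f x \<noteq> g x}"
    and meas: "\<And>g. continuous_on UNIV g \<Longrightarrow> {x \<in> \<Omega>. f x \<noteq> g x} \<in> sets lebesgue"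
    and e: "e > 0"
  obtains \<phi> where "C2_on_UNIV \<phi>" "emeasure lebesgue {x \<in> \<Omega>. f x \<noteq> \<phi> x} \<le> ennreal e"
proof -
  \<comment> \<open>A polynomial in |x|^2, positive exactly on the shell; using |x|^2 instead of |x|
    keeps it smooth at the origin.\<close>
  define w where "w k x = ((norm x)\<^sup>2 - real k) * ((real k + 1) - (norm x)\<^sup>2)" for k and x :: 'a
  define U where "U k = {x :: 'a. w k x > 0}" for k
  have wC2: "C2_on_UNIV (w k)" for k
    unfolding w_def by (intro C2_on_UNIV_mult C2_on_UNIV_diff C2_on_UNIV_const C2_on_UNIV_norm_square)
  have wc: "continuous_on S (w k)" for k S by (rule C2_on_UNIV_continuous[OF wC2])
  have U: "x \<in> U k \<longleftrightarrow> real k < (norm x)\<^sup>2 \<and> (norm x)\<^sup>2 < real k + 1" for x k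
    by (auto simp: U_def w_def zero_less_mult_iff)
  have Uo: "open (U k)" for k unfolding U_def by (intro open_Collect_less wc continuous_intros)
  have Ub: "bounded (U k)" for k
  proof (rule bounded_subset[OF bounded_cball[of 0 "real k + 1"]], rule subsetI)
    fix x assume "x \<in> U k"
    then have "(norm x)\<^sup>2 \<le> (real k + 1)\<^sup>2" unfolding U by (smt (verit) of_nat_0_le_iff self_le_power zero_less_numeral power2_eq_square mult_left_mono)
    then have "norm x \<le> real k + 1" by (rule power2_le_imp_le) simp
    then show "x \<in> cball 0 (real k + 1)" by simp
  qed
  have Us: "U k \<in> sets lebesgue" for k using Uo by auto
  define \<delta> where "\<delta> k = e / 2 ^ Suc k / 2" for k
  have \<delta>: "\<delta> k > 0" for k using e by (simp add: \<delta>_def)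
  have "\<exists>\<psi>. C2_on_UNIV \<psi> \<and> (\<forall>x. x \<notin> U k \<longrightarrow> \<psi> x = 0) \<and> measure lebesgue {x \<in> \<Omega> \<inter> U k. f x \<noteq> \<psi> x} \<le> e / 2 ^ Suc k" for k
  proof -
    have mk: "{x \<in> \<Omega> \<inter> U k. f x \<noteq> h x} \<in> sets lebesgue" if "continuous_on UNIV h" for h
    proof -
      have "{x \<in> \<Omega> \<inter> U k. f x \<noteq> h x} = {x \<in> \<Omega>. f x \<noteq> h x} \<inter> U k" by auto
      then show ?thesis using meas[OF that] Us by simp
    qed
    obtain \<phi> where \<phi>: "C2_on_UNIV \<phi>" "measure lebesgue {x \<in> \<Omega> \<inter> U k. f x \<noteq> \<phi> x} \<le> \<delta> k"
    proof (rule bounded_lusin_C2[of "\<Omega> \<inter> U k" \<G> f "\<delta> k"])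
      show "negligible {x \<in> \<Omega> \<inter> U k. \<forall>g\<in>\<G>. f x \<noteq> g x}" by (rule negligible_subset[OF neg]) auto
      show "bounded (\<Omega> \<inter> U k)" using Ub bounded_subset by blast
      show "\<Omega> \<inter> U k \<in> sets lebesgue" using \<Omega> Us by auto
    qed (use \<G> mk \<delta> in auto)
    obtain K where K: "compact K" "K \<subseteq> U k" "measure lebesgue (U k - K) < \<delta> k"
      using lmeasurable_inner_compact[OF Us Ub \<delta>] by blast
    \<comment> \<open>On the compact \<open>K\<close> inside the shell \<open>w k\<close> is bounded
      below by a positive number; scaling it to at least 1 makes the cutoff equal to 1 on all of
      \<open>K\<close>.\<close>
    obtain c where c: "\<And>x. x \<in> K \<Longrightarrow> c * w k x \<ge> 1" "c > 0"
    proof (cases "K = {}")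
      case True then show thesis using that[of 1] by simp
    next
      case False
      obtain x0 where x0: "x0 \<in> K" "\<And>x. x \<in> K \<Longrightarrow> w k x0 \<le> w k x"
        using continuous_attains_inf[OF K(1) False wc] by blast
      have p: "w k x0 > 0" using x0(1) K(2) by (auto simp: U_def)
      show thesis
      proof (rule that[of "1 / w k x0"])
        show "1 \<le> 1 / w k x0 * w k x" if "x \<in> K" for x using x0(2)[OF that] p by (simp add: field_simps)
      qed (use p in simp)
    qed
    obtain \<zeta> where \<zeta>: "C2_on_UNIV \<zeta>" "\<And>x. c * w k x \<le> 0 \<Longrightarrow> \<zeta> x = 0" "\<And>x. c * w k x \<ge> 1 \<Longrightarrow> \<zeta> x = 1"
      using C2_cutoff[OF C2_on_UNIV_mult[OF C2_on_UNIV_const[of c] wC2[of k]]] by blast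
    let ?\<psi> = "\<lambda>x. \<zeta> x * \<phi> x"
    have \<psi>: "C2_on_UNIV ?\<psi>" by (rule C2_on_UNIV_mult[OF \<zeta>(1) \<phi>(1)])
    have z: "?\<psi> x = 0" if "x \<notin> U k" for x
    proof -
      have "w k x \<le> 0" using that by (simp add: U_def)
      then have "c * w k x \<le> 0" using c(2) by (simp add: mult_nonneg_nonpos)
      then show ?thesis using \<zeta>(2) by simp
    qed
    let ?A = "{x \<in> \<Omega> \<inter> U k. f x \<noteq> \<phi> x}"
    have Am: "?A \<in> lmeasurable"
    proof (rule bounded_set_imp_lmeasurable)
      show "bounded ?A" by (rule bounded_subset[OF Ub[of k]]) blast
      show "?A \<in> sets lebesgue" by (rule mk[OF C2_on_UNIV_continuous[OF \<phi>(1)]])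
    qed
    have Bm: "U k - K \<in> lmeasurable"
    proof (rule bounded_set_imp_lmeasurable)
      show "bounded (U k - K)" by (rule bounded_subset[OF Ub[of k]]) blast
      show "U k - K \<in> sets lebesgue" using Us fmeasurableD[OF lmeasurable_compact[OF K(1)]] by (rule sets.Diff)
    qed
    have sub: "{x \<in> \<Omega> \<inter> U k. f x \<noteq> ?\<psi> x} \<subseteq> ?A \<union> (U k - K)"
    proof
      fix x assume x: "x \<in> {x \<in> \<Omega> \<inter> U k. f x \<noteq> ?\<psi> x}"
      show "x \<in> ?A \<union> (U k - K)"
      proof (cases "x \<in> K")
        case True
        then have "\<zeta> x = 1" using c(1) \<zeta>(3) by blast
        then show ?thesis using x by simp
      qed (use x in auto)
    qed
    have "measure lebesgue {x \<in> \<Omega> \<inter> U k. f x \<noteq> ?\<psi> x} \<le> measure lebesgue (?A \<union> (U k - K))"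
      by (rule measure_mono_fmeasurable[OF sub mk[OF C2_on_UNIV_continuous[OF \<psi>]] fmeasurable.Un[OF Am Bm]])
    also have "\<dots> \<le> measure lebesgue ?A + measure lebesgue (U k - K)"
      by (rule measure_Un_le[OF fmeasurableD[OF Am] fmeasurableD[OF Bm]])
    also have "\<dots> \<le> \<delta> k + \<delta> k" using \<phi>(2) K(3) by linarith
    also have "\<dots> = e / 2 ^ Suc k" unfolding \<delta>_def by simp
    finally show ?thesis using \<psi> z by blast
  qed
  then obtain \<psi> where \<psi>: "\<And>k. C2_on_UNIV (\<psi> k)" "\<And>k x. x \<notin> U k \<Longrightarrow> \<psi> k x = 0"
    "\<And>k. measure lebesgue {x \<in> \<Omega> \<inter> U k. f x \<noteq> \<psi> k x} \<le> e / 2 ^ Suc k" by metis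
  obtain \<Psi> H where C2: "\<And>k. C2_jet (\<psi> k) (\<Psi> k) (H k)"
    using \<psi>(1) unfolding C2_on_UNIV_iff_C2_jet by metis
  have C2s: "C2_on_UNIV (\<lambda>x. \<Sum>k. \<psi> k x)"
  proof (rule C2_on_UNIV_suminf[OF C2])
    fix r :: real
    \<comment> \<open>On a given ball only finitely many shells contribute, so a majorant with
      finite support is available.\<close>
    have zero: "\<psi> k x = 0 \<and> \<Psi> k x = 0 \<and> H k x = 0" if x: "norm x < r" and k: "r\<^sup>2 \<le> real k" for k x
    proof -
      have 0: "\<psi> k y = 0" if "y \<in> ball 0 r" for y
      proof (rule \<psi>(2))
        have "(norm y)\<^sup>2 \<le> r\<^sup>2" using that by (intro power_mono) auto
        then show "y \<notin> U k" using k unfolding U by linarith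
      qed
      have "x \<in> ball 0 r" using x by simp
      then show ?thesis using C2_jet_eq_0_on_open[OF C2 open_ball _ 0] 0 by blast
    qed
    have "\<exists>a. \<forall>x\<in>cball 0 r. norm (\<psi> k x) \<le> a \<and> norm (\<Psi> k x) \<le> a \<and> norm (H k x) \<le> a" for k
    proof -
      have bnd: "\<exists>B. \<forall>x\<in>cball 0 r. norm (h x) \<le> B" if "continuous_on (cball 0 r) h" for h :: "'a \<Rightarrow> 'b::real_normed_vector"
        using compact_imp_bounded[OF compact_continuous_image[OF that compact_cball]] unfolding bounded_iff by blast
      obtain a1 a2 a3 where "\<forall>x\<in>cball 0 r. norm (\<psi> k x) \<le> a1" "\<forall>x\<in>cball 0 r. norm (\<Psi> k x) \<le> a2"
          "\<forall>x\<in>cball 0 r. norm (H k x) \<le> a3"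
        using bnd[OF C2_jetD(5)[OF C2]] bnd[OF C2_jetD(4)[OF C2]] bnd[OF C2_jetD(3)[OF C2]] by metis
      then show ?thesis by (intro exI[of _ "max a1 (max a2 a3)"]) (auto simp: le_max_iff_disj)
    qed
    then obtain a where a: "\<And>k x. x \<in> cball 0 r \<Longrightarrow> norm (\<psi> k x) \<le> a k \<and> norm (\<Psi> k x) \<le> a k \<and> norm (H k x) \<le> a k"
      by metis
    obtain N :: nat where N: "r\<^sup>2 \<le> real N" using real_arch_simple by blast
    show "\<exists>a. summable a \<and> (\<forall>n x. norm x < r \<longrightarrow> norm (\<psi> n x) \<le> a n \<and> norm (\<Psi> n x) \<le> a n \<and> norm (H n x) \<le> a n)"
    proof (intro exI[of _ "\<lambda>n. if n < N then a n else 0"] conjI allI impI)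
      show "summable (\<lambda>n. if n < N then a n else 0)" by (rule summable_finite[of "{..<N}"]) auto
      fix n and x :: 'a assume x: "norm x < r"
      have "norm (\<psi> n x) \<le> (if n < N then a n else 0) \<and> norm (\<Psi> n x) \<le> (if n < N then a n else 0) \<and> norm (H n x) \<le> (if n < N then a n else 0)"
      proof (cases "n < N")
        case True then show ?thesis using a[of x n] x by simp
      next
        case False
        then have "r\<^sup>2 \<le> real n" using N by simp
        then show ?thesis using zero[OF x, of n] False by simp
      qed
      then show "norm (\<psi> n x) \<le> (if n < N then a n else 0)" "norm (\<Psi> n x) \<le> (if n < N then a n else 0)"
        "norm (H n x) \<le> (if n < N then a n else 0)" by blast+
    qed
  qed
  have single: "(\<Sum>k. \<psi> k x) = \<psi> n x" if x: "x \<in> U n" for x n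
  proof -
    have "\<psi> k x = 0" if "k \<noteq> n" for k
    proof (rule \<psi>(2))
      show "x \<notin> U k" using x that unfolding U by linarith
    qed
    then have "(\<lambda>k. \<psi> k x) = (\<lambda>k. if k = n then \<psi> k x else 0)" by auto
    then show ?thesis using sums_unique[OF sums_single[of n "\<lambda>k. \<psi> k x"]] by simp
  qed
  define B where "B k = {x \<in> \<Omega> \<inter> U k. f x \<noteq> \<psi> k x}" for k
  have Bm: "B k \<in> lmeasurable" for k
  proof (rule bounded_set_imp_lmeasurable)
    show "bounded (B k)" unfolding B_def by (rule bounded_subset[OF Ub[of k]]) blast
    have "B k = {x \<in> \<Omega>. f x \<noteq> \<psi> k x} \<inter> U k" by (auto simp: B_def)
    then show "B k \<in> sets lebesgue" using meas[OF C2_on_UNIV_continuous[OF \<psi>(1)]] Us by simp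
  qed
  have B: "(\<Union>k. B k) \<in> lmeasurable" "measure lebesgue (\<Union>k. B k) \<le> e"
    using measure_UN_geometric[OF Bm \<psi>(3)[folded B_def]] by auto
  \<comment> \<open>The spheres between the shells (and the origin), where every
    \<open>\<psi> k\<close> vanishes, form a null set.\<close>
  define Z where "Z = (\<Union>k::nat. sphere (0::'a) (sqrt (real k)))"
  have Z: "negligible Z" unfolding Z_def by (intro negligible_countable_Union) (auto intro: negligible_sphere)
  have sub: "{x \<in> \<Omega>. f x \<noteq> (\<Sum>k. \<psi> k x)} \<subseteq> (\<Union>k. B k) \<union> Z"
  proof
    fix x assume x: "x \<in> {x \<in> \<Omega>. f x \<noteq> (\<Sum>k. \<psi> k x)}"
    define n where "n = nat \<lfloor>(norm x)\<^sup>2\<rfloor>"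
    have n: "real n \<le> (norm x)\<^sup>2" "(norm x)\<^sup>2 < real n + 1" unfolding n_def by (auto simp: of_nat_nat)
    show "x \<in> (\<Union>k. B k) \<union> Z"
    proof (cases "real n = (norm x)\<^sup>2")
      case True
      then have "x \<in> sphere 0 (sqrt (real n))" by simp
      then show ?thesis unfolding Z_def by blast
    next
      case False
      then have "x \<in> U n" using n unfolding U by simp
      then have "x \<in> B n" using x single[of x n] by (simp add: B_def)
      then show ?thesis by blast
    qed
  qed
  have BZ: "(\<Union>k. B k) \<union> Z \<in> lmeasurable" by (intro fmeasurable.Un B(1) negligible_imp_measurable[OF Z])
  have "emeasure lebesgue {x \<in> \<Omega>. f x \<noteq> (\<Sum>k. \<psi> k x)} \<le> emeasure lebesgue ((\<Union>k. B k) \<union> Z)"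
    by (rule emeasure_mono[OF sub fmeasurableD[OF BZ]])
  also have "\<dots> = ennreal (measure lebesgue ((\<Union>k. B k) \<union> Z))" by (rule emeasure_eq_measure2[OF BZ])
  also have "\<dots> \<le> ennreal e"
  proof (rule ennreal_leI)
    have "measure lebesgue ((\<Union>k. B k) \<union> Z) \<le> measure lebesgue (\<Union>k. B k) + measure lebesgue Z"
      by (rule measure_Un_le[OF fmeasurableD[OF B(1)] fmeasurableD[OF negligible_imp_measurable[OF Z]]])
    then show "measure lebesgue ((\<Union>k. B k) \<union> Z) \<le> e" using B(2) Z by (simp add: negligible_imp_measure0)
  qed
  finally show thesis by (rule that[OF C2s])
qed

text \<open>Around a point of lower semicontinuity the superlevel set contains a relative
  neighbourhood in \<Omega>. It is therefore \<Omega> \<inter> V, with \<open>V\<close> open, up to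
  a subset of a null set, and completeness of Lebesgue measure concludes.\<close>

lemma almost_lsc_superlevel_sets:
  fixes f :: "'a::euclidean_space \<Rightarrow> real"
  assumes \<Omega>: "\<Omega> \<in> sets lebesgue"
    and lsc: "negligible {x \<in> \<Omega>. \<not> (\<forall>c<f x. \<exists>r>0. \<forall>y\<in>\<Omega>. norm (y - x) < r \<longrightarrow> c < f y)}"
  shows "{x \<in> \<Omega>. c < f x} \<in> sets lebesgue"
proof -
  define N where "N = {x \<in> \<Omega>. \<not> (\<forall>c<f x. \<exists>r>0. \<forall>y\<in>\<Omega>. norm (y - x) < r \<longrightarrow> c < f y)}"
  define V where "V = \<Union>{U. open U \<and> (\<forall>y\<in>\<Omega> \<inter> U. c < f y)}"
  have "open V" unfolding V_def by blast
  have "{x \<in> \<Omega>. c < f x} = (\<Omega> \<inter> V) \<union> ({x \<in> \<Omega>. c < f x} \<inter> N)"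
  proof -
    have "x \<in> V" if x: "x \<in> \<Omega>" "c < f x" "x \<notin> N" for x
    proof -
      obtain r where r: "r > 0" "\<forall>y\<in>\<Omega>. norm (y - x) < r \<longrightarrow> c < f y" using x unfolding N_def by blast
      then have "\<forall>y\<in>\<Omega> \<inter> ball x r. c < f y" by (auto simp: dist_norm norm_minus_commute)
      moreover have "x \<in> ball x r" using r(1) by simp
      ultimately show ?thesis unfolding V_def by blast
    qed
    moreover have "c < f x" if "x \<in> \<Omega>" "x \<in> V" for x using that unfolding V_def by blast
    ultimately show ?thesis by auto
  qed
  moreover have "negligible ({x \<in> \<Omega>. c < f x} \<inter> N)"
    using lsc[folded N_def] by (rule negligible_subset) blast
  then have "{x \<in> \<Omega>. c < f x} \<inter> N \<in> sets lebesgue" by (rule negligible_imp_sets)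
  moreover have "\<Omega> \<inter> V \<in> sets lebesgue" using \<Omega> \<open>open V\<close> by auto
  ultimately show ?thesis by (metis sets.Un)
qed

lemma superlevel_sets_imp_neq_sets:
  fixes f g :: "'a::euclidean_space \<Rightarrow> real"
  assumes \<Omega>: "\<Omega> \<in> sets lebesgue" and f: "\<And>c. {x \<in> \<Omega>. c < f x} \<in> sets lebesgue"
    and g: "continuous_on UNIV g"
  shows "{x \<in> \<Omega>. f x \<noteq> g x} \<in> sets lebesgue"
proof -
  have "f \<in> borel_measurable (lebesgue_on \<Omega>)"
    unfolding borel_measurable_iff_greater
    using f \<Omega> by (auto simp: sets_restrict_space_iff Int_absorb2 space_restrict_space subset_iff)
  moreover have "g \<in> borel_measurable (lebesgue_on \<Omega>)"
    using borel_measurable_continuous_onI[OF g] by (intro measurable_restrict_space1 measurable_completion) simp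
  ultimately have "{x \<in> space (lebesgue_on \<Omega>). f x \<noteq> g x} \<in> sets (lebesgue_on \<Omega>)" by (rule borel_measurable_neq)
  then show ?thesis using \<Omega> by (simp add: sets_restrict_space_iff space_restrict_space)
qed

text \<open>The punctured filter leaves out y = x, where the bound is an equality. At an isolated
  point of \<Omega> the filter is trivial and the argument is vacuous away from x.\<close>

lemma Liminf_quotient_imp_lower_bound:
  fixes f :: "'a::euclidean_space \<Rightarrow> real"
  assumes "Liminf (at x within \<Omega>) (\<lambda>y. ereal ((f y - f x - \<xi> \<bullet> (y - x)) / (norm (y - x))^2)) > -\<infinity>"
  obtains K r where "r > 0" "\<And>y. y \<in> \<Omega> \<Longrightarrow> norm (y - x) < r \<Longrightarrow> f y \<ge> f x + \<xi> \<bullet> (y - x) - K * (norm (y - x))\<^sup>2"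
proof -
  let ?q = "\<lambda>y. (f y - f x - \<xi> \<bullet> (y - x)) / (norm (y - x))^2"
  obtain c where c: "ereal c < Liminf (at x within \<Omega>) (\<lambda>y. ereal (?q y))"
    using assms ereal_dense2 by blast
  then have "\<forall>\<^sub>F y in at x within \<Omega>. ereal c < ereal (?q y)" by (rule less_LiminfD)
  then obtain r where r: "r > 0" "\<And>y. y \<in> \<Omega> \<Longrightarrow> y \<noteq> x \<Longrightarrow> dist y x < r \<Longrightarrow> c < ?q y"
    unfolding eventually_at by auto
  show thesis
  proof (rule that[OF r(1), of "- c"])
    fix y assume y: "y \<in> \<Omega>" "norm (y - x) < r"
    show "f y \<ge> f x + \<xi> \<bullet> (y - x) - (- c) * (norm (y - x))\<^sup>2"
    proof (cases "y = x")
      case False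
      then have "c < ?q y" using r(2) y by (simp add: dist_norm)
      then show ?thesis using False by (simp add: field_simps)
    qed simp
  qed
qed

lemma lower_bound_imp_lsc:
  fixes f :: "'a::euclidean_space \<Rightarrow> real"
  assumes r: "r > 0" and low: "\<And>y. y \<in> \<Omega> \<Longrightarrow> norm (y - x) < r \<Longrightarrow> f y \<ge> f x + \<xi> \<bullet> (y - x) - K * (norm (y - x))\<^sup>2"
    and c: "c < f x"
  shows "\<exists>r>0. \<forall>y\<in>\<Omega>. norm (y - x) < r \<longrightarrow> c < f y"
proof -
  let ?h = "\<lambda>y. f x + \<xi> \<bullet> (y - x) - K * (norm (y - x))\<^sup>2"
  have "open {y. c < ?h y}" by (intro open_Collect_less continuous_intros)
  moreover have "x \<in> {y. c < ?h y}" using c by simp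
  ultimately obtain s where s: "s > 0" "ball x s \<subseteq> {y. c < ?h y}" by (meson openE)
  show ?thesis
  proof (intro exI[of _ "min r s"] conjI ballI impI)
    fix y assume y: "y \<in> \<Omega>" "norm (y - x) < min r s"
    then have "y \<in> ball x s" by (simp add: dist_norm norm_minus_commute)
    then show "c < f y" using s(2) low[of y] y by fastforce
  qed (use r s in simp)
qed

theorem theorem2:
  fixes \<Omega> :: "'a::euclidean_space set" and f :: "'a \<Rightarrow> real"
  assumes "\<Omega> \<in> sets lebesgue"
    and "AE x in lebesgue. x \<in> \<Omega> \<longrightarrow>
           (\<exists>\<xi>::'a. Liminf (at x within \<Omega>)
              (\<lambda>y. ereal ((f y - f x - \<xi> \<bullet> (y - x)) / (norm (y - x))^2)) > -\<infinity>)"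
    and "\<epsilon> > 0"
  shows "\<exists>g. C2_on_UNIV g \<and> {x \<in> \<Omega>. f x \<noteq> g x} \<in> sets lebesgue \<and>
             emeasure lebesgue {x \<in> \<Omega>. f x \<noteq> g x} \<le> ennreal \<epsilon>"
proof -
  let ?P = "\<lambda>x. \<exists>\<xi> K r. r > 0 \<and> (\<forall>y\<in>\<Omega>. norm (y - x) < r \<longrightarrow>
      f y \<ge> f x + \<xi> \<bullet> (y - x) - K * (norm (y - x))\<^sup>2)"
  have "AE x in lebesgue. x \<in> \<Omega> \<longrightarrow> ?P x"
    using assms(2)
  proof eventually_elim
    case (elim x)
    show ?case
    proof
      assume "x \<in> \<Omega>"
      with elim obtain \<xi> where "Liminf (at x within \<Omega>)
        (\<lambda>y. ereal ((f y - f x - \<xi> \<bullet> (y - x)) / (norm (y - x))^2)) > -\<infinity>" by blast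
      from Liminf_quotient_imp_lower_bound[OF this] show "?P x" by metis
    qed
  qed
  then obtain N where N: "N \<in> null_sets lebesgue" "{x \<in> space lebesgue. \<not> (x \<in> \<Omega> \<longrightarrow> ?P x)} \<subseteq> N"
    by (rule AE_E3) blast
  have "{x \<in> \<Omega>. \<not> ?P x} \<subseteq> N" using N(2) by auto
  moreover have "negligible N" using N(1) by (simp add: negligible_iff_null_sets)
  ultimately have neg: "negligible {x \<in> \<Omega>. \<not> ?P x}" by (rule negligible_subset[rotated])
  \<comment> \<open>Measurability of the set in the conclusion has to be earned from the lower
    bounds, through lower semicontinuity almost everywhere.\<close>
  have "negligible {x \<in> \<Omega>. \<not> (\<forall>c<f x. \<exists>r>0. \<forall>y\<in>\<Omega>. norm (y - x) < r \<longrightarrow> c < f y)}"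
  proof (rule negligible_subset[OF neg], rule Collect_mono, intro impI, elim conjE, intro conjI)
    fix x assume x: "\<not> (\<forall>c<f x. \<exists>r>0. \<forall>y\<in>\<Omega>. norm (y - x) < r \<longrightarrow> c < f y)"
    show "\<not> ?P x"
    proof
      assume "?P x"
      then obtain \<xi> K r where "r > 0" "\<And>y. y \<in> \<Omega> \<Longrightarrow> norm (y - x) < r \<Longrightarrow> f y \<ge> f x + \<xi> \<bullet> (y - x) - K * (norm (y - x))\<^sup>2"
        by blast
      then show False using x lower_bound_imp_lsc[of r \<Omega> x f \<xi> K] by blast
    qed
  qed
  then have meas: "{x \<in> \<Omega>. f x \<noteq> g x} \<in> sets lebesgue" if "continuous_on UNIV g" for g
    using superlevel_sets_imp_neq_sets[OF assms(1) almost_lsc_superlevel_sets[OF assms(1)] that] by blast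
  show ?thesis
  proof (rule C11_decomposition[OF neg])
    fix \<G> assume \<G>: "countable \<G>" "\<And>g. g \<in> \<G> \<Longrightarrow> \<exists>G M. jet_bound UNIV g G M"
      "negligible {x \<in> \<Omega>. \<forall>g\<in>\<G>. f x \<noteq> g x}"
    show ?thesis
    proof (rule lusin_C2_of_C11_cover[OF assms(1) \<G> meas assms(3)])
      fix \<phi> assume "C2_on_UNIV \<phi>" "emeasure lebesgue {x \<in> \<Omega>. f x \<noteq> \<phi> x} \<le> ennreal \<epsilon>"
      then show ?thesis using meas[OF C2_on_UNIV_continuous] by blast
    qed
  qed
qed

end
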